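(* Let $(X,Y)$ be a two-dimensional random variable and let $(X_1,Y_1),\dots,(X_n,Y_n)$ be i.i.d. copies of $(X,Y)$. Let $S_n=(X_1+\cdots+X_n)/\sqrt n$ and $\mathbf{Y}_n=(Y_1,\dots,Y_n)$. Assume: (1) for $\mathbb{P}_Y$-almost every $y$, the conditional law of $X$ given $Y=y$ is absolutely continuous with respect to Lebesgue measure and has an absolutely continuous density; (2) there exist $u>3$ and $k>6$ with $\mathbb{E}|X|^k<\infty$, $\mathbb{E}J^u(X|Y):=\int J^u(X|Y=y)\,\mathbb{P}_Y(dy)<\infty$, and \[ \alpha:=\frac6k+\frac3u<1. \] Then for every $\varepsilon\in\big(0,\frac{1-\alpha}{4+\alpha}\big)$, \[ \mathbb{E}D(S_n|\mathbf{Y}_n):=\int D(S_n|\mathbf{Y}_n=\mathbf{y}_n)\,\mathbb{P}_{\mathbf{Y}_n}(d\mathbf{y}_n)=O\!\left(\Big(\frac1n\Big)^{\frac{1-\alpha}{4+\alpha}-\varepsilon}\right)\quad(n\to\infty). \]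
   Context: For a random variable $Z$ with absolutely continuous density $p$, $J(Z)=\int|p'|^2/p$ is its Fisher information, and $D(Z)$ is the Kullback–Leibler divergence of the law of $Z$ from the Gaussian law with the same mean and variance as $Z$. $J(X|Y=y)$ and $D(S_n|\mathbf{Y}_n=\mathbf{y}_n)$ denote these quantities computed for the conditional law of $X$ given $Y=y$, respectively of $S_n$ given $\mathbf{Y}_n=\mathbf{y}_n$. *)

theory Defs
  imports "HOL-Probability.Probability"
begin

definition abs_cont_on_interval :: "(real \<Rightarrow> real) \<Rightarrow> real \<Rightarrow> real \<Rightarrow> bool" where
  "abs_cont_on_interval f a b \<longleftrightarrow>
     (\<forall>e>0. \<exists>d>0. \<forall>(n::nat) (l::nat \<Rightarrow> real) (r::nat \<Rightarrow> real).
        (\<forall>i<n. a \<le> l i \<and> l i \<le> r i \<and> r i \<le> b) \<longrightarrow>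
        (\<forall>i<n. \<forall>j<n. i \<noteq> j \<longrightarrow> r i \<le> l j \<or> r j \<le> l i) \<longrightarrow>
        (\<Sum>i<n. r i - l i) < d \<longrightarrow> (\<Sum>i<n. \<bar>f (r i) - f (l i)\<bar>) < e)"

definition abs_cont_real :: "(real \<Rightarrow> real) \<Rightarrow> bool" where
  "abs_cont_real f \<longleftrightarrow> (\<forall>a b. abs_cont_on_interval f a b)"

text \<open>Fisher information of a density p: integral of (p')^2/p (over the set where p > 0,
  since division by zero gives zero), as an extended nonnegative real.\<close>
definition fisher_info :: "(real \<Rightarrow> real) \<Rightarrow> ennreal" where
  "fisher_info p = (\<integral>\<^sup>+ x. ennreal ((deriv p x)\<^sup>2 / p x) \<partial>lborel)"

definition dens_mean :: "(real \<Rightarrow> real) \<Rightarrow> real" where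
  "dens_mean p = (\<integral> x. x * p x \<partial>lborel)"

definition dens_var :: "(real \<Rightarrow> real) \<Rightarrow> real" where
  "dens_var p = (\<integral> x. (x - dens_mean p)\<^sup>2 * p x \<partial>lborel)"

text \<open>Kullback-Leibler divergence D of the law with density p from the Gaussian law with the
  same mean and variance: \<open>\<integral> p ln (p/g)\<close>, written with the (integral-zero) correction
  \<open>- p + g\<close> so that the integrand is pointwise nonnegative.\<close>
definition gauss_KL :: "(real \<Rightarrow> real) \<Rightarrow> ennreal" where
  "gauss_KL p = (let g = normal_density (dens_mean p) (sqrt (dens_var p)) in
     \<integral>\<^sup>+ x. ennreal (p x * ln (p x / g x) - p x + g x) \<partial>lborel)"

definition cond_density ::
  "'a measure \<Rightarrow> ('a \<Rightarrow> real) \<Rightarrow> ('a \<Rightarrow> 'b) \<Rightarrow> 'b measure \<Rightarrow> ('b \<Rightarrow> real \<Rightarrow> real) \<Rightarrow> bool" where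
  "cond_density M Z W N q \<longleftrightarrow>
     (\<lambda>(w, x). q w x) \<in> borel_measurable (N \<Otimes>\<^sub>M borel) \<and> (\<forall>w x. 0 \<le> q w x) \<and>
     (\<forall>A\<in>sets borel. \<forall>B\<in>sets N.
        emeasure M {\<omega>\<in>space M. Z \<omega> \<in> A \<and> W \<omega> \<in> B}
        = (\<integral>\<^sup>+ w. indicator B w * (\<integral>\<^sup>+ x. ennreal (q w x) * indicator A x \<partial>lborel) \<partial>distr M N W))"

text \<open>Expected conditional divergence E D(Z|W) = \<integral> D(Z|W=w) dP_W(w), computed with some version of
  the conditional density (the value does not depend on the version).\<close>
definition exp_cond_gauss_KL ::
  "'a measure \<Rightarrow> ('a \<Rightarrow> real) \<Rightarrow> ('a \<Rightarrow> 'b) \<Rightarrow> 'b measure \<Rightarrow> ennreal" where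
  "exp_cond_gauss_KL M Z W N =
     (\<integral>\<^sup>+ w. gauss_KL ((SOME q. cond_density M Z W N q) w) \<partial>distr M N W)"

definition normalized_sum :: "(nat \<Rightarrow> 'a \<Rightarrow> real) \<Rightarrow> nat \<Rightarrow> 'a \<Rightarrow> real" where
  "normalized_sum X n \<omega> = (\<Sum>i<n. X i \<omega>) / sqrt (real n)"

definition vec_prefix :: "(nat \<Rightarrow> 'a \<Rightarrow> 'b) \<Rightarrow> nat \<Rightarrow> 'a \<Rightarrow> (nat \<Rightarrow> 'b)" where
  "vec_prefix Y n \<omega> = (\<lambda>i\<in>{..<n}. Y i \<omega>)"

end

theory Submission imports Defs "HOL-Real_Asymp.Real_Asymp" begin

text \<open>
  Fix \<open>y\<^sub>1, \<dots>, y\<^sub>n\<close>. Conditionally, \<open>S\<^sub>n\<close> is a normalized sum of independent variables with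
  Fisher informations \<open>J\<^sub>j\<close> and sixth moments \<open>c\<^sub>j\<close>. In total variation it is compared with the
  Gaussian of the same mean and variance by Lindeberg's replacement of one summand at a time. The test
  function is merely measurable; the smoothness needed for a third-order expansion comes from the other
  summands: split the indices into four blocks of \<open>n/4\<close>, three of which avoid the replaced index.
  Averaging over a block allows one differentiation at the price of the \<open>L\<^sup>1\<close>-norm of the averaged
  scores of its summands, which is \<open>O(n\<^sup>-\<^sup>1\<^sup>/\<^sup>2)\<close> times the root of the mean of the \<open>J\<^sub>j\<close>. The
  replacement errors add up to \<open>O(n\<^sup>-\<^sup>1\<^sup>/\<^sup>2)\<close> times the mean of \<open>J\<^sub>j\<^sup>3 + c\<^sub>j\<close>.

  A density with Fisher information \<open>J\<close> is bounded by \<open>\<surd>J\<close>, and equality of the variances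
  turns total variation \<open>\<delta>\<close> into divergence \<open>O(\<delta> ln n + \<surd>\<delta>)\<close>. Integrating over the \<open>y\<^sub>j\<close> bounds the
  expected divergence by \<open>O(n\<^sup>-\<^sup>1\<^sup>/\<^sup>4 ln\<^sup>2 n)\<close>, and \<open>(1 - \<alpha>)/(4 + \<alpha>) < 1/4\<close>.
\<close>

section \<open>The derivative of an absolutely continuous function\<close>

text \<open>The test function that attains total variation is the sign of a difference of densities,
  so no smoothness can be asked of it; derivatives must fall on the laws of the summands, which is
  what a score expresses. The Gaussian replacements must be as smooth as the originals: a law with
  information J has variance at least 1/(32 J), so the Gaussian of equal variance has information at
  most 32 J, and all intermediate products obey one bound. The replacement error has the shape
  mean(J)^(3/2) times mean(sqrt c); Young and Jensen turn it into means of J^3 and c, the moments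
  provided by u > 3 and k > 6. Passing to the divergence costs a square root of the variation bound,
  which leaves n^(-1/4). Two preparations are substantial. Absolute continuity is an epsilon-delta
  condition, so an integrable derivative with the fundamental theorem has to be built from it. And
  the expected divergence refers to an arbitrarily chosen conditional density, so such a density
  must be shown to exist and every version must be identified with the law of an independent
  sum.\<close>

definition nonoverlapping :: "'i set \<Rightarrow> ('i \<Rightarrow> real) \<Rightarrow> ('i \<Rightarrow> real) \<Rightarrow> bool" where
  "nonoverlapping I l r \<longleftrightarrow> (\<forall>i\<in>I. l i \<le> r i) \<and>
     (\<forall>i\<in>I. \<forall>j\<in>I. i \<noteq> j \<longrightarrow> r i \<le> l j \<or> r j \<le> l i)"

definition small_variation :: "(real \<Rightarrow> real) \<Rightarrow> real \<Rightarrow> real \<Rightarrow> real \<Rightarrow> real \<Rightarrow> 'i set \<Rightarrow> bool" where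
  "small_variation f a b e d I \<longleftrightarrow> (\<forall>l r. nonoverlapping I l r \<longrightarrow>
     (\<forall>i\<in>I. a \<le> l i \<and> r i \<le> b) \<longrightarrow> (\<Sum>i\<in>I. r i - l i) < d \<longrightarrow> (\<Sum>i\<in>I. \<bar>f (r i) - f (l i)\<bar>) < e)"

lemma small_variation_transfer:
  fixes I :: "'i set"
  assumes nat: "\<And>n. small_variation f a b e d {..<n::nat}" and fin: "finite I"
  shows "small_variation f a b e d I"
  unfolding small_variation_def
proof (intro allI impI)
  fix l r assume no: "nonoverlapping I l r" and ab: "\<forall>i\<in>I. a \<le> l i \<and> r i \<le> b"
    and len: "(\<Sum>i\<in>I. r i - l i) < d"
  obtain h where h: "bij_betw h {..<card I} I"
    using ex_bij_betw_nat_finite[OF fin] by (auto simp: lessThan_atLeast0)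
  have mem: "h i \<in> I" if "i < card I" for i using h that by (auto simp: bij_betw_def)
  have inj: "h i \<noteq> h j" if "i < card I" "j < card I" "i \<noteq> j" for i j
    using h that by (auto simp: bij_betw_def inj_on_def)
  have no': "nonoverlapping {..<card I} (l \<circ> h) (r \<circ> h)"
    unfolding nonoverlapping_def comp_def
  proof (intro conjI ballI impI)
    fix i j assume ij: "i \<in> {..<card I}" "j \<in> {..<card I}" "i \<noteq> j"
    then have "h i \<in> I" "h j \<in> I" "h i \<noteq> h j" using mem inj by simp_all
    then show "r (h i) \<le> l (h j) \<or> r (h j) \<le> l (h i)"
      using no unfolding nonoverlapping_def by blast
  next
    fix i assume "i \<in> {..<card I}"
    then show "l (h i) \<le> r (h i)" using no mem unfolding nonoverlapping_def by simp
  qed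
  have ab': "\<forall>i\<in>{..<card I}. a \<le> (l \<circ> h) i \<and> (r \<circ> h) i \<le> b" using ab mem by auto
  have len': "(\<Sum>i<card I. (r \<circ> h) i - (l \<circ> h) i) = (\<Sum>i\<in>I. r i - l i)"
    using sum.reindex_bij_betw[OF h, of "\<lambda>i. r i - l i"] by simp
  have "(\<Sum>i<card I. \<bar>f ((r \<circ> h) i) - f ((l \<circ> h) i)\<bar>) = (\<Sum>i\<in>I. \<bar>f (r i) - f (l i)\<bar>)"
    using sum.reindex_bij_betw[OF h, of "\<lambda>i. \<bar>f (r i) - f (l i)\<bar>"] by simp
  then show "(\<Sum>i\<in>I. \<bar>f (r i) - f (l i)\<bar>) < e"
    using nat[of "card I", unfolded small_variation_def, THEN spec, THEN spec, THEN mp, OF no', THEN mp, OF ab',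
        THEN mp] len len' by simp
qed

lemma abs_cont_small_variation:
  assumes "abs_cont_on_interval f a b" "e > 0"
  obtains d where "d > 0" "\<And>n. small_variation f a b e d {..<n::nat}"
proof -
  obtain d where d: "d > 0 \<and> (\<forall>(n::nat) (l::nat \<Rightarrow> real) (r::nat \<Rightarrow> real).
        (\<forall>i<n. a \<le> l i \<and> l i \<le> r i \<and> r i \<le> b) \<longrightarrow>
        (\<forall>i<n. \<forall>j<n. i \<noteq> j \<longrightarrow> r i \<le> l j \<or> r j \<le> l i) \<longrightarrow>
        (\<Sum>i<n. r i - l i) < d \<longrightarrow> (\<Sum>i<n. \<bar>f (r i) - f (l i)\<bar>) < e)"
    using assms(1)[unfolded abs_cont_on_interval_def, THEN spec, of e, THEN mp, OF assms(2)] by (rule exE)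
  have "small_variation f a b e d {..<n::nat}" for n
    unfolding small_variation_def nonoverlapping_def
  proof (intro allI impI)
    fix l r :: "nat \<Rightarrow> real"
    assume "(\<forall>i\<in>{..<n}. l i \<le> r i) \<and> (\<forall>i\<in>{..<n}. \<forall>j\<in>{..<n}. i \<noteq> j \<longrightarrow> r i \<le> l j \<or> r j \<le> l i)"
      and "\<forall>i\<in>{..<n}. a \<le> l i \<and> r i \<le> b" and s: "(\<Sum>i<n. r i - l i) < d"
    then have "\<forall>i<n. a \<le> l i \<and> l i \<le> r i \<and> r i \<le> b" "\<forall>i<n. \<forall>j<n. i \<noteq> j \<longrightarrow> r i \<le> l j \<or> r j \<le> l i"
      by blast+
    then show "(\<Sum>i<n. \<bar>f (r i) - f (l i)\<bar>) < e"
      using d[THEN conjunct2, THEN spec, of n, THEN spec, of l, THEN spec, of r] s by simp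
  qed
  with d that show ?thesis by blast
qed

text \<open>The open intervals are disjoint even where the closed ones touch, so their lengths add
  up to the measure of a subset of \<open>{x..y}\<close>. This avoids sorting the family.\<close>

lemma nonoverlapping_length:
  assumes "finite I" "nonoverlapping I l r" "\<forall>i\<in>I. x \<le> l i \<and> r i \<le> y" "x \<le> y"
  shows "(\<Sum>i\<in>I. r i - l i) \<le> y - x"
proof -
  have "(\<Sum>i\<in>I. r i - l i) = (\<Sum>i\<in>I. measure lborel {l i<..<r i})"
    using assms(2) by (intro sum.cong) (auto simp: nonoverlapping_def)
  also have "\<dots> = measure lborel (\<Union>i\<in>I. {l i<..<r i})"
  proof (rule measure_finite_Union[symmetric])
    show "disjoint_family_on (\<lambda>i. {l i<..<r i}) I"
      unfolding disjoint_family_on_def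
    proof (intro ballI impI)
      fix i j assume "i \<in> I" "j \<in> I" "i \<noteq> j"
      then have "r i \<le> l j \<or> r j \<le> l i" using assms(2) by (auto simp: nonoverlapping_def)
      then show "{l i<..<r i} \<inter> {l j<..<r j} = {}" by auto
    qed
  qed (use assms in \<open>auto simp: nonoverlapping_def emeasure_lborel_Ioo\<close>)
  also have "\<dots> \<le> measure lborel {x..y}"
  proof -
    have "(\<Union>i\<in>I. {l i<..<r i}) \<subseteq> {x..y}" using assms(3) by fastforce
    moreover have "(\<Union>i\<in>I. {l i<..<r i}) \<in> sets lborel" using assms(1) by auto
    moreover have "{x..y} \<in> fmeasurable lborel" by (auto simp: fmeasurable_def emeasure_lborel_Icc_eq)
    ultimately show ?thesis by (rule measure_mono_fmeasurable)
  qed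
  also have "\<dots> = y - x" using assms by simp
  finally show ?thesis .
qed

section \<open>Positive variation of a function on an interval\<close>

definition pos_variations :: "(real \<Rightarrow> real) \<Rightarrow> real \<Rightarrow> real \<Rightarrow> real set" where
  "pos_variations f x y = {s. \<exists>(n::nat) l r. nonoverlapping {..<n} l r \<and> (\<forall>i<n. x \<le> l i \<and> r i \<le> y) \<and>
     s = (\<Sum>i<n. f (r i) - f (l i))}"

definition pos_variation :: "(real \<Rightarrow> real) \<Rightarrow> real \<Rightarrow> real \<Rightarrow> real" where
  "pos_variation f x y = Sup (pos_variations f x y)"

lemma zero_in_pos_variations: "0 \<in> pos_variations f x y"
  unfolding pos_variations_def nonoverlapping_def by (rule CollectI, rule exI[of _ 0]) auto

lemma pos_variations_mono:
  "x' \<le> x \<Longrightarrow> y \<le> y' \<Longrightarrow> pos_variations f x y \<subseteq> pos_variations f x' y'"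
  unfolding pos_variations_def using order_trans by blast

text \<open>On an interval shorter than \<open>d\<close> every nonoverlapping family has total
  length below \<open>d\<close>, so absolute continuity bounds all sums at once. This is how
  finiteness of the variation is obtained.\<close>

lemma pos_variations_le:
  assumes sv: "\<And>n. small_variation f c e t d {..<n::nat}" and "e - c < d" "c \<le> x" "y \<le> e" "x \<le> y"
    and s: "s \<in> pos_variations f x y"
  shows "s \<le> t"
proof -
  obtain n l r where f: "nonoverlapping {..<n::nat} l r" "\<forall>i<n. x \<le> l i \<and> r i \<le> y"
     "s = (\<Sum>i<n. f (r i) - f (l i))" using s unfolding pos_variations_def by auto
  have "(\<Sum>i<n. r i - l i) \<le> y - x" by (rule nonoverlapping_length) (use f assms in auto)
  then have "(\<Sum>i<n. r i - l i) < d" using assms by linarith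
  moreover have "\<forall>i\<in>{..<n}. c \<le> l i \<and> r i \<le> e" using f(2) assms order_trans by (meson lessThan_iff)
  ultimately have "(\<Sum>i<n. \<bar>f (r i) - f (l i)\<bar>) < t"
    using sv[of n] f(1) unfolding small_variation_def by blast
  moreover have "s \<le> (\<Sum>i<n. \<bar>f (r i) - f (l i)\<bar>)" unfolding f(3) by (rule sum_mono) auto
  ultimately show ?thesis by simp
qed

lemma pos_variations_append:
  assumes "s \<in> pos_variations f c x" "c \<le> x" "x \<le> y"
  shows "s + (f y - f x) \<in> pos_variations f c y"
proof -
  obtain n l r where f: "nonoverlapping {..<n::nat} l r" "\<forall>i<n. c \<le> l i \<and> r i \<le> x"
     "s = (\<Sum>i<n. f (r i) - f (l i))" using assms unfolding pos_variations_def by auto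
  have "nonoverlapping {..<Suc n} (l(n := x)) (r(n := y))"
    unfolding nonoverlapping_def
  proof (intro conjI ballI impI)
    fix i j assume ij: "i \<in> {..<Suc n}" "j \<in> {..<Suc n}" "i \<noteq> j"
    show "(r(n := y)) i \<le> (l(n := x)) j \<or> (r(n := y)) j \<le> (l(n := x)) i"
    proof (cases "i = n \<or> j = n")
      case True then show ?thesis using ij f(2) by (auto simp: less_Suc_eq)
    next
      case False
      then have "i < n" "j < n" using ij by auto
      then have "r i \<le> l j \<or> r j \<le> l i" using f(1) ij(3) unfolding nonoverlapping_def by blast
      then show ?thesis using False by simp
    qed
  qed (use f(1) assms(3) in \<open>auto simp: nonoverlapping_def less_Suc_eq\<close>)
  moreover have "\<forall>i<Suc n. c \<le> (l(n := x)) i \<and> (r(n := y)) i \<le> y"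
    using f assms by (force simp: less_Suc_eq)
  moreover have "s + (f y - f x) = (\<Sum>i<Suc n. f ((r(n := y)) i) - f ((l(n := x)) i))"
    using f(3) by simp
  ultimately show ?thesis unfolding pos_variations_def by blast
qed

text \<open>Each interval is cut at \<open>x\<close>; taking \<open>min\<close> and
  \<open>max\<close> of both endpoints with \<open>x\<close> produces the two pieces. Pieces on the
  wrong side become degenerate and contribute zero, so intervals straddling \<open>x\<close> need no
  separate treatment.\<close>

lemma pos_variations_split:
  assumes "s \<in> pos_variations f c y" "c \<le> x" "x \<le> y"
  obtains s1 s2 where "s1 \<in> pos_variations f c x" "s2 \<in> pos_variations f x y" "s = s1 + s2"
proof -
  obtain n l r where f: "nonoverlapping {..<n::nat} l r" "\<forall>i<n. c \<le> l i \<and> r i \<le> y"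
     "s = (\<Sum>i<n. f (r i) - f (l i))" using assms unfolding pos_variations_def by auto
  define s1 where "s1 = (\<Sum>i<n. f (min (r i) x) - f (min (l i) x))"
  define s2 where "s2 = (\<Sum>i<n. f (max (r i) x) - f (max (l i) x))"
  have lr: "\<forall>i<n. l i \<le> r i" and ov: "\<And>i j. i < n \<Longrightarrow> j < n \<Longrightarrow> i \<noteq> j \<Longrightarrow> r i \<le> l j \<or> r j \<le> l i"
    using f(1) by (auto simp: nonoverlapping_def)
  have "nonoverlapping {..<n} (\<lambda>i. min (l i) x) (\<lambda>i. min (r i) x)"
    unfolding nonoverlapping_def
  proof (intro conjI ballI impI)
    fix i j assume "i \<in> {..<n}" "j \<in> {..<n}" "i \<noteq> j"
    then have "r i \<le> l j \<or> r j \<le> l i" using ov by auto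
    then show "min (r i) x \<le> min (l j) x \<or> min (r j) x \<le> min (l i) x" by linarith
  qed (use lr in \<open>auto intro: min.mono\<close>)
  moreover have "nonoverlapping {..<n} (\<lambda>i. max (l i) x) (\<lambda>i. max (r i) x)"
    unfolding nonoverlapping_def
  proof (intro conjI ballI impI)
    fix i j assume "i \<in> {..<n}" "j \<in> {..<n}" "i \<noteq> j"
    then have "r i \<le> l j \<or> r j \<le> l i" using ov by auto
    then show "max (r i) x \<le> max (l j) x \<or> max (r j) x \<le> max (l i) x" by linarith
  qed (use lr in \<open>auto intro: max.mono\<close>)
  moreover have "\<forall>i<n. c \<le> min (l i) x \<and> min (r i) x \<le> x" "\<forall>i<n. x \<le> max (l i) x \<and> max (r i) x \<le> y"
    using f(2) assms by auto
  ultimately have "s1 \<in> pos_variations f c x" "s2 \<in> pos_variations f x y"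
    unfolding pos_variations_def s1_def s2_def by blast+
  moreover have "s = s1 + s2" unfolding f(3) s1_def s2_def sum.distrib[symmetric]
    by (intro sum.cong) (auto simp: min_def max_def)
  ultimately show ?thesis using that by blast
qed

text \<open>The index set of the refined family is the disjoint union of the index sets of the
  families chosen inside each interval.\<close>
lemma pos_variation_sum_le:
  fixes I :: "'i set"
  assumes sv: "\<And>n. small_variation f c e t d {..<n::nat}" and fin: "finite I"
    and no: "nonoverlapping I x y" and ce: "\<forall>i\<in>I. c \<le> x i \<and> y i \<le> e" and len: "(\<Sum>i\<in>I. y i - x i) < d"
    and s: "\<forall>i\<in>I. s i \<in> pos_variations f (x i) (y i)"
  shows "(\<Sum>i\<in>I. s i) \<le> t"
proof -
  have "\<forall>i\<in>I. \<exists>t. nonoverlapping {..<fst t::nat} (fst (snd t)) (snd (snd t)) \<and>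
     (\<forall>j<fst t. x i \<le> fst (snd t) j \<and> snd (snd t) j \<le> y i) \<and>
     s i = (\<Sum>j<fst t. f (snd (snd t) j) - f (fst (snd t) j))"
    using s unfolding pos_variations_def by force
  then obtain h where h: "\<forall>i\<in>I. nonoverlapping {..<fst (h i)::nat} (fst (snd (h i))) (snd (snd (h i))) \<and>
     (\<forall>j<fst (h i). x i \<le> fst (snd (h i)) j \<and> snd (snd (h i)) j \<le> y i) \<and>
     s i = (\<Sum>j<fst (h i). f (snd (snd (h i)) j) - f (fst (snd (h i)) j))"
    by (rule bchoice[THEN exE])
  define n l r where "n i = fst (h i)" and "l i = fst (snd (h i))" and "r i = snd (snd (h i))" for i
  have f: "\<And>i. i \<in> I \<Longrightarrow> nonoverlapping {..<n i::nat} (l i) (r i)"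
     "\<And>i j. i \<in> I \<Longrightarrow> j < n i \<Longrightarrow> x i \<le> l i j \<and> r i j \<le> y i"
     "\<And>i. i \<in> I \<Longrightarrow> s i = (\<Sum>j<n i. f (r i j) - f (l i j))"
    using h unfolding n_def l_def r_def by blast+
  define K where "K = (SIGMA i:I. {..<n i})"
  have finK: "finite K" using fin unfolding K_def by auto
  have xy: "x i \<le> y i" if "i \<in> I" for i using no that by (auto simp: nonoverlapping_def)
  have nK: "nonoverlapping K (\<lambda>(i,j). l i j) (\<lambda>(i,j). r i j)"
    unfolding nonoverlapping_def
  proof (intro conjI ballI impI)
    fix k assume "k \<in> K" then show "(\<lambda>(i,j). l i j) k \<le> (\<lambda>(i,j). r i j) k"
      using f(1) unfolding K_def nonoverlapping_def by auto
  next
    fix k k' assume k: "k \<in> K" "k' \<in> K" "k \<noteq> k'"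
    obtain i j where ij: "k = (i,j)" by (cases k)
    obtain i' j' where ij': "k' = (i',j')" by (cases k')
    have m: "i \<in> I" "i' \<in> I" "j < n i" "j' < n i'" using k ij ij' by (auto simp: K_def)
    show "(\<lambda>(i,j). r i j) k \<le> (\<lambda>(i,j). l i j) k' \<or> (\<lambda>(i,j). r i j) k' \<le> (\<lambda>(i,j). l i j) k"
    proof (cases "i = i'")
      case True
      then have "j \<noteq> j'" using k ij ij' by auto
      then show ?thesis using True f(1)[OF m(1)] m ij ij' by (auto simp: nonoverlapping_def)
    next
      case False
      then have "y i \<le> x i' \<or> y i' \<le> x i" using no m by (auto simp: nonoverlapping_def)
      then show ?thesis using f(2)[OF m(1,3)] f(2)[OF m(2,4)] ij ij' by auto
    qed
  qed
  have cK: "\<forall>k\<in>K. c \<le> (\<lambda>(i,j). l i j) k \<and> (\<lambda>(i,j). r i j) k \<le> e"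
  proof
    fix k assume "k \<in> K"
    then obtain i j where "k = (i,j)" "i \<in> I" "j < n i" unfolding K_def by auto
    then show "c \<le> (\<lambda>(i,j). l i j) k \<and> (\<lambda>(i,j). r i j) k \<le> e"
      using f(2)[of i j] bspec[OF ce, of i] by simp
  qed
  have lK: "(\<Sum>k\<in>K. (\<lambda>(i,j). r i j) k - (\<lambda>(i,j). l i j) k) < d"
  proof -
    have "(\<Sum>k\<in>K. (\<lambda>(i,j). r i j) k - (\<lambda>(i,j). l i j) k) = (\<Sum>i\<in>I. \<Sum>j<n i. r i j - l i j)"
      unfolding K_def using fin by (subst sum.Sigma) (auto simp: case_prod_beta)
    also have "\<dots> \<le> (\<Sum>i\<in>I. y i - x i)"
      by (intro sum_mono nonoverlapping_length) (use f xy in auto)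
    finally show ?thesis using len by simp
  qed
  have "(\<Sum>k\<in>K. \<bar>f ((\<lambda>(i,j). r i j) k) - f ((\<lambda>(i,j). l i j) k)\<bar>) < t"
    using small_variation_transfer[OF sv finK, unfolded small_variation_def, THEN spec, THEN spec, THEN mp,
        OF nK, THEN mp, OF cK, THEN mp, OF lK] .
  moreover have "(\<Sum>i\<in>I. s i) = (\<Sum>k\<in>K. f ((\<lambda>(i,j). r i j) k) - f ((\<lambda>(i,j). l i j) k))"
  proof -
    have "(\<Sum>i\<in>I. s i) = (\<Sum>i\<in>I. \<Sum>j<n i. f (r i j) - f (l i j))" using f(3) by simp
    also have "\<dots> = (\<Sum>(i,j)\<in>K. f (r i j) - f (l i j))"
      unfolding K_def using fin by (intro sum.Sigma) auto
    finally show ?thesis by (simp add: case_prod_beta)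
  qed
  moreover have "\<dots> \<le> (\<Sum>k\<in>K. \<bar>f ((\<lambda>(i,j). r i j) k) - f ((\<lambda>(i,j). l i j) k)\<bar>)"
    by (rule sum_mono) auto
  ultimately show ?thesis by linarith
qed

section \<open>Densities of monotone absolutely continuous functions\<close>

text \<open>Monotonicity turns increments of \<open>g\<close> into a Stieltjes measure. Absolute
  continuity says that this measure is small on finite unions of short intervals, hence vanishes on
  Lebesgue null sets, and Radon-Nikodym supplies the density.\<close>

lemma mono_abs_cont_density:
  fixes g :: "real \<Rightarrow> real"
  assumes mono: "\<And>x y. c \<le> x \<Longrightarrow> x \<le> y \<Longrightarrow> y \<le> e \<Longrightarrow> g x \<le> g y" and ce: "c \<le> e"
    and ac: "\<And>t. t > 0 \<Longrightarrow> \<exists>d>0. \<forall>n. small_variation g c e t d {..<n::nat}"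
  obtains \<rho> where "\<rho> \<in> borel_measurable borel" "\<And>x. 0 \<le> \<rho> x" "integrable lborel \<rho>"
    "\<And>x y. c \<le> x \<Longrightarrow> x \<le> y \<Longrightarrow> y \<le> e \<Longrightarrow> g y - g x = (\<integral>z\<in>{x..y}. \<rho> z \<partial>lborel)"
proof -
  \<comment> \<open>Clamping to \<open>{c..e}\<close> extends \<open>g\<close> to a monotone
    continuous function on the whole line, as the interval measure requires, with no increments
    outside \<open>{c..e}\<close>.\<close>
  define k where "k x = max c (min e x)" for x
  define G where "G x = g (k x) - g c" for x
  have k: "c \<le> k x" "k x \<le> e" for x using ce by (auto simp: k_def)
  have kmono: "k x \<le> k y" if "x \<le> y" for x y using that by (auto simp: k_def)
  have klip: "\<bar>k x - k y\<bar> \<le> \<bar>x - y\<bar>" for x y by (auto simp: k_def max_def min_def)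
  have Gmono: "G x \<le> G y" if "x \<le> y" for x y
    unfolding G_def using mono[OF k(1) kmono[OF that] k(2)] by simp
  have osc: "\<exists>d>0. \<forall>x y. \<bar>x - y\<bar> < d \<longrightarrow> \<bar>G x - G y\<bar> < t" if t: "t > 0" for t
  proof -
    obtain d where d: "d > 0" "\<And>n. small_variation g c e t d {..<n::nat}" using ac[OF t] by blast
    have le: "\<bar>G x - G y\<bar> < t" if "\<bar>x - y\<bar> < d" "x \<le> y" for x y
    proof -
      have "k y - k x < d" using klip[of x y] that kmono[OF that(2)] by linarith
      then have "\<bar>g (k y) - g (k x)\<bar> < t"
        using d(2)[of 1, unfolded small_variation_def, THEN spec, of "\<lambda>_. k x", THEN spec, of "\<lambda>_. k y"]
          k kmono[OF that(2)] by (simp add: nonoverlapping_def)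
      then show ?thesis unfolding G_def by linarith
    qed
    have "\<bar>G x - G y\<bar> < t" if "\<bar>x - y\<bar> < d" for x y
      using le[of x y] le[of y x] that by (cases "x \<le> y") (auto simp: abs_minus_commute)
    then show ?thesis using d(1) by blast
  qed
  have Gcont: "continuous_on UNIV G"
    unfolding continuous_on_iff dist_real_def using osc by (metis UNIV_I)
  have rc: "continuous (at_right a) G" for a
    using Gcont by (simp add: continuous_on_eq_continuous_at continuous_at_imp_continuous_within)
  have bot: "(G \<longlongrightarrow> 0) at_bot"
  proof (rule tendsto_eventually)
    have "G n = 0" if "n \<le> c" for n using that by (simp add: G_def k_def min.coboundedI2 max_absorb1)
    then show "\<forall>\<^sub>F n in at_bot. G n = 0" unfolding eventually_at_bot_linorder by blast
  qed
  have top: "(G \<longlongrightarrow> g e - g c) at_top"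
  proof (rule tendsto_eventually)
    have "G n = g e - g c" if "n \<ge> e" for n using that ce by (simp add: G_def k_def min_absorb1 max_absorb2)
    then show "\<forall>\<^sub>F n in at_top. G n = g e - g c" unfolding eventually_at_top_linorder by blast
  qed
  have m: "0 \<le> g e - g c" using mono[of c e] ce by simp
  define \<nu> where "\<nu> = interval_measure G"
  interpret finite_borel_measure \<nu>
    unfolding \<nu>_def by (rule finite_borel_measure_interval_measure[OF Gmono rc bot top m])
  have Icc: "emeasure \<nu> {a..b} = ennreal (G b - G a)" if "a \<le> b" for a b
    unfolding \<nu>_def by (rule emeasure_interval_measure_Icc[OF that Gmono Gcont])
  have sets\<nu>: "sets \<nu> = sets borel" unfolding \<nu>_def by simp
  \<comment> \<open>Only compact null sets are treated by hand, because their interval covers can be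
    taken finite; inner regularity extends the result to all null sets.\<close>
  have cpt: "emeasure \<nu> K = 0" if K: "compact K" "emeasure lborel K = 0" for K
  proof -
    have "emeasure \<nu> K \<le> ennreal t" if t: "t > 0" for t
    proof -
      obtain d where d: "d > 0" "\<And>n. small_variation g c e t d {..<n::nat}" using ac[OF t] by blast
      have Kb: "K \<in> sets borel" using K by (simp add: borel_compact)
      obtain U where U: "open U" "K \<subseteq> U" "emeasure lborel (U - K) < d"
        using outer_regular_lborel[OF Kb d(1)] by blast
      have "emeasure lborel U = emeasure lborel ((U - K) \<union> K)" using U by (simp add: Un_absorb2)
      also have "\<dots> \<le> emeasure lborel (U - K) + emeasure lborel K"
        by (rule emeasure_subadditive) (use U Kb in auto)
      finally have Ud: "emeasure lborel U < d" using U K by simp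
      have "\<forall>x\<in>K. \<exists>r>0. cball x r \<subseteq> U" using U by (auto simp: open_contains_cball)
      then obtain r where r: "\<forall>x\<in>K. r x > 0 \<and> cball x (r x) \<subseteq> U" by (rule bchoice[THEN exE])
      obtain F where F: "F \<subseteq> K" "finite F" "K \<subseteq> (\<Union>x\<in>F. ball x (r x))"
        by (rule compactE_image[OF K(1), of K "\<lambda>x. ball x (r x)"]) (use r in force)+
      \<comment> \<open>The covering balls overlap. A division of their union has members with
        disjoint interiors, the form to which \<open>small_variation\<close> applies.\<close>
      obtain p where p: "p division_of \<Union> ((\<lambda>x. cball x (r x)) ` F)"
      proof (rule elementary_unions_intervals[of "(\<lambda>x. cball x (r x)) ` F"])
        fix s assume "s \<in> (\<lambda>x. cball x (r x)) ` F"
        then show "\<exists>a b. s = cbox a b" by (metis imageE cball_eq_atLeastAtMost cbox_interval)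
      qed (use F(2) in auto)
      have pU: "\<Union>p = (\<Union>x\<in>F. cball x (r x))" and finp: "finite p" using p by (auto simp: division_of_def)
      have KU: "K \<subseteq> \<Union>p" "\<Union>p \<subseteq> U"
      proof -
        have "ball x (r x) \<subseteq> cball x (r x)" for x by auto
        then have "(\<Union>x\<in>F. ball x (r x)) \<subseteq> (\<Union>x\<in>F. cball x (r x))" by (rule UN_mono[OF order_refl])
        with F(3) show "K \<subseteq> \<Union>p" unfolding pU by (rule order_trans)
        show "\<Union>p \<subseteq> U" unfolding pU using r F(1) by (intro UN_least) blast
      qed
      have pint: "\<exists>a b. a \<le> b \<and> X = {a..b}" if Xp: "X \<in> p" for X
      proof -
        obtain a b where "X = cbox a b" using division_ofD(4)[OF p Xp] by blast
        moreover have "X \<noteq> {}" by (rule division_ofD(3)[OF p Xp])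
        ultimately show ?thesis by (intro exI[of _ a] exI[of _ b]) auto
      qed
      define l u where "l X = Inf X" and "u X = Sup X" for X :: "real set"
      have lu: "l X \<le> u X \<and> X = {l X..u X}" if "X \<in> p" for X
        using pint[OF that] unfolding l_def u_def by (elim exE conjE) simp
      \<comment> \<open>Degenerate members of the division carry no increment of \<open>G\<close>.
        For the remaining ones disjoint interiors force the endpoints to be ordered.\<close>
      define q where "q = {X\<in>p. l X < u X}"
      have finq: "finite q" using finp q_def by auto
      have disj: "u X \<le> l Y \<or> u Y \<le> l X" if "X \<in> q" "Y \<in> q" "X \<noteq> Y" for X Y
      proof -
        have "interior X \<inter> interior Y = {}" using p that unfolding division_of_def q_def by auto
        moreover have "X = {l X..u X}" "Y = {l Y..u Y}" using lu that q_def by auto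
        ultimately have "{l X<..<u X} \<inter> {l Y<..<u Y} = {}" by (metis interior_atLeastAtMost_real)
        moreover have "l X < u X" "l Y < u Y" using that q_def by auto
        ultimately show ?thesis by (auto simp: min_def max_def split: if_splits)
      qed
      have nqk: "nonoverlapping q (\<lambda>X. k (l X)) (\<lambda>X. k (u X))"
        unfolding nonoverlapping_def
      proof (intro conjI ballI impI)
        fix X Y assume "X \<in> q" "Y \<in> q" "X \<noteq> Y"
        then show "k (u X) \<le> k (l Y) \<or> k (u Y) \<le> k (l X)" using disj[of X Y] kmono by blast
      qed (auto simp: q_def intro!: kmono)
      have "(\<Sum>X\<in>q. u X - l X) = (\<Sum>X\<in>q. measure lborel {l X<..<u X})"
        by (intro sum.cong) (auto simp: q_def)
      also have "\<dots> = measure lborel (\<Union>X\<in>q. {l X<..<u X})"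
      proof (rule measure_finite_Union[symmetric])
        show "disjoint_family_on (\<lambda>X. {l X<..<u X}) q"
          unfolding disjoint_family_on_def
        proof (intro ballI impI)
          fix X Y assume "X \<in> q" "Y \<in> q" "X \<noteq> Y"
          from disj[OF this] show "{l X<..<u X} \<inter> {l Y<..<u Y} = {}" by auto
        qed
      qed (use finq in \<open>auto simp: q_def\<close>)
      also have "\<dots> < d"
      proof -
        have "(\<Union>X\<in>q. {l X<..<u X}) \<subseteq> U"
        proof
          fix z assume "z \<in> (\<Union>X\<in>q. {l X<..<u X})"
          then obtain X where X: "X \<in> q" "z \<in> {l X<..<u X}" by auto
          then have Xp: "X \<in> p" and "z \<in> {l X..u X}" by (auto simp: q_def)
          then have "z \<in> X" using lu[OF Xp] by metis
          moreover note Xp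
          ultimately show "z \<in> U" using KU(2) by blast
        qed
        then have "emeasure lborel (\<Union>X\<in>q. {l X<..<u X}) \<le> emeasure lborel U"
          by (rule emeasure_mono) (use U in auto)
        then have "emeasure lborel (\<Union>X\<in>q. {l X<..<u X}) < ennreal d" using Ud by simp
        then have "emeasure lborel (\<Union>X\<in>q. {l X<..<u X}) \<noteq> \<top>" by (metis ennreal_less_top less_trans less_irrefl)
        from emeasure_eq_ennreal_measure[OF this] show ?thesis
          using d(1) \<open>emeasure lborel (\<Union>X\<in>q. {l X<..<u X}) < ennreal d\<close> by (simp add: ennreal_less_iff)
      qed
      finally have len: "(\<Sum>X\<in>q. u X - l X) < d" .
      have "(\<Sum>X\<in>q. k (u X) - k (l X)) \<le> (\<Sum>X\<in>q. u X - l X)"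
      proof (rule sum_mono)
        fix X assume "X \<in> q"
        then show "k (u X) - k (l X) \<le> u X - l X" using klip[of "u X" "l X"] by (auto simp: q_def)
      qed
      with len have "(\<Sum>X\<in>q. k (u X) - k (l X)) < d" by simp
      moreover have "\<forall>X\<in>q. c \<le> k (l X) \<and> k (u X) \<le> e" using k by auto
      ultimately have sm: "(\<Sum>X\<in>q. \<bar>g (k (u X)) - g (k (l X))\<bar>) < t"
        using small_variation_transfer[OF d(2) finq, unfolded small_variation_def, THEN spec, THEN spec, THEN mp, OF nqk]
        by blast
      have psets: "X \<in> sets \<nu>" if "X \<in> p" for X
        using pint[OF that] by (auto simp: sets\<nu>)
      have "(\<Union>X\<in>p. X) \<in> sets \<nu>" using finp psets by blast
      then have "emeasure \<nu> K \<le> emeasure \<nu> (\<Union>X\<in>p. X)"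
        using KU(1) by (intro emeasure_mono) auto
      also have "\<dots> \<le> (\<Sum>X\<in>p. emeasure \<nu> X)"
        by (rule emeasure_subadditive_finite) (use finp psets in auto)
      also have "\<dots> = (\<Sum>X\<in>p. ennreal (G (u X) - G (l X)))"
      proof (rule sum.cong)
        fix X assume "X \<in> p"
        then have "l X \<le> u X" "X = {l X..u X}" using lu by auto
        then show "emeasure \<nu> X = ennreal (G (u X) - G (l X))" using Icc[of "l X" "u X"] by simp
      qed simp
      also have "\<dots> = ennreal (\<Sum>X\<in>p. G (u X) - G (l X))"
        using lu Gmono by (intro sum_ennreal) auto
      also have "(\<Sum>X\<in>p. G (u X) - G (l X)) = (\<Sum>X\<in>q. G (u X) - G (l X))"
      proof (rule sum.mono_neutral_right[OF finp])
        show "\<forall>X\<in>p - q. G (u X) - G (l X) = 0"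
        proof
          fix X assume "X \<in> p - q"
          then have "l X = u X" using lu[of X] by (auto simp: q_def)
          then show "G (u X) - G (l X) = 0" by simp
        qed
      qed (auto simp: q_def)
      also have "\<dots> \<le> (\<Sum>X\<in>q. \<bar>g (k (u X)) - g (k (l X))\<bar>)" unfolding G_def by (intro sum_mono) auto
      finally show ?thesis using sm by (meson ennreal_leI less_imp_le order_trans)
    qed
    then show ?thesis by (metis ennreal_le_epsilon add_0 le_zero_eq less_irrefl)
  qed
  have "absolutely_continuous lborel \<nu>"
    unfolding absolutely_continuous_def
  proof
    fix Z assume Z: "Z \<in> null_sets (lborel :: real measure)"
    then have Zb: "Z \<in> sets borel" by auto
    have "emeasure \<nu> Z = (SUP K\<in>{K. K \<subseteq> Z \<and> compact K}. emeasure \<nu> K)"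
      by (rule inner_regular[OF sets\<nu> _ Zb]) simp
    also have "\<dots> = (SUP K\<in>{K. K \<subseteq> Z \<and> compact K}. 0)"
    proof (rule SUP_cong)
      fix K assume "K \<in> {K. K \<subseteq> Z \<and> compact K}"
      then have "compact K" "emeasure lborel K = 0"
      proof -
        assume "K \<in> {K. K \<subseteq> Z \<and> compact K}"
        then have K: "K \<subseteq> Z" "compact K" by auto
        have "emeasure lborel K \<le> emeasure lborel Z" using K Zb by (intro emeasure_mono) auto
        then show "compact K" "emeasure lborel K = 0" using K Z by (auto dest: null_setsD1)
      qed
      then show "emeasure \<nu> K = 0" by (rule cpt)
    qed simp
    also have "\<dots> \<le> 0" by (rule SUP_least) simp
    finally have "emeasure \<nu> Z = 0" by simp
    then show "Z \<in> null_sets \<nu>" using Zb by (simp add: null_sets_def sets\<nu>)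
  qed
  then obtain h where h: "h \<in> borel_measurable lborel" "density lborel h = \<nu>"
    using sigma_finite_measure.Radon_Nikodym[OF sigma_finite_lborel, of \<nu>] by (auto simp: sets\<nu>)
  have hint: "(\<integral>\<^sup>+x. h x \<partial>lborel) = emeasure \<nu> UNIV"
    unfolding h(2)[symmetric] using h(1) by (simp add: emeasure_density)
  then have hfin: "(\<integral>\<^sup>+x. h x \<partial>lborel) \<noteq> \<infinity>" using emeasure_finite[of UNIV] by auto
  then have AEh: "AE x in lborel. h x \<noteq> \<infinity>" using h(1) by (intro nn_integral_noteq_infinite) auto
  define \<rho> where "\<rho> x = enn2real (h x)" for x
  have meas: "\<rho> \<in> borel_measurable borel" unfolding \<rho>_def using h(1) by measurable
  have eq: "AE x in lborel. ennreal (\<rho> x) = h x" using AEh unfolding \<rho>_def by (auto simp: top.not_eq_extremum)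
  have int: "integrable lborel \<rho>"
  proof (rule integrableI_nonneg)
    have "(\<integral>\<^sup>+x. ennreal (\<rho> x) \<partial>lborel) = (\<integral>\<^sup>+x. h x \<partial>lborel)" using eq by (rule nn_integral_cong_AE)
    then show "(\<integral>\<^sup>+x. ennreal (\<rho> x) \<partial>lborel) < \<infinity>" using hfin by (simp add: top.not_eq_extremum)
  qed (use meas in \<open>auto simp: \<rho>_def\<close>)
  have main: "g y - g x = (\<integral>z\<in>{x..y}. \<rho> z \<partial>lborel)" if xy: "c \<le> x" "x \<le> y" "y \<le> e" for x y
  proof -
    have "ennreal (G y - G x) = emeasure \<nu> {x..y}" using Icc xy by simp
    also have "\<dots> = (\<integral>\<^sup>+z. h z * indicator {x..y} z \<partial>lborel)"
      unfolding h(2)[symmetric] using h(1) by (simp add: emeasure_density)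
    also have "\<dots> = (\<integral>\<^sup>+z. ennreal (indicator {x..y} z * \<rho> z) \<partial>lborel)"
      by (rule nn_integral_cong_AE, use eq in eventually_elim) (auto simp: indicator_def)
    also have "\<dots> = ennreal (\<integral>z\<in>{x..y}. \<rho> z \<partial>lborel)"
      unfolding set_lebesgue_integral_def real_scaleR_def
      by (rule nn_integral_eq_integral) (use int integrable_mult_indicator[of "{x..y}" lborel \<rho>] in \<open>auto simp: \<rho>_def\<close>)
    finally have "G y - G x = (\<integral>z\<in>{x..y}. \<rho> z \<partial>lborel)"
      using Gmono[OF xy(2)] by (subst (asm) ennreal_inj) (auto simp: set_lebesgue_integral_def \<rho>_def)
    moreover have "k x = x" "k y = y" using xy by (auto simp: k_def)
    ultimately show ?thesis unfolding G_def by simp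
  qed
  show ?thesis by (rule that[OF meas _ int main]) (auto simp: \<rho>_def)
qed

section \<open>Lebesgue differentiation by a Vitali covering\<close>

lemma UN_disjoint_emeasure_le:
  fixes \<mu> \<nu> :: "'a measure"
  assumes "countable C" "disjoint_family_on A C" "\<And>i. i \<in> C \<Longrightarrow> A i \<in> sets \<mu>" "sets \<nu> = sets \<mu>"
    and le: "\<And>i. i \<in> C \<Longrightarrow> emeasure \<mu> (A i) \<le> emeasure \<nu> (A i)"
  shows "emeasure \<mu> (\<Union>i\<in>C. A i) \<le> emeasure \<nu> (\<Union>i\<in>C. A i)"
proof -
  have "emeasure \<mu> (\<Union>i\<in>C. A i) = (\<integral>\<^sup>+i. emeasure \<mu> (A i) \<partial>count_space C)"
    by (rule emeasure_UN_countable) (use assms in auto)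
  also have "\<dots> \<le> (\<integral>\<^sup>+i. emeasure \<nu> (A i) \<partial>count_space C)"
    by (rule nn_integral_mono) (use le in auto)
  also have "\<dots> = emeasure \<nu> (\<Union>i\<in>C. A i)"
    by (rule emeasure_UN_countable[symmetric]) (use assms in auto)
  finally show ?thesis .
qed

text \<open>Equality may fail because \<open>ennreal\<close> truncates the negative values of
  \<open>f\<close> to zero.\<close>

lemma ennreal_integral_le_nn_integral:
  fixes f :: "'a \<Rightarrow> real"
  assumes "integrable M f"
  shows "ennreal (\<integral>x. f x \<partial>M) \<le> (\<integral>\<^sup>+x. ennreal (f x) \<partial>M)"
proof -
  have "ennreal (\<integral>x. f x \<partial>M) \<le> ennreal (\<integral>x. max 0 (f x) \<partial>M)"
    using assms by (intro ennreal_leI integral_mono) auto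
  also have "\<dots> = (\<integral>\<^sup>+x. ennreal (max 0 (f x)) \<partial>M)"
    using assms by (intro nn_integral_eq_integral[symmetric]) auto
  also have "\<dots> = (\<integral>\<^sup>+x. ennreal (f x) \<partial>M)"
    by (intro nn_integral_cong) (auto simp: max_def ennreal_neg)
  finally show ?thesis .
qed

text \<open>If the mean of \<open>\<rho>\<close> over arbitrarily short intervals around points of \<open>{\<rho> \<le> s}\<close> exceeds \<open>t > s\<close>,
  a disjoint Vitali subfamily inside an open set on which \<open>(\<rho> - s)\<^sup>+\<close> has small integral has small measure.\<close>
lemma upper_mean_negligible:
  fixes \<rho> :: "real \<Rightarrow> real"
  assumes int: "integrable lborel \<rho>" and st: "s < t"
  shows "negligible {x. a < x \<and> x < b \<and> \<rho> x \<le> s \<and>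
     (\<forall>d>0. \<exists>z r. 0 < r \<and> r < d \<and> x \<in> cball z r \<and> t * (2 * r) < (\<integral>y\<in>cball z r. \<rho> y \<partial>lborel))}"
    (is "negligible ?E")
proof -
  have [measurable]: "\<rho> \<in> borel_measurable borel" using int by auto
  define B where "B = {x. a < x \<and> x < b \<and> \<rho> x \<le> s}"
  have Bm: "B \<in> sets borel" unfolding B_def by measurable
  define w where "w x = ennreal (max 0 (\<rho> x - s)) * indicator {a<..<b} x" for x
  have wm[measurable]: "w \<in> borel_measurable borel" unfolding w_def by measurable
  define \<nu> where "\<nu> = density lborel w"
  have s\<nu>: "sets \<nu> = sets borel" unfolding \<nu>_def by simp
  have em\<nu>: "emeasure \<nu> A = (\<integral>\<^sup>+x. w x * indicator A x \<partial>lborel)" if "A \<in> sets borel" for A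
    unfolding \<nu>_def by (rule emeasure_density) (use that in auto)
  have "emeasure \<nu> (space \<nu>) \<le> (\<integral>\<^sup>+x. ennreal (\<bar>\<rho> x\<bar>) + ennreal \<bar>s\<bar> * indicator {a<..<b} x \<partial>lborel)"
  proof -
    have "emeasure \<nu> (space \<nu>) = (\<integral>\<^sup>+x. w x \<partial>lborel)" using em\<nu>[of UNIV] by (simp add: \<nu>_def)
    also have "\<dots> \<le> (\<integral>\<^sup>+x. ennreal (\<bar>\<rho> x\<bar>) + ennreal \<bar>s\<bar> * indicator {a<..<b} x \<partial>lborel)"
      unfolding w_def by (intro nn_integral_mono) (auto simp: indicator_def ennreal_plus[symmetric] simp del: ennreal_plus intro!: ennreal_leI)
    finally show ?thesis .
  qed
  also have "\<dots> = (\<integral>\<^sup>+x. ennreal (\<bar>\<rho> x\<bar>) \<partial>lborel) + ennreal \<bar>s\<bar> * emeasure lborel {a<..<b}"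
    by (subst nn_integral_add) (auto simp: nn_integral_cmult_indicator)
  also have "\<dots> < \<infinity>"
  proof -
    have "(\<integral>\<^sup>+x. ennreal (\<bar>\<rho> x\<bar>) \<partial>lborel) < \<infinity>" using int unfolding integrable_iff_bounded by simp
    then show ?thesis using emeasure_bounded_finite[of "{a<..<b}"] by (auto simp: ennreal_mult_less_top)
  qed
  finally have fin: "emeasure \<nu> (space \<nu>) \<noteq> \<infinity>" by simp
  have "emeasure \<nu> B = 0"
    unfolding em\<nu>[OF Bm] by (subst nn_integral_0_iff_AE) (auto simp: w_def B_def indicator_def ennreal_neg)
  then have INF: "(INF U\<in>{U. B \<subseteq> U \<and> open U}. emeasure \<nu> U) = 0"
    using outer_regular[OF s\<nu> fin Bm] by simp
  show ?thesis
    unfolding negligible_outer_le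
  proof (intro allI impI)
    fix e :: real assume e: "e > 0"
    have "(INF U\<in>{U. B \<subseteq> U \<and> open U}. emeasure \<nu> U) < ennreal (e * (t - s))"
      unfolding INF using e st by simp
    then obtain U where U: "B \<subseteq> U" "open U" "emeasure \<nu> U < ennreal (e * (t - s))"
      unfolding INF_less_iff by auto
    define V where "V = U \<inter> {a<..<b}"
    have V: "open V" "B \<subseteq> V" using U by (auto simp: V_def B_def)
    define K where "K = {(z, r). 0 < r \<and> cball z r \<subseteq> V \<and> t * (2 * r) < (\<integral>y\<in>cball z r. \<rho> y \<partial>lborel)}"
    obtain C where C: "countable C" "C \<subseteq> K"
      "pairwise (\<lambda>i j. disjnt (cball (fst i) (snd i)) (cball (fst j) (snd j))) C"
      "negligible (?E - (\<Union>i\<in>C. cball (fst i) (snd i)))"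
    proof (rule Vitali_covering_theorem_cballs[of K snd ?E fst])
      fix x d :: real assume x: "x \<in> ?E" and d: "0 < d"
      then have "x \<in> V" using V by (auto simp: B_def)
      then obtain \<eta> where \<eta>: "\<eta> > 0" "ball x \<eta> \<subseteq> V" using V(1) open_contains_ball by blast
      have "0 < min d (\<eta> / 2)" using d \<eta> by simp
      then obtain z r where zr: "0 < r" "r < min d (\<eta> / 2)" "x \<in> cball z r"
         "t * (2 * r) < (\<integral>y\<in>cball z r. \<rho> y \<partial>lborel)"
        using x by blast
      have "cball z r \<subseteq> ball x \<eta>" using zr by (auto simp: dist_real_def)
      then have "(z, r) \<in> K" using zr \<eta>(2) unfolding K_def by auto
      then show "\<exists>i. i \<in> K \<and> x \<in> cball (fst i) (snd i) \<and> snd i < d"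
        using zr by (intro exI[of _ "(z, r)"]) auto
    next
      fix i assume "i \<in> K" then show "0 < snd i" by (auto simp: K_def)
    qed (erule (3) that)
    define A where "A = (\<Union>i\<in>C. cball (fst i) (snd i))"
    have Am: "A \<in> sets borel" unfolding A_def using C(1) by (intro sets.countable_UN') auto
    \<comment> \<open>In each ball of the family the mean of \<rho> exceeds \<open>t\<close>, so
      \<open>t - s\<close> times its length is at most its \<nu>-mass; disjointness adds these
      inequalities up.\<close>
    have "emeasure (density lborel (\<lambda>_. ennreal (t - s))) A \<le> emeasure \<nu> A"
      unfolding A_def
    proof (rule UN_disjoint_emeasure_le[OF C(1)])
      show "disjoint_family_on (\<lambda>i. cball (fst i) (snd i)) C"
        using C(3) unfolding disjoint_family_on_def pairwise_def disjnt_def by blast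
    next
      fix i assume "i \<in> C"
      then obtain z r where i: "i = (z, r)" "0 < r" "cball z r \<subseteq> V" "t * (2 * r) < (\<integral>y\<in>cball z r. \<rho> y \<partial>lborel)"
        using C(2) unfolding K_def by auto
      have sint: "set_integrable lborel (cball z r) \<rho>"
        unfolding set_integrable_def using int by (intro integrable_mult_indicator) auto
      have em: "emeasure lborel (cball z r) = ennreal (2 * r)" using i(2) by (simp add: cball_eq_atLeastAtMost)
      have cint: "set_integrable lborel (cball z r) (\<lambda>_. s)"
        unfolding set_integrable_def using em by (intro integrable_scaleR_left integrable_real_indicator) auto
      have "(\<integral>y\<in>cball z r. \<rho> y - s \<partial>lborel) = (\<integral>y\<in>cball z r. \<rho> y \<partial>lborel) - (\<integral>y\<in>cball z r. s \<partial>lborel)"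
        by (rule set_integral_diff(2)[OF sint cint])
      also have "(\<integral>y\<in>cball z r. s \<partial>lborel) = s * (2 * r)"
        using i(2) by (simp add: set_integral_const cball_eq_atLeastAtMost)
      finally have "(t - s) * (2 * r) \<le> (\<integral>y\<in>cball z r. \<rho> y - s \<partial>lborel)"
        using i(4) by (simp add: algebra_simps)
      then have "ennreal ((t - s) * (2 * r)) \<le> ennreal (\<integral>y\<in>cball z r. \<rho> y - s \<partial>lborel)" by (rule ennreal_leI)
      also have "\<dots> \<le> (\<integral>\<^sup>+y. ennreal (indicator (cball z r) y *\<^sub>R (\<rho> y - s)) \<partial>lborel)"
        unfolding set_lebesgue_integral_def
        using set_integral_diff(1)[OF sint cint]
        by (intro ennreal_integral_le_nn_integral) (simp add: set_integrable_def)
      also have "\<dots> = emeasure \<nu> (cball z r)"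
        using i(3) by (subst em\<nu>) (auto simp: w_def V_def indicator_def max_def ennreal_neg intro!: nn_integral_cong)
      finally have "ennreal (t - s) * emeasure lborel (cball z r) \<le> emeasure \<nu> (cball z r)"
        using st i(2) by (simp add: em ennreal_mult)
      then show "emeasure (density lborel (\<lambda>_. ennreal (t - s))) (cball (fst i) (snd i)) \<le> emeasure \<nu> (cball (fst i) (snd i))"
        using i(1) by (simp add: emeasure_density_const)
    qed (auto simp: s\<nu>)
    then have "ennreal (t - s) * emeasure lborel A \<le> emeasure \<nu> A" using Am by (simp add: emeasure_density_const)
    also have "\<dots> \<le> emeasure \<nu> U"
    proof (rule emeasure_mono)
      show "A \<subseteq> U" using C(2) unfolding A_def K_def V_def by fastforce
    qed (use U s\<nu> in auto)
    also have "\<dots> < ennreal (t - s) * ennreal e" using U(3) st e by (simp add: ennreal_mult[symmetric] mult.commute)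
    finally have Ae: "emeasure lborel A < ennreal e"
      by (meson linorder_not_le mult_left_mono zero_le)
    have Alm: "A \<in> lmeasurable"
      by (rule fmeasurableI) (use Am Ae less_trans[OF Ae ennreal_less_top] in simp_all)
    define Z where "Z = ?E - A"
    have neg: "Z \<in> lmeasurable" "measure lebesgue Z = 0"
      using C(4) unfolding A_def[symmetric] Z_def[symmetric] by (rule negligible_imp_measurable, rule negligible_imp_measure0)
    show "\<exists>T. ?E \<subseteq> T \<and> T \<in> lmeasurable \<and> measure lebesgue T \<le> e"
    proof (intro exI conjI)
      show "?E \<subseteq> Z \<union> A" unfolding Z_def by blast
      show "Z \<union> A \<in> lmeasurable" using neg(1) Alm by (rule fmeasurable.Un)
      have "measure lebesgue (Z \<union> A) \<le> measure lebesgue Z + measure lebesgue A"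
        by (rule measure_Un_le) (use neg(1) Alm in simp_all)
      also have "measure lebesgue A = measure lborel A" using Am by (simp add: measure_completion)
      also have "measure lborel A \<le> e"
        using Ae e unfolding measure_def by (intro enn2real_leI) simp_all
      finally show "measure lebesgue (Z \<union> A) \<le> e" using neg by simp
    qed
  qed
qed

text \<open>If arbitrarily small balls around \<open>x\<close> have means of \<rho> or of its
  negative well above the value at \<open>x\<close>, two rationals \<open>s < t\<close> fit in
  between and place \<open>x\<close> in one of countably many negligible sets. The balls only have
  to contain \<open>x\<close>, not to be centred there, so one-sided difference quotients are
  covered.\<close>

lemma AE_has_derivative_of_density:
  fixes \<rho> F :: "real \<Rightarrow> real"
  assumes int: "integrable lborel \<rho>"
    and F: "\<And>x y. a \<le> x \<Longrightarrow> x \<le> y \<Longrightarrow> y \<le> b \<Longrightarrow> F y - F x = (\<integral>z\<in>{x..y}. \<rho> z \<partial>lborel)"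
  shows "AE x in lborel. a < x \<and> x < b \<longrightarrow> (F has_real_derivative \<rho> x) (at x)"
proof -
  define E where "E \<sigma> s t = {x. a < x \<and> x < b \<and> \<sigma> x \<le> s \<and>
     (\<forall>d>0. \<exists>z r. 0 < r \<and> r < d \<and> x \<in> cball z r \<and> t * (2 * r) < (\<integral>y\<in>cball z r. \<sigma> y \<partial>lborel))}" for \<sigma> :: "real \<Rightarrow> real" and s t :: real
  define Q where "Q = {(s, t). s \<in> \<rat> \<and> t \<in> \<rat> \<and> s < (t::real)}"
  have "Q \<subseteq> \<rat> \<times> \<rat>" by (auto simp: Q_def)
  then have cQ: "countable Q" by (rule countable_subset) (intro countable_SIGMA countable_rat)
  have int': "integrable lborel (\<lambda>x. - \<rho> x)" using int by simp
  have negl: "negligible (E \<rho> s t)" "negligible (E (\<lambda>x. - \<rho> x) s t)" if "s < t" for s t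
    unfolding E_def using upper_mean_negligible[OF int that] upper_mean_negligible[OF int' that] by blast+
  define N where "N = (\<Union>(s,t)\<in>Q. E \<rho> s t \<union> E (\<lambda>x. - \<rho> x) s t)"
  have "negligible N"
    unfolding N_def by (rule negligible_countable_Union) (use cQ negl in \<open>auto simp: Q_def\<close>)
  then have "N \<in> null_sets lebesgue" by (simp add: negligible_iff_null_sets)
  then have "AE x in lebesgue. x \<notin> N" by (rule AE_not_in)
  then have AE: "AE x in lborel. x \<notin> N" by (simp add: AE_completion_iff)
  have upper: "\<exists>d>0. \<forall>z r. 0 < r \<longrightarrow> r < d \<longrightarrow> x \<in> cball z r \<longrightarrow> (\<integral>y\<in>cball z r. \<sigma> y \<partial>lborel) \<le> (\<sigma> x + \<epsilon>) * (2 * r)"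
    if x: "x \<notin> N" "a < x" "x < b" and \<sigma>: "\<sigma> = \<rho> \<or> \<sigma> = (\<lambda>x. - \<rho> x)" and "\<epsilon> > 0" for x \<sigma> \<epsilon>
  proof -
    obtain s where s: "s \<in> \<rat>" "\<sigma> x < s" "s < \<sigma> x + \<epsilon>" using Rats_dense_in_real[of "\<sigma> x" "\<sigma> x + \<epsilon>"] \<open>\<epsilon> > 0\<close> by auto
    obtain t where t: "t \<in> \<rat>" "s < t" "t < \<sigma> x + \<epsilon>" using Rats_dense_in_real[of s "\<sigma> x + \<epsilon>"] s by auto
    have "(s, t) \<in> Q" using s t by (auto simp: Q_def)
    then have "x \<notin> E \<sigma> s t" using x(1) \<sigma> unfolding N_def by blast
    then obtain d where d: "d > 0" "\<And>z r. 0 < r \<Longrightarrow> r < d \<Longrightarrow> x \<in> cball z r \<Longrightarrow> \<not> t * (2 * r) < (\<integral>y\<in>cball z r. \<sigma> y \<partial>lborel)"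
      unfolding E_def using x s by fastforce
    show ?thesis
    proof (intro exI[of _ d] conjI allI impI d(1))
      fix z r assume r: "0 < r" "r < d" "x \<in> cball z r"
      have "(\<integral>y\<in>cball z r. \<sigma> y \<partial>lborel) \<le> t * (2 * r)" using d(2)[OF r] by simp
      also have "\<dots> \<le> (\<sigma> x + \<epsilon>) * (2 * r)" using t r by (intro mult_right_mono) auto
      finally show "(\<integral>y\<in>cball z r. \<sigma> y \<partial>lborel) \<le> (\<sigma> x + \<epsilon>) * (2 * r)" .
    qed
  qed
  show ?thesis
    using AE
  proof (rule AE_mp, intro AE_I2 impI, elim conjE)
    fix x assume x: "x \<notin> N" "a < x" "x < b"
    show "(F has_real_derivative \<rho> x) (at x)"
      unfolding has_field_derivative_iff
    proof (rule tendstoI)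
      fix e :: real assume "e > 0"
      then have e2: "e / 2 > 0" by simp
      obtain d1 where d1: "d1 > 0" "\<And>z r. 0 < r \<Longrightarrow> r < d1 \<Longrightarrow> x \<in> cball z r \<Longrightarrow> (\<integral>y\<in>cball z r. \<rho> y \<partial>lborel) \<le> (\<rho> x + e / 2) * (2 * r)"
        using upper[OF x _ e2, of \<rho>] by blast
      obtain d2 where d2: "d2 > 0" "\<And>z r. 0 < r \<Longrightarrow> r < d2 \<Longrightarrow> x \<in> cball z r \<Longrightarrow> (\<integral>y\<in>cball z r. - \<rho> y \<partial>lborel) \<le> (- \<rho> x + e / 2) * (2 * r)"
        using upper[OF x _ e2, of "\<lambda>x. - \<rho> x"] by blast
      define d where "d = min (min d1 d2) (min (x - a) (b - x))"
      have d: "d > 0" using d1 d2 x by (auto simp: d_def)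
      \<comment> \<open>The interval from \<open>u\<close> to \<open>v\<close> is a ball about its
        midpoint with \<open>x\<close> on its boundary. The estimate for the negative of \<rho>
        provides the lower bound.\<close>
      have close: "\<bar>(F v - F u) / (v - u) - \<rho> x\<bar> \<le> e / 2" if uv: "u < v" "u = x \<or> v = x" "v - u < d" for u v
      proof -
        define z r where "z = (u + v) / 2" and "r = (v - u) / 2"
        have r: "0 < r" "r < d1" "r < d2" and cb: "cball z r = {u..v}"
          using uv d unfolding z_def r_def d_def by (auto simp: cball_eq_atLeastAtMost field_simps)
        have r2: "2 * r = v - u" unfolding r_def by simp
        have "x \<in> cball z r" unfolding cb using uv by auto
        note b = d1(2)[OF r(1,2) this] d2(2)[OF r(1,3) this]
        have "F v - F u = (\<integral>y\<in>cball z r. \<rho> y \<partial>lborel)" unfolding cb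
          using uv d x by (intro F) (auto simp: d_def)
        moreover have "(\<integral>y\<in>cball z r. - \<rho> y \<partial>lborel) = - (\<integral>y\<in>cball z r. \<rho> y \<partial>lborel)"
          unfolding set_lebesgue_integral_def by simp
        ultimately have "F v - F u \<le> (\<rho> x + e / 2) * (v - u)" "- (F v - F u) \<le> (- \<rho> x + e / 2) * (v - u)"
          using b unfolding r2 by simp_all
        moreover have "(\<rho> x - e / 2) * (v - u) = - ((- \<rho> x + e / 2) * (v - u))" by (simp add: algebra_simps)
        ultimately have "(F v - F u) / (v - u) \<le> \<rho> x + e / 2" "\<rho> x - e / 2 \<le> (F v - F u) / (v - u)"
          using uv(1) by (simp_all add: pos_divide_le_eq pos_le_divide_eq)
        then show ?thesis by (intro abs_leI) linarith+
      qed
      show "\<forall>\<^sub>F y in at x. dist ((F y - F x) / (y - x)) (\<rho> x) < e"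
        unfolding eventually_at
      proof (intro exI[of _ d] conjI d ballI impI)
        fix y assume "y \<noteq> x \<and> dist y x < d"
        then consider "x < y" "y - x < d" | "y < x" "x - y < d" by (fastforce simp: dist_real_def)
        then have "\<bar>(F y - F x) / (y - x) - \<rho> x\<bar> \<le> e / 2"
        proof cases
          case 1 then show ?thesis using close[of x y] by simp
        next
          case 2
          have "(F y - F x) / (y - x) = (F x - F y) / (x - y)" by (metis minus_diff_eq minus_divide_divide)
          then show ?thesis using 2 close[of y x] by simp
        qed
        then show "dist ((F y - F x) / (y - x)) (\<rho> x) < e" using \<open>e > 0\<close> by (simp add: dist_real_def)
      qed
    qed
  qed
qed

section \<open>Jordan decomposition and the fundamental theorem of calculus\<close>

text \<open>Write \<open>f = P - (P - f)\<close> with \<open>P\<close> the positive variation from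
  \<open>c\<close>. Both parts are increasing and inherit absolute continuity, so each has a
  density. The interval is kept shorter than \<open>d\<close> to make \<open>P\<close>
  finite.\<close>

lemma abs_cont_local_density:
  assumes ac: "abs_cont_on_interval f c e" and sv: "\<And>n. small_variation f c e 1 d {..<n::nat}"
    and len: "e - c < d" and ce: "c \<le> e"
  obtains \<rho> where "integrable lborel \<rho>"
    "\<And>x y. c \<le> x \<Longrightarrow> x \<le> y \<Longrightarrow> y \<le> e \<Longrightarrow> f y - f x = (\<integral>z\<in>{x..y}. \<rho> z \<partial>lborel)"
proof -
  define P where "P x = pos_variation f c x" for x
  have bdd: "bdd_above (pos_variations f x y)" if "c \<le> x" "x \<le> y" "y \<le> e" for x y
    by (rule bdd_aboveI[of _ 1]) (rule pos_variations_le[OF sv len], use that in auto)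
  have ne: "pos_variations f x y \<noteq> {}" for x y using zero_in_pos_variations by blast
  have step: "P x + (f y - f x) \<le> P y" if "c \<le> x" "x \<le> y" "y \<le> e" for x y
  proof -
    have "P x \<le> P y - (f y - f x)"
      unfolding P_def pos_variation_def
    proof (rule cSup_least[OF ne])
      fix s assume "s \<in> pos_variations f c x"
      then have "s + (f y - f x) \<in> pos_variations f c y" using that by (intro pos_variations_append) auto
      then have "s + (f y - f x) \<le> Sup (pos_variations f c y)" using that by (intro cSup_upper bdd) auto
      then show "s \<le> Sup (pos_variations f c y) - (f y - f x)" by simp
    qed
    then show ?thesis by simp
  qed
  have Pmono: "P x \<le> P y" if "c \<le> x" "x \<le> y" "y \<le> e" for x y
    unfolding P_def pos_variation_def
    by (rule cSup_subset_mono[OF ne bdd pos_variations_mono]) (use that in auto)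
  have Pdiff: "P y - P x \<le> pos_variation f x y" if xy: "c \<le> x" "x \<le> y" "y \<le> e" for x y
  proof -
    have "P y \<le> P x + pos_variation f x y"
      unfolding P_def pos_variation_def
    proof (rule cSup_least[OF ne])
      fix s assume sc: "s \<in> pos_variations f c y"
      obtain s1 s2 where s: "s1 \<in> pos_variations f c x" "s2 \<in> pos_variations f x y" "s = s1 + s2"
        by (rule pos_variations_split[OF sc xy(1,2)])
      have "s1 \<le> Sup (pos_variations f c x)" "s2 \<le> Sup (pos_variations f x y)"
        using s xy by (auto intro!: cSup_upper bdd)
      then show "s \<le> Sup (pos_variations f c x) + Sup (pos_variations f x y)" using s by simp
    qed
    then show ?thesis by simp
  qed
  have Psum: "(\<Sum>i<n. \<bar>P (r i) - P (l i)\<bar>) \<le> t"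
    if sv: "\<And>n. small_variation f c e t \<delta> {..<n::nat}" and no: "nonoverlapping {..<n::nat} l r"
      and lr: "\<forall>i\<in>{..<n}. c \<le> l i \<and> r i \<le> e" and s: "(\<Sum>i<n. r i - l i) < \<delta>" for t \<delta> n l r
  proof -
    have lr': "c \<le> l i" "l i \<le> r i" "r i \<le> e" if "i < n" for i
      using no lr that by (auto simp: nonoverlapping_def)
    have "(\<Sum>i<n. \<bar>P (r i) - P (l i)\<bar>) \<le> (\<Sum>i<n. pos_variation f (l i) (r i))"
    proof (rule sum_mono)
      fix i assume "i \<in> {..<n}"
      then have "i < n" by simp
      note L = lr'[OF this]
      show "\<bar>P (r i) - P (l i)\<bar> \<le> pos_variation f (l i) (r i)" using Pdiff[OF L] Pmono[OF L] by simp
    qed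
    also have "\<dots> \<le> t"
    proof (rule field_le_epsilon)
      fix \<eta> :: real assume \<eta>: "\<eta> > 0"
      \<comment> \<open>The slack is shared among the \<open>n\<close> suprema, each of which is
        approximated by an actual sum; the denominator \<open>n + 1\<close> also covers
        \<open>n = 0\<close>.\<close>
      define \<eta>' where "\<eta>' = \<eta> / (real n + 1)"
      have \<eta>': "\<eta>' > 0" using \<eta> by (simp add: \<eta>'_def)
      have "\<exists>s\<in>pos_variations f (l i) (r i). pos_variation f (l i) (r i) - \<eta>' < s" for i
        unfolding pos_variation_def by (rule less_cSupE[OF _ ne]) (use \<eta>' in auto)
      then obtain s where s': "\<And>i. s i \<in> pos_variations f (l i) (r i)" "\<And>i. pos_variation f (l i) (r i) - \<eta>' < s i"
        by metis
      have "(\<Sum>i<n. pos_variation f (l i) (r i)) \<le> (\<Sum>i<n. s i + \<eta>')"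
        by (rule sum_mono) (use s'(2) in \<open>simp add: less_imp_le algebra_simps\<close>)
      also have "\<dots> = (\<Sum>i<n. s i) + real n * \<eta>'" by (simp add: sum.distrib)
      also have "(\<Sum>i<n. s i) \<le> t"
        by (rule pos_variation_sum_le[OF sv _ no lr s]) (use s' in auto)
      also have "real n * \<eta>' \<le> \<eta>" unfolding \<eta>'_def using \<eta> by (simp add: field_simps)
      finally show "(\<Sum>i<n. pos_variation f (l i) (r i)) \<le> t + \<eta>" by simp
    qed
    finally show ?thesis .
  qed
  have acP: "\<exists>\<delta>>0. \<forall>n. small_variation P c e t \<delta> {..<n::nat}"
    and acPf: "\<exists>\<delta>>0. \<forall>n. small_variation (\<lambda>x. P x - f x) c e t \<delta> {..<n::nat}" if "t > 0" for t
  proof -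
    have "t / 2 > 0" using that by simp
    obtain \<delta> where \<delta>: "\<delta> > 0" "\<And>n. small_variation f c e (t / 2) \<delta> {..<n::nat}"
      using abs_cont_small_variation[OF ac \<open>t / 2 > 0\<close>] by blast
    have "(\<Sum>i<n. \<bar>P (r i) - P (l i)\<bar>) < t \<and> (\<Sum>i<n. \<bar>(P (r i) - f (r i)) - (P (l i) - f (l i))\<bar>) < t"
      if A: "nonoverlapping {..<n::nat} l r" "\<forall>i\<in>{..<n}. c \<le> l i \<and> r i \<le> e" "(\<Sum>i<n. r i - l i) < \<delta>" for n l r
    proof -
      have 1: "(\<Sum>i<n. \<bar>P (r i) - P (l i)\<bar>) \<le> t / 2" by (rule Psum[OF \<delta>(2) A])
      have 2: "(\<Sum>i<n. \<bar>f (r i) - f (l i)\<bar>) < t / 2" using \<delta>(2)[of n] A unfolding small_variation_def by blast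
      have "(\<Sum>i<n. \<bar>(P (r i) - f (r i)) - (P (l i) - f (l i))\<bar>) \<le> (\<Sum>i<n. \<bar>P (r i) - P (l i)\<bar> + \<bar>f (r i) - f (l i)\<bar>)"
        by (rule sum_mono) linarith
      then show ?thesis using 1 2 \<open>t > 0\<close> by (simp add: sum.distrib)
    qed
    then show "\<exists>\<delta>>0. \<forall>n. small_variation P c e t \<delta> {..<n::nat}"
      "\<exists>\<delta>>0. \<forall>n. small_variation (\<lambda>x. P x - f x) c e t \<delta> {..<n::nat}"
      unfolding small_variation_def using \<delta>(1) by (intro exI[of _ \<delta>]; blast)+
  qed
  obtain \<rho>1 where \<rho>1: "integrable lborel \<rho>1" "\<And>x y. c \<le> x \<Longrightarrow> x \<le> y \<Longrightarrow> y \<le> e \<Longrightarrow> P y - P x = (\<integral>z\<in>{x..y}. \<rho>1 z \<partial>lborel)"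
    by (rule mono_abs_cont_density[OF Pmono ce acP]) (assumption+, rule that)
  have Pfmono: "P x - f x \<le> P y - f y" if "c \<le> x" "x \<le> y" "y \<le> e" for x y using step[OF that] by simp
  obtain \<rho>2 where \<rho>2: "integrable lborel \<rho>2" "\<And>x y. c \<le> x \<Longrightarrow> x \<le> y \<Longrightarrow> y \<le> e \<Longrightarrow> (P y - f y) - (P x - f x) = (\<integral>z\<in>{x..y}. \<rho>2 z \<partial>lborel)"
    by (rule mono_abs_cont_density[OF Pfmono ce acPf]) (assumption+, rule that)
  have si: "set_integrable lborel {x..y} \<rho>1" "set_integrable lborel {x..y} \<rho>2" for x y
    unfolding set_integrable_def using \<rho>1(1) \<rho>2(1) by (intro integrable_mult_indicator; simp)+
  show ?thesis
  proof (rule that[of "\<lambda>x. \<rho>1 x - \<rho>2 x"])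
    fix x y assume "c \<le> x" "x \<le> y" "y \<le> e"
    then show "f y - f x = (\<integral>z\<in>{x..y}. \<rho>1 z - \<rho>2 z \<partial>lborel)"
      using \<rho>1(2)[of x y] \<rho>2(2)[of x y] set_integral_diff(2)[OF si] by simp
  qed (use \<rho>1 \<rho>2 in auto)
qed

text \<open>The limit runs along one explicit sequence, which makes measurability immediate, also
  jointly with a parameter, as conditional densities require. Where the derivative exists it has the
  same value.\<close>

definition diff_limit :: "(real \<Rightarrow> real) \<Rightarrow> real \<Rightarrow> real" where
  "diff_limit f x = lim (\<lambda>n. (f (x + 1 / real (Suc n)) - f x) * real (Suc n))"

lemma diff_limit_eq:
  assumes "(f has_real_derivative D) (at x)"
  shows "diff_limit f x = D"
proof -
  have "((\<lambda>h. (f (x + h) - f x) / h) \<longlongrightarrow> D) (at 0)" using assms by (simp add: DERIV_def)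
  moreover have "filterlim (\<lambda>n. 1 / real (Suc n)) (at 0) sequentially"
    unfolding filterlim_at using LIMSEQ_Suc[OF lim_1_over_n] by (auto simp: lim_1_over_n)
  ultimately have "((\<lambda>n. (f (x + 1 / real (Suc n)) - f x) / (1 / real (Suc n))) \<longlongrightarrow> D) sequentially"
    by (rule filterlim_compose)
  then show ?thesis unfolding diff_limit_def by (intro limI) simp
qed

lemma borel_measurable_diff_limit[measurable]:
  assumes [measurable]: "f \<in> borel_measurable borel"
  shows "diff_limit f \<in> borel_measurable borel"
  unfolding diff_limit_def[abs_def] by measurable

lemma abs_cont_real_continuous:
  assumes "abs_cont_real f"
  shows "continuous_on UNIV f"
  unfolding continuous_on_iff
proof (intro ballI allI impI)
  fix x e :: real assume "e > 0"
  obtain d where d: "d > 0" "\<And>n. small_variation f (x - 1) (x + 1) e d {..<n::nat}"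
    using abs_cont_small_variation assms \<open>e > 0\<close> unfolding abs_cont_real_def by metis
  have le: "\<bar>f v - f u\<bar> < e" if "u \<le> v" "x - 1 \<le> u" "v \<le> x + 1" "v - u < d" for u v
    using d(2)[of 1, unfolded small_variation_def, THEN spec, of "\<lambda>_. u", THEN spec, of "\<lambda>_. v"] that
    by (simp add: nonoverlapping_def)
  show "\<exists>d>0. \<forall>y\<in>UNIV. dist y x < d \<longrightarrow> dist (f y) (f x) < e"
  proof (intro exI[of _ "min d 1"] conjI ballI impI)
    fix y assume y: "dist y x < min d 1"
    show "dist (f y) (f x) < e"
      using le[of x y] le[of y x] y by (cases "x \<le> y") (auto simp: dist_real_def abs_minus_commute)
  qed (use d in auto)
qed

text \<open>Densities are available only on intervals shorter than \<open>d R\<close> inside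
  \<open>{-R..R}\<close>. Countably many rational intervals of this kind cover the line, which
  settles differentiability almost everywhere, and a given interval is reached by chaining finitely
  many short ones. As all local derivatives equal \<open>diff_limit f\<close>, nothing has to be
  glued.\<close>

lemma abs_cont_real_FTC:
  assumes ac: "abs_cont_real f"
  shows abs_cont_AE_derivative: "AE x in lborel. (f has_real_derivative diff_limit f x) (at x)"
    and abs_cont_set_integrable: "set_integrable lborel {x..y} (diff_limit f)"
    and abs_cont_integral_derivative: "x \<le> y \<Longrightarrow> f y - f x = (\<integral>z\<in>{x..y}. diff_limit f z \<partial>lborel)"
proof -
  have fm[measurable]: "f \<in> borel_measurable borel"
    using abs_cont_real_continuous[OF ac] by (rule borel_measurable_continuous_onI)
  have "\<exists>d>0. \<forall>n. small_variation f (- real R) (real R) 1 d {..<n::nat}" for R :: nat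
    using abs_cont_small_variation[of f "- real R" "real R" 1] ac unfolding abs_cont_real_def by (metis zero_less_one)
  then obtain d where d: "\<And>R. d R > 0" "\<And>R n. small_variation f (- real R) (real R) 1 (d R) {..<n::nat}" by metis
  define loc where "loc R c e \<longleftrightarrow> - real R \<le> c \<and> c \<le> e \<and> e \<le> real R \<and> e - c < d R" for R c e
  have local: "(AE x in lborel. c < x \<and> x < e \<longrightarrow> (f has_real_derivative diff_limit f x) (at x)) \<and>
     set_integrable lborel {c..e} (diff_limit f) \<and> f e - f c = (\<integral>z\<in>{c..e}. diff_limit f z \<partial>lborel)"
    if L: "loc R c e" for R c e
  proof -
    have "small_variation f c e 1 (d R) {..<n::nat}" for n
      using d(2)[of R n] L unfolding small_variation_def loc_def by (meson order_trans)
    then obtain \<rho> where \<rho>: "integrable lborel \<rho>"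
        "\<And>x y. c \<le> x \<Longrightarrow> x \<le> y \<Longrightarrow> y \<le> e \<Longrightarrow> f y - f x = (\<integral>z\<in>{x..y}. \<rho> z \<partial>lborel)"
      using abs_cont_local_density[of f c e "d R"] ac L unfolding abs_cont_real_def loc_def by blast
    have AE: "AE x in lborel. c < x \<and> x < e \<longrightarrow> (f has_real_derivative \<rho> x) (at x)"
      by (rule AE_has_derivative_of_density[OF \<rho>])
    then have 1: "AE x in lborel. c < x \<and> x < e \<longrightarrow> (f has_real_derivative diff_limit f x) (at x)"
      by eventually_elim (use diff_limit_eq in fastforce)
    have "AE x in lborel. x \<noteq> c" "AE x in lborel. x \<noteq> e" by (rule AE_lborel_singleton)+
    with AE have eq: "AE x in lborel. indicator {c..e} x *\<^sub>R diff_limit f x = indicator {c..e} x *\<^sub>R \<rho> x"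
      by eventually_elim (auto dest: diff_limit_eq simp: indicator_def)
    have "integrable lborel (\<lambda>x. indicator {c..e} x *\<^sub>R \<rho> x)" using \<rho>(1) by (intro integrable_mult_indicator) auto
    then have 2: "set_integrable lborel {c..e} (diff_limit f)"
      unfolding set_integrable_def using eq by (subst integrable_cong_AE) (use \<rho>(1) in auto)
    have 3: "f e - f c = (\<integral>z\<in>{c..e}. diff_limit f z \<partial>lborel)"
      using \<rho>(2)[of c e] L eq unfolding set_lebesgue_integral_def loc_def
      by (subst integral_cong_AE[OF _ _ eq]) (use \<rho>(1) in auto)
    show ?thesis using 1 2 3 by blast
  qed
  have "AE x in lborel. \<forall>(R,c,e)\<in>{(R,c,e). c \<in> \<rat> \<and> e \<in> \<rat> \<and> loc R c e}. c < x \<and> x < e \<longrightarrow> (f has_real_derivative diff_limit f x) (at x)"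
  proof (subst AE_ball_countable)
    show "countable {(R,c,e). c \<in> \<rat> \<and> e \<in> \<rat> \<and> loc R c e}"
      by (rule countable_subset[of _ "(UNIV::nat set) \<times> \<rat> \<times> \<rat>"]) (auto intro: countable_rat)
  qed (use local in auto)
  then show "AE x in lborel. (f has_real_derivative diff_limit f x) (at x)"
  proof (rule AE_mp, intro AE_I2 impI)
    fix x :: real
    assume *: "\<forall>(R,c,e)\<in>{(R,c,e). c \<in> \<rat> \<and> e \<in> \<rat> \<and> loc R c e}. c < x \<and> x < e \<longrightarrow> (f has_real_derivative diff_limit f x) (at x)"
    obtain R :: nat where R: "\<bar>x\<bar> < real R" using reals_Archimedean2 by blast
    define h where "h = min (d R / 2) (real R - \<bar>x\<bar>)"
    have h: "h > 0" using d(1)[of R] R by (simp add: h_def)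
    obtain c where c: "c \<in> \<rat>" "x - h < c" "c < x" using Rats_dense_in_real[of "x - h" x] h by auto
    obtain e where e: "e \<in> \<rat>" "x < e" "e < x + h" using Rats_dense_in_real[of x "x + h"] h by auto
    have "loc R c e" unfolding loc_def using c e R by (auto simp: h_def)
    then show "(f has_real_derivative diff_limit f x) (at x)" using * c e by blast
  qed
  define P where "P x y \<longleftrightarrow> set_integrable lborel {x..y} (diff_limit f) \<and> f y - f x = (\<integral>z\<in>{x..y}. diff_limit f z \<partial>lborel)" for x y
  have add: "P x z" if "P x y" "P y z" "x \<le> y" "y \<le> z" for x y z
  proof -
    have eq: "{x..z} = {x..y} \<union> {y..z}" using that by auto
    have si: "set_integrable lborel {x..y} (diff_limit f)" "set_integrable lborel {y..z} (diff_limit f)"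
      using that unfolding P_def by auto
    have "set_integrable lborel {x..z} (diff_limit f)" unfolding eq using si by (rule set_integrable_Un) auto
    moreover have "AE v in lborel. \<not> (v \<in> {x..y} \<and> v \<in> {y..z})"
      using AE_lborel_singleton[of y] by eventually_elim auto
    then have "(\<integral>v\<in>{x..y} \<union> {y..z}. diff_limit f v \<partial>lborel) = (\<integral>v\<in>{x..y}. diff_limit f v \<partial>lborel) + (\<integral>v\<in>{y..z}. diff_limit f v \<partial>lborel)"
      by (rule set_integral_Un_AE[OF _ _ _ si]) auto
    ultimately show ?thesis using that unfolding P_def eq by simp
  qed
  have all: "P x y" if xy: "x \<le> y" for x y
  proof -
    obtain R :: nat where R: "max \<bar>x\<bar> \<bar>y\<bar> < real R" using reals_Archimedean2 by blast
    obtain m :: nat where m: "(y - x) / d R < real m" using reals_Archimedean2 by blast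
    have m0: "m > 0" using m xy d(1)[of R] by (metis divide_nonneg_pos diff_ge_0_iff_ge of_nat_0_less_iff order_le_less_trans)
    define h where "h = (y - x) / real m"
    have h: "h \<ge> 0" "h < d R" "real m * h = y - x"
      using m m0 xy d(1)[of R] by (auto simp: h_def field_simps)
    have mono: "real i * h \<le> y - x" if "i \<le> m" for i
      using h that mult_right_mono[of "real i" "real m" h] by auto
    have "P x (x + real i * h)" if "i \<le> m" for i
      using that
    proof (induction i)
      case 0
      have "loc R x x" using R d(1)[of R] by (auto simp: loc_def)
      from local[OF this] show ?case by (simp add: P_def)
    next
      case (Suc i)
      have "0 \<le> real i * h" using h by simp
      moreover have "real (Suc i) * h = real i * h + h" by (simp add: algebra_simps)
      moreover have "- real R \<le> x" "y \<le> real R" using R by auto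
      ultimately have "loc R (x + real i * h) (x + real (Suc i) * h)"
        using mono[OF Suc.prems] h(1,2) unfolding loc_def by (intro conjI; linarith)
      from local[OF this] have "P (x + real i * h) (x + real (Suc i) * h)" unfolding P_def by blast
      moreover have "P x (x + real i * h)" using Suc by simp
      moreover have "x \<le> x + real i * h" "x + real i * h \<le> x + real (Suc i) * h"
        using \<open>0 \<le> real i * h\<close> \<open>real (Suc i) * h = real i * h + h\<close> h(1) by linarith+
      ultimately show ?case using add by blast
    qed
    from this[of m] show ?thesis using h by simp
  qed
  show "x \<le> y \<Longrightarrow> f y - f x = (\<integral>z\<in>{x..y}. diff_limit f z \<partial>lborel)" using all unfolding P_def by blast
  show "set_integrable lborel {x..y} (diff_limit f)"
    using all[of x y] unfolding P_def by (cases "x \<le> y") (auto simp: set_integrable_def)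
qed

section \<open>Fisher information and scores\<close>

lemma ennreal_power2_le_imp_le:
  fixes a b :: ennreal
  assumes "a\<^sup>2 \<le> b\<^sup>2"
  shows "a \<le> b"
proof (cases a; cases b)
  fix x y :: real assume *: "0 \<le> x" "0 \<le> y" "a = ennreal x" "b = ennreal y"
  then have "x\<^sup>2 \<le> y\<^sup>2" using assms by (simp add: ennreal_power ennreal_le_iff)
  then have "x \<le> y" using *(2) by (rule power2_le_imp_le)
  then show "a \<le> b" using * by (simp add: ennreal_leI)
qed (use assms in \<open>auto simp: top_unique ennreal_power\<close>)

text \<open>The derivative enters only through its integral identity, and \<open>J\<close> is merely
  an upper bound. Since division by zero yields zero, the integral in \<open>info\<close> says
  nothing about \<open>f'\<close> on the zero set of \<open>f\<close>; \<open>f'_zero\<close> closes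
  this gap.\<close>

locale fisher_density =
  fixes f f' :: "real \<Rightarrow> real" and J :: real
  assumes f_meas[measurable]: "f \<in> borel_measurable borel" and f'_meas[measurable]: "f' \<in> borel_measurable borel"
    and f_nonneg: "0 \<le> f x" and f_one: "(\<integral>\<^sup>+x. ennreal (f x) \<partial>lborel) = 1"
    and f'_local: "set_integrable lborel {x..y} f'"
    and FTC: "x \<le> y \<Longrightarrow> f y - f x = (\<integral>z\<in>{x..y}. f' z \<partial>lborel)"
    and f'_zero: "AE x in lborel. f x = 0 \<longrightarrow> f' x = 0"
    and J_nonneg: "0 \<le> J" and info: "(\<integral>\<^sup>+x. ennreal ((f' x)\<^sup>2 / f x) \<partial>lborel) \<le> ennreal J"
begin

definition law :: "real measure" where "law = density lborel f"

definition score :: "real \<Rightarrow> real" where "score x = f' x / f x"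

lemma score_meas[measurable]: "score \<in> borel_measurable borel"
  unfolding score_def[abs_def] by measurable

lemma sets_law[simp, measurable_cong]: "sets law = sets borel" unfolding law_def by simp

lemma space_law[simp]: "space law = UNIV" unfolding law_def by simp

lemma prob_law: "prob_space law"
  by (rule prob_spaceI) (simp add: law_def emeasure_density f_one)

text \<open>Cauchy-Schwarz for the factors \<open>sqrt (f x)\<close> and
  \<open>\<bar>f' x\<bar> / sqrt (f x)\<close>, whose squares integrate to 1 and to at most
  \<open>J\<close>.\<close>

lemma nn_integral_abs_f'_le: "(\<integral>\<^sup>+x. ennreal \<bar>f' x\<bar> \<partial>lborel) \<le> ennreal (sqrt J)"
proof -
  have "(\<integral>\<^sup>+x. ennreal \<bar>f' x\<bar> \<partial>lborel)\<^sup>2 = (\<integral>\<^sup>+x. ennreal (sqrt (f x)) * ennreal (\<bar>f' x\<bar> / sqrt (f x)) \<partial>lborel)\<^sup>2"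
  proof (intro arg_cong[where f="\<lambda>x. x\<^sup>2"] nn_integral_cong_AE)
    show "AE x in lborel. ennreal \<bar>f' x\<bar> = ennreal (sqrt (f x)) * ennreal (\<bar>f' x\<bar> / sqrt (f x))"
      using f'_zero
    proof eventually_elim
      fix x assume "f x = 0 \<longrightarrow> f' x = 0"
      then show "ennreal \<bar>f' x\<bar> = ennreal (sqrt (f x)) * ennreal (\<bar>f' x\<bar> / sqrt (f x))"
        using f_nonneg[of x] by (cases "f x = 0") (auto simp: ennreal_mult[symmetric])
    qed
  qed
  also have "\<dots> \<le> (\<integral>\<^sup>+x. (ennreal (sqrt (f x)))\<^sup>2 \<partial>lborel) * (\<integral>\<^sup>+x. (ennreal (\<bar>f' x\<bar> / sqrt (f x)))\<^sup>2 \<partial>lborel)"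
    by (rule Cauchy_Schwarz_nn_integral) auto
  also have "(\<lambda>x. (ennreal (sqrt (f x)))\<^sup>2) = (\<lambda>x. ennreal (f x))"
    using f_nonneg by (auto simp: ennreal_power)
  also have "(\<lambda>x. (ennreal (\<bar>f' x\<bar> / sqrt (f x)))\<^sup>2) = (\<lambda>x. ennreal ((f' x)\<^sup>2 / f x))"
    using f_nonneg by (auto simp: ennreal_power power_divide)
  also have "(\<integral>\<^sup>+x. ennreal (f x) \<partial>lborel) * (\<integral>\<^sup>+x. ennreal ((f' x)\<^sup>2 / f x) \<partial>lborel) \<le> ennreal J"
    using info f_one by simp
  finally have "(\<integral>\<^sup>+x. ennreal \<bar>f' x\<bar> \<partial>lborel)\<^sup>2 \<le> (ennreal (sqrt J))\<^sup>2"
    using J_nonneg by (simp add: ennreal_power)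
  then show ?thesis by (rule ennreal_power2_le_imp_le)
qed

lemma integrable_f': "integrable lborel f'"
  using nn_integral_abs_f'_le by (intro integrableI_bounded) (auto intro: le_less_trans simp: ennreal_less_top)

lemma integral_abs_f'_le: "(\<integral>x. \<bar>f' x\<bar> \<partial>lborel) \<le> sqrt J"
proof -
  have "ennreal (\<integral>x. \<bar>f' x\<bar> \<partial>lborel) = (\<integral>\<^sup>+x. ennreal \<bar>f' x\<bar> \<partial>lborel)"
    using integrable_f' by (intro nn_integral_eq_integral[symmetric]) auto
  then have "ennreal (\<integral>x. \<bar>f' x\<bar> \<partial>lborel) \<le> ennreal (sqrt J)" using nn_integral_abs_f'_le by simp
  then show ?thesis using J_nonneg by (subst (asm) ennreal_le_iff) auto
qed

lemma integrable_f: "integrable lborel f"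
  by (rule integrableI_nonneg) (use f_nonneg f_one in auto)

text \<open>Any two values of \<open>f\<close> differ by at most the integral of
  \<open>\<bar>f'\<bar>\<close>, hence by \<open>sqrt J\<close>. A value exceeding
  \<open>sqrt J\<close> would then keep \<open>f\<close> above a positive constant everywhere,
  contradicting total mass 1.\<close>

lemma density_le_sqrt_info: "f x \<le> sqrt J"
proof -
  have le: "f x - f y \<le> sqrt J" for y
  proof -
    have *: "\<bar>f v - f u\<bar> \<le> sqrt J" if "u \<le> v" for u v
    proof -
      have "\<bar>f v - f u\<bar> \<le> (\<integral>x. \<bar>indicator {u..v} x *\<^sub>R f' x\<bar> \<partial>lborel)"
        unfolding FTC[OF that] set_lebesgue_integral_def by (rule integral_abs_bound)
      also have "\<dots> \<le> (\<integral>x. \<bar>f' x\<bar> \<partial>lborel)"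
        using integrable_f' f'_local[of u v]
        by (intro integral_mono) (auto simp: indicator_def set_integrable_def)
      finally show ?thesis using integral_abs_f'_le by simp
    qed
    show ?thesis using *[of x y] *[of y x] by (cases "x \<le> y") auto
  qed
  show ?thesis
  proof (rule ccontr)
    assume "\<not> f x \<le> sqrt J"
    then obtain c where c: "c > 0" "f x - sqrt J \<ge> c" by (intro that[of "f x - sqrt J"]) auto
    have cf: "c \<le> f y" for y using le[of y] c by linarith
    have "(\<integral>\<^sup>+y. ennreal c \<partial>(lborel :: real measure)) \<le> (\<integral>\<^sup>+y. ennreal (f y) \<partial>lborel)" by (intro nn_integral_mono ennreal_leI cf)
    then show False using c(1) f_one by (simp add: ennreal_mult_top top_unique)
  qed
qed

lemma emeasure_law_le:
  assumes "A \<in> sets borel"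
  shows "emeasure law A \<le> ennreal (sqrt J) * emeasure lborel A"
proof -
  have "emeasure law A = (\<integral>\<^sup>+x. ennreal (f x) * indicator A x \<partial>lborel)"
    unfolding law_def using assms by (simp add: emeasure_density)
  also have "\<dots> \<le> (\<integral>\<^sup>+x. ennreal (sqrt J) * indicator A x \<partial>lborel)"
    using density_le_sqrt_info by (intro nn_integral_mono mult_right_mono ennreal_leI) auto
  also have "\<dots> = ennreal (sqrt J) * emeasure lborel A" using assms by (simp add: nn_integral_cmult_indicator)
  finally show ?thesis .
qed

lemma J_pos: "0 < J"
proof (rule ccontr)
  assume "\<not> 0 < J"
  then have "J = 0" using J_nonneg by simp
  then have "f x = 0" for x using density_le_sqrt_info[of x] f_nonneg[of x] by simp
  then show False using f_one by simp
qed

lemma integral_law: "g \<in> borel_measurable borel \<Longrightarrow> (\<integral>x. g x \<partial>law) = (\<integral>x. f x * g x \<partial>lborel)"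
  for g :: "real \<Rightarrow> real"
  unfolding law_def using f_nonneg by (subst integral_density) auto

lemma integrable_law: "g \<in> borel_measurable borel \<Longrightarrow> integrable law g \<longleftrightarrow> integrable lborel (\<lambda>x. f x * g x)"
  for g :: "real \<Rightarrow> real"
  unfolding law_def using f_nonneg by (subst integrable_density) auto

text \<open>As the density is at most \<open>sqrt J\<close>, the interval of radius
  \<open>t = 1 / (4 * sqrt J)\<close> about \<open>m\<close> has mass at most 1/2; the other half of
  the mass contributes at least \<open>t\<^sup>2 / 2\<close>, which is \<open>1 / (32 * J)\<close>.
  With \<open>m\<close> the mean, this bounds the information of the Gaussian of equal
  variance.\<close>

lemma second_moment_ge:
  assumes "integrable law (\<lambda>x. (x - m)\<^sup>2)"
  shows "1 / (32 * J) \<le> (\<integral>x. (x - m)\<^sup>2 \<partial>law)"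
proof -
  interpret prob_space law by (rule prob_law)
  define t where "t = 1 / (4 * sqrt J)"
  have t: "t > 0" using J_pos by (simp add: t_def)
  let ?A = "{m - t..m + t}"
  have "emeasure law ?A \<le> ennreal (sqrt J) * emeasure lborel ?A" by (rule emeasure_law_le) simp
  also have "emeasure lborel ?A = ennreal (2 * t)" using t by simp
  also have "ennreal (sqrt J) * ennreal (2 * t) = ennreal (sqrt J * (2 * t))"
    using t J_pos by (intro ennreal_mult[symmetric]) auto
  also have "sqrt J * (2 * t) = 1 / 2" using J_pos by (simp add: t_def)
  finally have "prob ?A \<le> 1 / 2" unfolding emeasure_eq_measure by (subst (asm) ennreal_le_iff) auto
  then have half: "1 / 2 \<le> prob (UNIV - ?A)" using prob_compl[of ?A] by simp
  have "t\<^sup>2 * prob (UNIV - ?A) = (\<integral>x. t\<^sup>2 * indicator (UNIV - ?A) x \<partial>law)" by simp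
  also have "\<dots> \<le> (\<integral>x. (x - m)\<^sup>2 \<partial>law)"
  proof (rule integral_mono)
    show "integrable law (\<lambda>x. t\<^sup>2 * indicator (UNIV - ?A) x)" by (intro integrable_mult_right integrable_real_indicator) (auto simp: emeasure_eq_measure)
    fix x
    have "t\<^sup>2 \<le> (x - m)\<^sup>2" if "x \<notin> ?A"
    proof -
      have "\<bar>t\<bar> \<le> \<bar>x - m\<bar>" using that t by (auto simp: abs_if)
      then show ?thesis by (simp add: abs_le_square_iff)
    qed
    then show "t\<^sup>2 * indicator (UNIV - ?A) x \<le> (x - m)\<^sup>2" by (auto simp: indicator_def)
  qed fact
  finally have "t\<^sup>2 * (1 / 2) \<le> (\<integral>x. (x - m)\<^sup>2 \<partial>law)"
    using mult_left_mono[OF half, of "t\<^sup>2"] by simp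
  then show ?thesis using J_pos by (simp add: t_def power_divide power_mult_distrib)
qed

end

text \<open>\<open>R\<close> plays the role of the Fisher score of the random variable \<open>U\<close>: the identity is the integrated
  form of \<open>d/dx E h (x + U) = - E (h (x + U) * R)\<close>, which makes sense without any regularity of \<open>h\<close>.\<close>
definition has_score :: "'w measure \<Rightarrow> ('w \<Rightarrow> real) \<Rightarrow> ('w \<Rightarrow> real) \<Rightarrow> bool" where
  "has_score P U R \<longleftrightarrow> prob_space P \<and> U \<in> borel_measurable P \<and> integrable P R \<and>
     (\<forall>h x y. h \<in> borel_measurable borel \<longrightarrow> bounded (range h) \<longrightarrow> x \<le> y \<longrightarrow>
        (\<integral>\<omega>. h (y + U \<omega>) \<partial>P) - (\<integral>\<omega>. h (x + U \<omega>) \<partial>P)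
        = - (\<integral>s\<in>{x..y}. (\<integral>\<omega>. h (s + U \<omega>) * R \<omega> \<partial>P) \<partial>lborel))"

context fisher_density begin

lemma integrable_score: "integrable law score"
proof -
  have "integrable lborel (\<lambda>x. f x * score x)"
  proof (subst integrable_cong_AE)
    show "AE x in lborel. f x * score x = f' x" using f'_zero by eventually_elim (auto simp: score_def)
  qed (use integrable_f' in auto)
  then show ?thesis by (simp add: integrable_law)
qed

lemma integral_score:
  assumes [measurable]: "g \<in> borel_measurable borel"
  shows "(\<integral>x. g x * score x \<partial>law) = (\<integral>x. g x * f' x \<partial>lborel)"
  unfolding integral_law[OF borel_measurable_times[OF assms score_meas]]
proof (rule integral_cong_AE)
  show "AE x in lborel. f x * (g x * score x) = g x * f' x" using f'_zero by eventually_elim (auto simp: score_def)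
qed auto

text \<open>A shift of the argument of \<open>h\<close> is moved to the density, where the integral
  identity for \<open>f\<close> expresses the difference by \<open>f'\<close>. Fubini exchanges the
  shift variable with the space variable; \<open>h\<close> occurs only as a bounded factor.\<close>

lemma has_score_law: "has_score law (\<lambda>x. x) score"
  unfolding has_score_def
proof (intro conjI allI impI)
  fix h :: "real \<Rightarrow> real" and x y :: real
  assume hm[measurable]: "h \<in> borel_measurable borel" and hb: "bounded (range h)" and xy: "x \<le> y"
  obtain B where B: "\<And>z. \<bar>h z\<bar> \<le> B" using hb unfolding bounded_iff by auto
  have B0: "0 \<le> B" using B[of 0] by linarith
  have shift: "(\<integral>u. h (a + u) \<partial>law) = (\<integral>z. h z * f (z - a) \<partial>lborel)" for a
  proof -
    have "(\<integral>u. h (a + u) \<partial>law) = (\<integral>u. f u * h (a + u) \<partial>lborel)" by (rule integral_law) measurable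
    also have "\<dots> = (\<integral>u. (\<lambda>z. h z * f (z - a)) (a + 1 * u) \<partial>lborel)" by (simp add: mult.commute)
    also have "\<dots> = (\<integral>z. h z * f (z - a) \<partial>lborel)"
      using lborel_integral_real_affine[of 1 "\<lambda>z. h z * f (z - a)" a] by simp
    finally show ?thesis .
  qed
  have hf: "integrable lborel (\<lambda>z. h z * f (z - a))" for a
  proof (rule Bochner_Integration.integrable_bound[of _ "\<lambda>z. B * f (z - a)"])
    show "integrable lborel (\<lambda>z. B * f (z - a))"
      using lborel_integrable_real_affine[OF integrable_f, of 1 "- a"] by simp
    show "AE z in lborel. norm (h z * f (z - a)) \<le> norm (B * f (z - a))"
      using B B0 f_nonneg by (auto simp: abs_mult intro!: mult_right_mono)
  qed measurable
  define G where "G s z = indicator {x..y} s * (h z * f' (z - s))" for s z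
  have Gm[measurable]: "(\<lambda>(s,z). G s z) \<in> borel_measurable (lborel \<Otimes>\<^sub>M lborel)"
    unfolding G_def by measurable
  have Gint: "integrable (lborel \<Otimes>\<^sub>M lborel) (\<lambda>(s,z). G s z)"
  proof (rule integrableI_bounded)
    have "(\<integral>\<^sup>+v. ennreal (norm (case v of (s,z) \<Rightarrow> G s z)) \<partial>(lborel \<Otimes>\<^sub>M lborel)) = (\<integral>\<^sup>+s. \<integral>\<^sup>+z. ennreal \<bar>G s z\<bar> \<partial>lborel \<partial>lborel)"
      by (subst lborel.nn_integral_fst[symmetric]) auto
    also have "\<dots> \<le> (\<integral>\<^sup>+s. ennreal (B * (\<integral>z. \<bar>f' z\<bar> \<partial>lborel)) * indicator {x..y} s \<partial>lborel)"
    proof (rule nn_integral_mono)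
      fix s
      have "(\<integral>\<^sup>+z. ennreal \<bar>G s z\<bar> \<partial>lborel) \<le> (\<integral>\<^sup>+z. indicator {x..y} s * ennreal (B * \<bar>f' (z - s)\<bar>) \<partial>lborel)"
        unfolding G_def using B by (intro nn_integral_mono) (auto simp: abs_mult indicator_def intro!: ennreal_leI mult_right_mono)
      also have "\<dots> = indicator {x..y} s * (\<integral>\<^sup>+z. ennreal (B * \<bar>f' (z - s)\<bar>) \<partial>lborel)"
        by (rule nn_integral_cmult) measurable
      also have "(\<integral>\<^sup>+z. ennreal (B * \<bar>f' (z - s)\<bar>) \<partial>lborel) = (\<integral>\<^sup>+z. ennreal (B * \<bar>f' z\<bar>) \<partial>lborel)"
        using nn_integral_real_affine[of "\<lambda>z. ennreal (B * \<bar>f' z\<bar>)" 1 "- s"] by simp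
      also have "\<dots> = ennreal (\<integral>z. B * \<bar>f' z\<bar> \<partial>lborel)"
        using integrable_f' B0 by (intro nn_integral_eq_integral) auto
      finally show "(\<integral>\<^sup>+z. ennreal \<bar>G s z\<bar> \<partial>lborel) \<le> ennreal (B * (\<integral>z. \<bar>f' z\<bar> \<partial>lborel)) * indicator {x..y} s"
        by (simp add: mult.commute)
    qed
    also have "\<dots> < \<infinity>" by (simp add: nn_integral_cmult_indicator ennreal_mult_less_top emeasure_lborel_Icc_eq)
    finally show "(\<integral>\<^sup>+v. ennreal (norm (case v of (s,z) \<Rightarrow> G s z)) \<partial>(lborel \<Otimes>\<^sub>M lborel)) < \<infinity>" .
  qed measurable
  have diff: "h z * f (z - y) - h z * f (z - x) = - (\<integral>s. G s z \<partial>lborel)" for z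
  proof -
    have "f (z - x) - f (z - y) = (\<integral>t. indicator {z - y..z - x} t * f' t \<partial>lborel)"
      using FTC[of "z - y" "z - x"] xy by (simp add: set_lebesgue_integral_def)
    also have "\<dots> = (\<integral>s. indicator {z - y..z - x} (z + (-1) * s) * f' (z + (-1) * s) \<partial>lborel)"
      using lborel_integral_real_affine[of "-1" "\<lambda>t. indicator {z - y..z - x} t * f' t" z] by simp
    also have "\<dots> = (\<integral>s. indicator {x..y} s * f' (z - s) \<partial>lborel)"
      by (intro Bochner_Integration.integral_cong) (auto simp: indicator_def)
    finally have "h z * (f (z - x) - f (z - y)) = (\<integral>s. h z * (indicator {x..y} s * f' (z - s)) \<partial>lborel)" by simp
    also have "\<dots> = (\<integral>s. G s z \<partial>lborel)" unfolding G_def by (intro Bochner_Integration.integral_cong) auto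
    finally show ?thesis by (simp add: algebra_simps)
  qed
  have "(\<integral>u. h (y + u) \<partial>law) - (\<integral>u. h (x + u) \<partial>law) = (\<integral>z. h z * f (z - y) - h z * f (z - x) \<partial>lborel)"
    unfolding shift using hf by simp
  also have "\<dots> = - (\<integral>z. (\<integral>s. G s z \<partial>lborel) \<partial>lborel)" unfolding diff by simp
  also have "(\<integral>z. (\<integral>s. G s z \<partial>lborel) \<partial>lborel) = (\<integral>s. (\<integral>z. G s z \<partial>lborel) \<partial>lborel)"
    by (rule lborel_pair.Fubini_integral[OF Gint])
  also have "\<dots> = (\<integral>s\<in>{x..y}. (\<integral>u. h (s + u) * score u \<partial>law) \<partial>lborel)"
    unfolding set_lebesgue_integral_def
  proof (intro Bochner_Integration.integral_cong refl)
    fix s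
    have "(\<integral>u. h (s + u) * score u \<partial>law) = (\<integral>u. h (s + u) * f' u \<partial>lborel)" by (rule integral_score) measurable
    also have "\<dots> = (\<integral>z. h z * f' (z - s) \<partial>lborel)"
      using lborel_integral_real_affine[of 1 "\<lambda>z. h z * f' (z - s)" s] by simp
    finally show "(\<integral>z. G s z \<partial>lborel) = indicator {x..y} s *\<^sub>R (\<integral>u. h (s + u) * score u \<partial>law)"
      unfolding G_def by simp
  qed
  finally show "(\<integral>u. h (y + u) \<partial>law) - (\<integral>u. h (x + u) \<partial>law)
      = - (\<integral>s\<in>{x..y}. (\<integral>u. h (s + u) * score u \<partial>law) \<partial>lborel)" .
qed (use prob_law integrable_score in auto)

lemma score_second_moment: "integrable law (\<lambda>x. (score x)\<^sup>2)" "(\<integral>x. (score x)\<^sup>2 \<partial>law) \<le> J"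
proof -
  have eq: "f x * (score x)\<^sup>2 = (f' x)\<^sup>2 / f x" for x by (simp add: score_def power2_eq_square)
  have i: "integrable lborel (\<lambda>x. (f' x)\<^sup>2 / f x)"
    using info f_nonneg by (intro integrableI_nonneg) (auto intro: le_less_trans simp: ennreal_less_top)
  then show "integrable law (\<lambda>x. (score x)\<^sup>2)" by (subst integrable_law) (auto simp: eq)
  have "ennreal (\<integral>x. (f' x)\<^sup>2 / f x \<partial>lborel) \<le> ennreal J"
    using info f_nonneg by (subst nn_integral_eq_integral[OF i, symmetric]) auto
  then show "(\<integral>x. (score x)\<^sup>2 \<partial>law) \<le> J" by (subst integral_law) (auto simp: eq ennreal_le_iff J_nonneg)
qed

end

section \<open>Scores of independent sums and their averages\<close>

lemma has_scoreD:
  assumes "has_score P U R"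
  shows "prob_space P" "U \<in> borel_measurable P" "integrable P R"
    "\<And>h x y. h \<in> borel_measurable borel \<Longrightarrow> bounded (range h) \<Longrightarrow> x \<le> y \<Longrightarrow>
        (\<integral>\<omega>. h (y + U \<omega>) \<partial>P) - (\<integral>\<omega>. h (x + U \<omega>) \<partial>P)
        = - (\<integral>s\<in>{x..y}. (\<integral>\<omega>. h (s + U \<omega>) * R \<omega> \<partial>P) \<partial>lborel)"
  using assms unfolding has_score_def by blast+

text \<open>For the constant test function 1 on \<open>{0..1}\<close> the left side of the identity
  vanishes and the right side is minus the expectation of \<open>R\<close>.\<close>

lemma has_score_expectation_zero:
  assumes "has_score P U R"
  shows "(\<integral>\<omega>. R \<omega> \<partial>P) = 0"
proof -
  interpret prob_space P by (rule has_scoreD(1)[OF assms])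
  have "bounded (range (\<lambda>x::real. 1::real))" by simp
  from has_scoreD(4)[OF assms _ this, of 0 1] show ?thesis
    by (simp add: set_integral_const)
qed

lemma has_score_distr:
  assumes sc: "has_score Q (\<lambda>\<omega>. U (T \<omega>)) (\<lambda>\<omega>. R (T \<omega>))" and T[measurable]: "T \<in> measurable Q S"
    and U[measurable]: "U \<in> borel_measurable S" and R[measurable]: "R \<in> borel_measurable S"
  shows "has_score (distr Q S T) U R"
  unfolding has_score_def
proof (intro conjI allI impI)
  show "prob_space (distr Q S T)" by (rule prob_space.prob_space_distr[OF has_scoreD(1)[OF sc] T])
  show "integrable (distr Q S T) R" using has_scoreD(3)[OF sc] by (subst integrable_distr_eq) auto
  fix h :: "real \<Rightarrow> real" and x y :: real
  assume h[measurable]: "h \<in> borel_measurable borel" and *: "bounded (range h)" "x \<le> y"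
  have 1: "(\<integral>\<omega>. h (a + U \<omega>) \<partial>distr Q S T) = (\<integral>\<omega>. h (a + U (T \<omega>)) \<partial>Q)" for a
    by (rule integral_distr) measurable
  have 2: "(\<integral>\<omega>. h (a + U \<omega>) * R \<omega> \<partial>distr Q S T) = (\<integral>\<omega>. h (a + U (T \<omega>)) * R (T \<omega>) \<partial>Q)" for a
    by (rule integral_distr) measurable
  show "(\<integral>\<omega>. h (y + U \<omega>) \<partial>distr Q S T) - (\<integral>\<omega>. h (x + U \<omega>) \<partial>distr Q S T)
        = - (\<integral>s\<in>{x..y}. (\<integral>\<omega>. h (s + U \<omega>) * R \<omega> \<partial>distr Q S T) \<partial>lborel)"
    unfolding 1 2 by (rule has_scoreD(4)[OF sc h *])
qed (use U in simp)

text \<open>For a fixed value of the independent \<open>V\<close> the identity holds with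
  \<open>h\<close> shifted by that value, again a bounded measurable function; it remains to
  integrate over \<open>V\<close>. The score of \<open>U\<close> thus serves for
  \<open>U + V\<close> without taking a conditional expectation.\<close>

lemma has_score_pair:
  assumes sc: "has_score P U R" and Q: "prob_space Q" and V[measurable]: "V \<in> borel_measurable Q"
  shows "has_score (P \<Otimes>\<^sub>M Q) (\<lambda>\<omega>. U (fst \<omega>) + V (snd \<omega>)) (\<lambda>\<omega>. R (fst \<omega>))"
proof -
  interpret P: prob_space P by (rule has_scoreD(1)[OF sc])
  interpret Q: prob_space Q by fact
  interpret PQ: pair_prob_space P Q ..
  interpret LQ: pair_sigma_finite lborel Q ..
  have U[measurable]: "U \<in> borel_measurable P" and Ri: "integrable P R" using has_scoreD[OF sc] by auto
  have R[measurable]: "R \<in> borel_measurable P" using Ri by auto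
  have RiPQ: "integrable (P \<Otimes>\<^sub>M Q) (\<lambda>\<omega>. R (fst \<omega>))"
  proof (rule integrableI_bounded)
    have "(\<integral>\<^sup>+\<omega>. ennreal (norm (R (fst \<omega>))) \<partial>(P \<Otimes>\<^sub>M Q)) = (\<integral>\<^sup>+a. ennreal (norm (R a)) \<partial>P)"
      by (subst Q.nn_integral_fst[symmetric]) (auto simp: Q.emeasure_space_1)
    also have "\<dots> < \<infinity>" using Ri unfolding integrable_iff_bounded by simp
    finally show "(\<integral>\<^sup>+\<omega>. ennreal (norm (R (fst \<omega>))) \<partial>(P \<Otimes>\<^sub>M Q)) < \<infinity>" .
  qed measurable
  show ?thesis
    unfolding has_score_def
  proof (intro conjI allI impI)
    fix h :: "real \<Rightarrow> real" and x y :: real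
    assume hm[measurable]: "h \<in> borel_measurable borel" and hb: "bounded (range h)" and xy: "x \<le> y"
    obtain B where B: "\<And>z. \<bar>h z\<bar> \<le> B" using hb unfolding bounded_iff by auto
    have B0: "0 \<le> B" using B[of 0] by linarith
    have hint: "integrable (P \<Otimes>\<^sub>M Q) (\<lambda>(a, b). h (s + (U a + V b)))" for s
      by (rule PQ.P.integrable_const_bound[of _ B]) (use B in auto)
    have hRint: "integrable (P \<Otimes>\<^sub>M Q) (\<lambda>(a, b). h (s + (U a + V b)) * R a)" for s
      by (rule Bochner_Integration.integrable_bound[OF integrable_mult_right[OF RiPQ, of B]])
        (use B B0 in \<open>auto simp: abs_mult case_prod_unfold intro!: mult_right_mono\<close>)
    have e: "(\<integral>\<omega>. h (s + (U (fst \<omega>) + V (snd \<omega>))) \<partial>(P \<Otimes>\<^sub>M Q)) = (\<integral>b. (\<integral>a. h (s + (U a + V b)) \<partial>P) \<partial>Q)" for s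
      using PQ.integral_snd[OF hint[of s]] by (simp add: case_prod_unfold)
    have ib: "integrable Q (\<lambda>b. (\<integral>a. h (s + (U a + V b)) \<partial>P))" for s
      using PQ.integrable_snd[OF hint[of s]] by simp
    define \<phi> where "\<phi> s b = (\<integral>a. h (s + (U a + V b)) * R a \<partial>P)" for s b
    have \<phi>m[measurable]: "(\<lambda>(s, b). \<phi> s b) \<in> borel_measurable (lborel \<Otimes>\<^sub>M Q)"
      unfolding \<phi>_def by measurable
    have hRi: "integrable P (\<lambda>a. h (s + (U a + V b)) * R a)" if "b \<in> space Q" for s b
      by (rule Bochner_Integration.integrable_bound[OF integrable_mult_right[OF Ri, of B]])
        (use B B0 that in \<open>auto simp: abs_mult intro!: mult_right_mono\<close>)
    have \<phi>b: "\<bar>\<phi> s b\<bar> \<le> B * (\<integral>a. \<bar>R a\<bar> \<partial>P)" if "b \<in> space Q" for s b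
    proof -
      have "\<bar>\<phi> s b\<bar> \<le> (\<integral>a. \<bar>h (s + (U a + V b)) * R a\<bar> \<partial>P)" unfolding \<phi>_def by (rule integral_abs_bound)
      also have "\<dots> \<le> (\<integral>a. B * \<bar>R a\<bar> \<partial>P)"
        by (rule integral_mono[OF integrable_abs[OF hRi[OF that]] integrable_mult_right[OF integrable_abs[OF Ri]]])
          (use B in \<open>auto simp: abs_mult intro!: mult_right_mono\<close>)
      finally show ?thesis by simp
    qed
    define C where "C = B * (\<integral>a. \<bar>R a\<bar> \<partial>P)"
    have \<phi>int: "integrable (lborel \<Otimes>\<^sub>M Q) (\<lambda>(s, b). indicator {x..y} s * \<phi> s b)"
    proof (rule integrableI_bounded)
      have "(\<integral>\<^sup>+v. ennreal (norm (case v of (s,b) \<Rightarrow> indicator {x..y} s * \<phi> s b)) \<partial>(lborel \<Otimes>\<^sub>M Q))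
          \<le> (\<integral>\<^sup>+v. ennreal C * indicator {x..y} (fst v) \<partial>(lborel \<Otimes>\<^sub>M Q))"
        using \<phi>b by (intro nn_integral_mono) (auto simp: space_pair_measure indicator_def C_def intro!: ennreal_leI)
      also have "\<dots> = (\<integral>\<^sup>+s. ennreal C * indicator {x..y} s \<partial>lborel)"
        by (subst Q.nn_integral_fst[symmetric]) (auto simp: Q.emeasure_space_1)
      also have "\<dots> < \<infinity>" by (simp add: nn_integral_cmult_indicator ennreal_mult_less_top emeasure_lborel_Icc_eq)
      finally show "(\<integral>\<^sup>+v. ennreal (norm (case v of (s,b) \<Rightarrow> indicator {x..y} s * \<phi> s b)) \<partial>(lborel \<Otimes>\<^sub>M Q)) < \<infinity>" .
    qed measurable
    have "(\<integral>\<omega>. h (y + (U (fst \<omega>) + V (snd \<omega>))) \<partial>(P \<Otimes>\<^sub>M Q)) - (\<integral>\<omega>. h (x + (U (fst \<omega>) + V (snd \<omega>))) \<partial>(P \<Otimes>\<^sub>M Q))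
        = (\<integral>b. (\<integral>a. h (y + (U a + V b)) \<partial>P) - (\<integral>a. h (x + (U a + V b)) \<partial>P) \<partial>Q)"
      unfolding e using ib by simp
    also have "\<dots> = (\<integral>b. - (\<integral>s. indicator {x..y} s * \<phi> s b \<partial>lborel) \<partial>Q)"
    proof (rule Bochner_Integration.integral_cong[OF refl])
      fix b
      have "range (\<lambda>z. h (z + V b)) \<subseteq> range h" by auto
      then have "bounded (range (\<lambda>z. h (z + V b)))" by (rule bounded_subset[OF hb])
      from has_scoreD(4)[OF sc _ this xy]
      have "(\<integral>a. h (y + U a + V b) \<partial>P) - (\<integral>a. h (x + U a + V b) \<partial>P)
          = - (\<integral>s\<in>{x..y}. (\<integral>a. h (s + U a + V b) * R a \<partial>P) \<partial>lborel)" by simp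
      then show "(\<integral>a. h (y + (U a + V b)) \<partial>P) - (\<integral>a. h (x + (U a + V b)) \<partial>P) = - (\<integral>s. indicator {x..y} s * \<phi> s b \<partial>lborel)"
        unfolding set_lebesgue_integral_def \<phi>_def by (simp add: add.assoc)
    qed
    also have "\<dots> = - (\<integral>b. (\<integral>s. indicator {x..y} s * \<phi> s b \<partial>lborel) \<partial>Q)" by simp
    also have "(\<integral>b. (\<integral>s. indicator {x..y} s * \<phi> s b \<partial>lborel) \<partial>Q) = (\<integral>s. (\<integral>b. indicator {x..y} s * \<phi> s b \<partial>Q) \<partial>lborel)"
      by (rule LQ.Fubini_integral[OF \<phi>int])
    also have "\<dots> = (\<integral>s\<in>{x..y}. (\<integral>\<omega>. h (s + (U (fst \<omega>) + V (snd \<omega>))) * R (fst \<omega>) \<partial>(P \<Otimes>\<^sub>M Q)) \<partial>lborel)"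
      unfolding set_lebesgue_integral_def
    proof (intro Bochner_Integration.integral_cong refl)
      fix s
      show "(\<integral>b. indicator {x..y} s * \<phi> s b \<partial>Q) = indicator {x..y} s *\<^sub>R (\<integral>\<omega>. h (s + (U (fst \<omega>) + V (snd \<omega>))) * R (fst \<omega>) \<partial>(P \<Otimes>\<^sub>M Q))"
        using PQ.integral_snd[OF hRint[of s]] by (simp add: case_prod_unfold \<phi>_def)
    qed
    finally show "(\<integral>\<omega>. h (y + (U (fst \<omega>) + V (snd \<omega>))) \<partial>(P \<Otimes>\<^sub>M Q)) - (\<integral>\<omega>. h (x + (U (fst \<omega>) + V (snd \<omega>))) \<partial>(P \<Otimes>\<^sub>M Q))
       = - (\<integral>s\<in>{x..y}. (\<integral>\<omega>. h (s + (U (fst \<omega>) + V (snd \<omega>))) * R (fst \<omega>) \<partial>(P \<Otimes>\<^sub>M Q)) \<partial>lborel)" .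
  qed (use RiPQ PQ.prob_space_axioms in auto)
qed

text \<open>The other coordinates act as the independent summand \<open>V\<close> of
  \<open>has_score_pair\<close>. Consequently every coordinate offers its own score for one and the
  same sum.\<close>

lemma has_score_PiM:
  fixes \<kappa> :: "'i \<Rightarrow> real measure"
  assumes fin: "finite I" and i: "i \<in> I" and pr: "\<And>j. j \<in> I \<Longrightarrow> prob_space (\<kappa> j)"
    and st: "\<And>j. j \<in> I \<Longrightarrow> sets (\<kappa> j) = sets borel"
    and sc: "has_score (\<kappa> i) (\<lambda>x. x) r"
  shows "has_score (Pi\<^sub>M I \<kappa>) (\<lambda>x. \<Sum>j\<in>I. x j) (\<lambda>x. r (x i))"
proof -
  define I' where "I' = I - {i}"
  have I: "I = insert i I'" "i \<notin> I'" "finite I'" using fin i by (auto simp: I'_def)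
  have Vm: "(\<lambda>x. \<Sum>j\<in>K. x j) \<in> borel_measurable (Pi\<^sub>M L \<kappa>)" if "K \<subseteq> L" "L \<subseteq> I" for K L
  proof (rule borel_measurable_sum)
    fix j assume "j \<in> K"
    then have "(\<lambda>x. x j) \<in> measurable (Pi\<^sub>M L \<kappa>) (\<kappa> j)" using that by (intro measurable_component_singleton) auto
    then show "(\<lambda>x. x j) \<in> borel_measurable (Pi\<^sub>M L \<kappa>)" using st[of j] \<open>j \<in> K\<close> that by (auto cong: measurable_cong_sets)
  qed
  have rm: "r \<in> borel_measurable (\<kappa> i)" using has_scoreD(3)[OF sc] by auto
  have sp: "has_score (\<kappa> i \<Otimes>\<^sub>M Pi\<^sub>M I' \<kappa>) (\<lambda>\<omega>. fst \<omega> + (\<Sum>j\<in>I'. snd \<omega> j)) (\<lambda>\<omega>. r (fst \<omega>))"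
    by (rule has_score_pair[OF sc]) (use pr I Vm in \<open>auto intro!: prob_space_PiM\<close>)
  have eq: "Pi\<^sub>M I \<kappa> = distr (\<kappa> i \<Otimes>\<^sub>M Pi\<^sub>M I' \<kappa>) (Pi\<^sub>M I \<kappa>) (\<lambda>(x, X). X(i := x))"
    unfolding I(1) by (rule distr_pair_PiM_eq_PiM[symmetric]) (use pr I in auto)
  show ?thesis
  proof (subst eq, rule has_score_distr)
    have 1: "(\<Sum>j\<in>I. (case \<omega> of (x, X) \<Rightarrow> X(i := x)) j) = fst \<omega> + (\<Sum>j\<in>I'. snd \<omega> j)"
      and 2: "(case \<omega> of (x, X) \<Rightarrow> X(i := x)) i = fst \<omega>" for \<omega> :: "real \<times> ('i \<Rightarrow> real)"
      unfolding I(1) using I(2,3) by (cases \<omega>; auto intro!: sum.cong)+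
    show "has_score (\<kappa> i \<Otimes>\<^sub>M Pi\<^sub>M I' \<kappa>) (\<lambda>\<omega>. \<Sum>j\<in>I. (case \<omega> of (x, X) \<Rightarrow> X(i := x)) j) (\<lambda>\<omega>. r ((case \<omega> of (x, X) \<Rightarrow> X(i := x)) i))"
      unfolding 1 2 by (rule sp)
    show "(\<lambda>(x, X). X(i := x)) \<in> measurable (\<kappa> i \<Otimes>\<^sub>M Pi\<^sub>M I' \<kappa>) (Pi\<^sub>M I \<kappa>)"
      unfolding I(1) by measurable
    show "(\<lambda>x. r (x i)) \<in> borel_measurable (Pi\<^sub>M I \<kappa>)"
      by (rule measurable_compose[OF measurable_component_singleton[OF i, of \<kappa>] rm])
  qed (use Vm in auto)
qed

text \<open>For fixed \<open>U\<close> the identity is affine in \<open>R\<close>, so scores may be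
  averaged. Averaging is what reduces the norm when the scores are orthogonal.\<close>

lemma has_score_sum:
  assumes fin: "finite B" and sc: "\<And>i. i \<in> B \<Longrightarrow> has_score P U (R i)" and B: "B \<noteq> {}"
  shows "has_score P U (\<lambda>\<omega>. (\<Sum>i\<in>B. R i \<omega>) / real (card B))"
proof -
  obtain i0 where i0: "i0 \<in> B" using B by blast
  interpret prob_space P by (rule has_scoreD(1)[OF sc[OF i0]])
  have Um[measurable]: "U \<in> borel_measurable P" by (rule has_scoreD(2)[OF sc[OF i0]])
  have c: "real (card B) > 0" using fin B by (simp add: card_gt_0_iff)
  have Ri: "integrable P (R i)" if "i \<in> B" for i using has_scoreD(3)[OF sc[OF that]] .
  show ?thesis
    unfolding has_score_def
  proof (intro conjI allI impI)
    show "integrable P (\<lambda>\<omega>. (\<Sum>i\<in>B. R i \<omega>) / real (card B))" using Ri by auto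
    fix h :: "real \<Rightarrow> real" and x y :: real
    assume hm[measurable]: "h \<in> borel_measurable borel" and hb: "bounded (range h)" and xy: "x \<le> y"
    obtain M where M: "\<And>z. \<bar>h z\<bar> \<le> M" using hb unfolding bounded_iff by auto
    have M0: "0 \<le> M" using M[of 0] by linarith
    define D where "D = (\<integral>\<omega>. h (y + U \<omega>) \<partial>P) - (\<integral>\<omega>. h (x + U \<omega>) \<partial>P)"
    define \<psi> where "\<psi> i s = (\<integral>\<omega>. h (s + U \<omega>) * R i \<omega> \<partial>P)" for i s
    have hRi: "integrable P (\<lambda>\<omega>. h (s + U \<omega>) * R i \<omega>)" if "i \<in> B" for s i
      by (rule Bochner_Integration.integrable_bound[OF integrable_mult_right[OF Ri[OF that], of M]])
        (use M M0 Ri[OF that] in \<open>auto simp: abs_mult intro!: mult_right_mono\<close>)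
    have \<psi>i: "set_integrable lborel {x..y} (\<psi> i)" if "i \<in> B" for i
    proof -
      have [measurable]: "R i \<in> borel_measurable P" using Ri[OF that] by auto
      have "\<psi> i \<in> borel_measurable lborel" unfolding \<psi>_def by measurable
      moreover have "\<bar>\<psi> i s\<bar> \<le> M * (\<integral>\<omega>. \<bar>R i \<omega>\<bar> \<partial>P)" for s
      proof -
        have "\<bar>\<psi> i s\<bar> \<le> (\<integral>\<omega>. \<bar>h (s + U \<omega>) * R i \<omega>\<bar> \<partial>P)" unfolding \<psi>_def by (rule integral_abs_bound)
        also have "\<dots> \<le> (\<integral>\<omega>. M * \<bar>R i \<omega>\<bar> \<partial>P)"
          by (rule integral_mono[OF integrable_abs[OF hRi[OF that]] integrable_mult_right[OF integrable_abs[OF Ri[OF that]]]])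
            (use M in \<open>auto simp: abs_mult intro!: mult_right_mono\<close>)
        finally show ?thesis by simp
      qed
      ultimately show ?thesis unfolding set_integrable_def
        by (intro integrableI_bounded_set_indicator[of _ _ _ "M * (\<integral>\<omega>. \<bar>R i \<omega>\<bar> \<partial>P)"]) (auto simp: emeasure_lborel_Icc_eq)
    qed
    have D: "D = - (\<integral>s\<in>{x..y}. \<psi> i s \<partial>lborel)" if "i \<in> B" for i
      unfolding D_def \<psi>_def by (rule has_scoreD(4)[OF sc[OF that] hm hb xy])
    have "real (card B) * D = (\<Sum>i\<in>B. - (\<integral>s\<in>{x..y}. \<psi> i s \<partial>lborel))"
    proof -
      have "(\<Sum>i\<in>B. - (\<integral>s\<in>{x..y}. \<psi> i s \<partial>lborel)) = (\<Sum>i\<in>B. D)" by (rule sum.cong[OF refl]) (rule D[symmetric])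
      then show ?thesis by simp
    qed
    also have "\<dots> = - (\<integral>s. (\<Sum>i\<in>B. indicator {x..y} s *\<^sub>R \<psi> i s) \<partial>lborel)"
      using \<psi>i unfolding set_lebesgue_integral_def set_integrable_def
      by (subst Bochner_Integration.integral_sum) (auto simp: sum_negf)
    also have "(\<integral>s. (\<Sum>i\<in>B. indicator {x..y} s *\<^sub>R \<psi> i s) \<partial>lborel) = (\<integral>s. real (card B) * (indicator {x..y} s *\<^sub>R (\<integral>\<omega>. h (s + U \<omega>) * ((\<Sum>i\<in>B. R i \<omega>) / real (card B)) \<partial>P)) \<partial>lborel)"
    proof (rule Bochner_Integration.integral_cong[OF refl])
      fix s
      have "(\<Sum>i\<in>B. \<psi> i s) = (\<integral>\<omega>. (\<Sum>i\<in>B. h (s + U \<omega>) * R i \<omega>) \<partial>P)"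
        unfolding \<psi>_def using hRi by (subst Bochner_Integration.integral_sum) auto
      also have "\<dots> = (\<integral>\<omega>. real (card B) * (h (s + U \<omega>) * ((\<Sum>i\<in>B. R i \<omega>) / real (card B))) \<partial>P)"
        using c by (intro Bochner_Integration.integral_cong) (auto simp: sum_distrib_left[symmetric])
      finally show "(\<Sum>i\<in>B. indicator {x..y} s *\<^sub>R \<psi> i s) = real (card B) * (indicator {x..y} s *\<^sub>R (\<integral>\<omega>. h (s + U \<omega>) * ((\<Sum>i\<in>B. R i \<omega>) / real (card B)) \<partial>P))"
        by (simp add: sum_distrib_left[symmetric])
    qed
    finally have "real (card B) * D = real (card B) * - (\<integral>s\<in>{x..y}. (\<integral>\<omega>. h (s + U \<omega>) * ((\<Sum>i\<in>B. R i \<omega>) / real (card B)) \<partial>P) \<partial>lborel)"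
      unfolding set_lebesgue_integral_def by simp
    then show "(\<integral>\<omega>. h (y + U \<omega>) \<partial>P) - (\<integral>\<omega>. h (x + U \<omega>) \<partial>P)
        = - (\<integral>s\<in>{x..y}. (\<integral>\<omega>. h (s + U \<omega>) * ((\<Sum>i\<in>B. R i \<omega>) / real (card B)) \<partial>P) \<partial>lborel)"
      unfolding D_def using c by (subst (asm) mult_cancel_left) auto
  qed (use prob_space_axioms in auto)
qed

text \<open>This is the nonnegativity of the variance of \<open>\<bar>Z\<bar>\<close>.\<close>

lemma (in prob_space) expectation_abs_le_sqrt:
  fixes Z :: "'a \<Rightarrow> real"
  assumes [measurable]: "Z \<in> borel_measurable M" and i2: "integrable M (\<lambda>x. (Z x)\<^sup>2)"
  shows "integrable M Z" "expectation (\<lambda>x. \<bar>Z x\<bar>) \<le> sqrt (expectation (\<lambda>x. (Z x)\<^sup>2))"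
proof -
  show i1: "integrable M Z"
  proof (rule Bochner_Integration.integrable_bound[of _ "\<lambda>x. 1 + (Z x)\<^sup>2"])
    have "\<bar>z\<bar> \<le> 1 + z\<^sup>2" for z :: real
      using sum_squares_bound[of "\<bar>z\<bar>" 1] by (simp add: power2_eq_square)
    then show "AE x in M. norm (Z x) \<le> norm (1 + (Z x)\<^sup>2)" by auto
  qed (use i2 in auto)
  define c where "c = expectation (\<lambda>x. \<bar>Z x\<bar>)"
  have "0 \<le> expectation (\<lambda>x. (\<bar>Z x\<bar> - c)\<^sup>2)" by simp
  also have "\<dots> = expectation (\<lambda>x. (Z x)\<^sup>2 - 2 * c * \<bar>Z x\<bar> + c\<^sup>2)"
    by (intro Bochner_Integration.integral_cong) (auto simp: power2_diff algebra_simps)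
  also have "\<dots> = expectation (\<lambda>x. (Z x)\<^sup>2) - 2 * c * c + c\<^sup>2"
    using i1 i2 by (simp add: prob_space c_def)
  finally have "c\<^sup>2 \<le> expectation (\<lambda>x. (Z x)\<^sup>2)" by (simp add: power2_eq_square)
  then show "expectation (\<lambda>x. \<bar>Z x\<bar>) \<le> sqrt (expectation (\<lambda>x. (Z x)\<^sup>2))"
    unfolding c_def by (rule real_le_rsqrt)
qed

lemma PiM_orthogonal_sum:
  fixes \<kappa> :: "'i \<Rightarrow> real measure" and r :: "'i \<Rightarrow> real \<Rightarrow> real"
  assumes fin: "finite B" and pr: "\<And>j. j \<in> B \<Longrightarrow> prob_space (\<kappa> j)"
    and r1: "\<And>j. j \<in> B \<Longrightarrow> integrable (\<kappa> j) (r j)" "\<And>j. j \<in> B \<Longrightarrow> (\<integral>x. r j x \<partial>\<kappa> j) = 0"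
    and i2: "\<And>j. j \<in> B \<Longrightarrow> integrable (\<kappa> j) (\<lambda>x. (r j x)\<^sup>2)"
  shows "(\<lambda>x. \<Sum>j\<in>B. r j (x j)) \<in> borel_measurable (Pi\<^sub>M B \<kappa>)"
    and "integrable (Pi\<^sub>M B \<kappa>) (\<lambda>x. (\<Sum>j\<in>B. r j (x j))\<^sup>2)"
    and "(\<integral>x. (\<Sum>j\<in>B. r j (x j))\<^sup>2 \<partial>Pi\<^sub>M B \<kappa>) = (\<Sum>j\<in>B. (\<integral>x. (r j x)\<^sup>2 \<partial>\<kappa> j))"
proof -
  \<comment> \<open>The product rules used here ask for a probability measure at every index, so a
    point mass is put outside \<open>B\<close>.\<close>
  define \<kappa>' where "\<kappa>' j = (if j \<in> B then \<kappa> j else return borel 0)" for j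
  have eq: "Pi\<^sub>M B \<kappa> = Pi\<^sub>M B \<kappa>'" by (rule PiM_cong) (auto simp: \<kappa>'_def)
  have pr': "prob_space (\<kappa>' j)" for j unfolding \<kappa>'_def using pr by (auto intro: prob_space_return)
  interpret product_prob_space \<kappa>' by (rule product_prob_spaceI) (rule pr')
  have rm: "(\<lambda>x. r i (x i)) \<in> borel_measurable (Pi\<^sub>M B \<kappa>)" if "i \<in> B" for i
    by (rule measurable_compose[OF measurable_component_singleton[OF that, of \<kappa>]]) (use r1(1)[OF that] in auto)
  have cross: "integrable (Pi\<^sub>M B \<kappa>) (\<lambda>x. r i (x i) * r j (x j)) \<and>
      (\<integral>x. r i (x i) * r j (x j) \<partial>Pi\<^sub>M B \<kappa>) = (if i = j then (\<integral>x. (r i x)\<^sup>2 \<partial>\<kappa> i) else 0)"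
    if ij: "i \<in> B" "j \<in> B" for i j
  proof -
    \<comment> \<open>Diagonal and mixed terms are both written as a product over all of
      \<open>B\<close> with factors 1 elsewhere. If \<open>i \<noteq> j\<close>, the factor at
      \<open>i\<close> has mean zero and annihilates the product.\<close>
    define g where "g k = (\<lambda>x. (if k = i then r i x else 1) * (if k = j then r j x else 1))" for k
    have gi: "integrable (\<kappa>' k) (g k)" if "k \<in> B" for k
    proof -
      interpret K: prob_space "\<kappa> k" by (rule pr[OF that])
      show ?thesis using that r1(1)[of k] i2[of k] unfolding g_def \<kappa>'_def
        by (cases "k = i"; cases "k = j") (simp_all add: power2_eq_square)
    qed
    have prod: "(\<Prod>k\<in>B. g k (x k)) = r i (x i) * r j (x j)" for x
      unfolding g_def prod.distrib using fin ij by (simp add: prod.If_cases prod.delta[OF fin, of i "\<lambda>k. r k (x k)", symmetric] if_distrib cong: if_cong)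
    have "integrable (Pi\<^sub>M B \<kappa>') (\<lambda>x. \<Prod>k\<in>B. g k (x k))" by (rule product_integrable_prod[OF fin gi])
    moreover have "(\<integral>x. (\<Prod>k\<in>B. g k (x k)) \<partial>Pi\<^sub>M B \<kappa>') = (\<Prod>k\<in>B. integral\<^sup>L (\<kappa>' k) (g k))"
      by (rule product_integral_prod[OF fin gi])
    moreover have "(\<Prod>k\<in>B. integral\<^sup>L (\<kappa>' k) (g k)) = (if i = j then (\<integral>x. (r i x)\<^sup>2 \<partial>\<kappa> i) else 0)"
    proof (cases "i = j")
      case True
      have "integral\<^sup>L (\<kappa>' k) (g k) = (if k = i then (\<integral>x. (r i x)\<^sup>2 \<partial>\<kappa> i) else 1)" if "k \<in> B" for k
      proof -
        interpret K: prob_space "\<kappa> k" by (rule pr[OF that])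
        show ?thesis using that True K.prob_space unfolding g_def \<kappa>'_def by (auto simp: power2_eq_square)
      qed
      then have "(\<Prod>k\<in>B. integral\<^sup>L (\<kappa>' k) (g k)) = (\<Prod>k\<in>B. if k = i then (\<integral>x. (r i x)\<^sup>2 \<partial>\<kappa> i) else 1)"
        by (rule prod.cong[OF refl])
      then show ?thesis using True fin ij by simp
    next
      case False
      then have "integral\<^sup>L (\<kappa>' i) (g i) = 0" using r1(2)[OF ij(1)] ij unfolding g_def \<kappa>'_def by simp
      then show ?thesis using False fin ij by (auto intro!: prod_zero)
    qed
    ultimately show ?thesis unfolding prod eq by simp
  qed
  define Z where "Z x = (\<Sum>j\<in>B. r j (x j))" for x
  have Z2: "(Z x)\<^sup>2 = (\<Sum>i\<in>B. \<Sum>j\<in>B. r i (x i) * r j (x j))" for x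
    unfolding Z_def by (simp add: power2_eq_square sum_product)
  show "(\<lambda>x. \<Sum>j\<in>B. r j (x j)) \<in> borel_measurable (Pi\<^sub>M B \<kappa>)" by (rule borel_measurable_sum) (rule rm)
  show "integrable (Pi\<^sub>M B \<kappa>) (\<lambda>x. (\<Sum>j\<in>B. r j (x j))\<^sup>2)"
    unfolding Z_def[symmetric] Z2 using cross by auto
  have "(\<integral>x. (Z x)\<^sup>2 \<partial>Pi\<^sub>M B \<kappa>) = (\<Sum>i\<in>B. \<Sum>j\<in>B. (if i = j then (\<integral>x. (r i x)\<^sup>2 \<partial>\<kappa> i) else 0))"
    unfolding Z2 using cross by (subst Bochner_Integration.integral_sum; simp)
  also have "\<dots> = (\<Sum>j\<in>B. (\<integral>x. (r j x)\<^sup>2 \<partial>\<kappa> j))" using fin by simp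
  finally show "(\<integral>x. (\<Sum>j\<in>B. r j (x j))\<^sup>2 \<partial>Pi\<^sub>M B \<kappa>) = (\<Sum>j\<in>B. (\<integral>x. (r j x)\<^sup>2 \<partial>\<kappa> j))"
    unfolding Z_def .
qed

text \<open>Scores of independent summands are orthogonal, so their average over a block of \<open>m\<close> summands
  has \<open>L\<^sup>1\<close>-norm of order \<open>m\<^sup>-\<^sup>1\<^sup>/\<^sup>2\<close>.\<close>
lemma block_score:
  fixes \<kappa> :: "'i \<Rightarrow> real measure"
  assumes fin: "finite B" and B: "B \<noteq> {}" and st: "\<And>j. j \<in> B \<Longrightarrow> sets (\<kappa> j) = sets borel"
    and sc: "\<And>j. j \<in> B \<Longrightarrow> has_score (\<kappa> j) (\<lambda>x. x) (r j)"
    and i2: "\<And>j. j \<in> B \<Longrightarrow> integrable (\<kappa> j) (\<lambda>x. (r j x)\<^sup>2)"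
    and J: "\<And>j. j \<in> B \<Longrightarrow> (\<integral>x. (r j x)\<^sup>2 \<partial>\<kappa> j) \<le> J j"
  obtains R where "has_score (Pi\<^sub>M B \<kappa>) (\<lambda>x. \<Sum>j\<in>B. x j) R"
    "(\<integral>x. \<bar>R x\<bar> \<partial>Pi\<^sub>M B \<kappa>) \<le> sqrt (\<Sum>j\<in>B. J j) / real (card B)"
proof -
  have pr: "prob_space (\<kappa> j)" if "j \<in> B" for j by (rule has_scoreD(1)[OF sc[OF that]])
  interpret PP: prob_space "Pi\<^sub>M B \<kappa>" by (rule prob_space_PiM) (rule pr)
  have sum: "has_score (Pi\<^sub>M B \<kappa>) (\<lambda>x. \<Sum>j\<in>B. x j) (\<lambda>x. r i (x i))" if "i \<in> B" for i
    by (rule has_score_PiM[of B i \<kappa> "r i", OF fin that pr st sc[OF that]])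
  define Z where "Z x = (\<Sum>j\<in>B. r j (x j))" for x
  note orth = PiM_orthogonal_sum[of B \<kappa> r, OF fin pr has_scoreD(3)[OF sc] has_score_expectation_zero[OF sc] i2, folded Z_def]
  have "(\<integral>x. (Z x)\<^sup>2 \<partial>Pi\<^sub>M B \<kappa>) \<le> (\<Sum>i\<in>B. J i)"
    by (rule ord_eq_le_trans[OF orth(3) sum_mono]) (use J in auto)
  then have "(\<integral>x. \<bar>Z x\<bar> \<partial>Pi\<^sub>M B \<kappa>) \<le> sqrt (\<Sum>i\<in>B. J i)"
    using PP.expectation_abs_le_sqrt(2)[OF orth(1,2)] by (meson order_trans real_sqrt_le_mono)
  moreover have "has_score (Pi\<^sub>M B \<kappa>) (\<lambda>x. \<Sum>j\<in>B. x j) (\<lambda>x. Z x / real (card B))"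
    unfolding Z_def by (rule has_score_sum[OF fin sum B])
  ultimately show ?thesis
    by (intro that[of "\<lambda>x. Z x / real (card B)"]) (auto simp: abs_divide intro!: divide_right_mono)
qed

section \<open>Lindeberg replacement in total variation\<close>

text \<open>With weight 1 this is the expectation of \<open>h (x + U)\<close>; with weight
  \<open>- R\<close>, for a score \<open>R\<close> of \<open>U\<close>, it is the derivative of that
  expectation in integrated form. One family of estimates serves both.\<close>

definition avg :: "'w measure \<Rightarrow> ('w \<Rightarrow> real) \<Rightarrow> ('w \<Rightarrow> real) \<Rightarrow> (real \<Rightarrow> real) \<Rightarrow> real \<Rightarrow> real" where
  "avg P U W h x = (\<integral>\<omega>. h (x + U \<omega>) * W \<omega> \<partial>P)"

lemma (in prob_space) avg_measurable:
  assumes [measurable]: "U \<in> borel_measurable M" "W \<in> borel_measurable M" "h \<in> borel_measurable borel"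
  shows "avg M U W h \<in> borel_measurable borel"
  unfolding avg_def[abs_def] by measurable

lemma (in prob_space) avg_integrable:
  fixes U W :: "'a \<Rightarrow> real" and h :: "real \<Rightarrow> real"
  assumes [measurable]: "U \<in> borel_measurable M" "h \<in> borel_measurable borel"
    and W: "integrable M W" and h: "\<And>z. \<bar>h z\<bar> \<le> b"
  shows "integrable M (\<lambda>\<omega>. h (x + U \<omega>) * W \<omega>)"
proof (rule Bochner_Integration.integrable_bound[OF integrable_mult_right[OF W, of b]])
  have [measurable]: "W \<in> borel_measurable M" using W by auto
  have "0 \<le> b" using h[of 0] by linarith
  then show "AE \<omega> in M. norm (h (x + U \<omega>) * W \<omega>) \<le> norm (b * W \<omega>)"
    using h by (auto simp: abs_mult intro!: mult_right_mono)
  show "(\<lambda>\<omega>. h (x + U \<omega>) * W \<omega>) \<in> borel_measurable M" by measurable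
qed

lemma (in prob_space) avg_diff_bound:
  assumes U: "U \<in> borel_measurable M" and W: "integrable M W" and L: "expectation (\<lambda>\<omega>. \<bar>W \<omega>\<bar>) \<le> L"
    and g: "g \<in> borel_measurable borel" "\<And>z. \<bar>g z\<bar> \<le> c" "0 \<le> c"
  shows "\<bar>avg M U W g x\<bar> \<le> c * L"
proof -
  have "\<bar>avg M U W g x\<bar> \<le> expectation (\<lambda>\<omega>. \<bar>g (x + U \<omega>) * W \<omega>\<bar>)" unfolding avg_def by (rule integral_abs_bound)
  also have "\<dots> \<le> expectation (\<lambda>\<omega>. c * \<bar>W \<omega>\<bar>)"
    by (rule integral_mono[OF integrable_abs[OF avg_integrable[OF U g(1) W g(2)]] integrable_mult_right[OF integrable_abs[OF W]]])
      (use g in \<open>auto simp: abs_mult intro!: mult_right_mono\<close>)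
  also have "\<dots> \<le> c * L" using L g(3) by (simp add: mult_left_mono)
  finally show ?thesis .
qed

text \<open>The case \<open>d = 0\<close> yields Lipschitz estimates, the case
  \<open>d = \<delta>\<close> first-order Taylor remainders.\<close>

lemma (in prob_space) avg_shift_diff:
  assumes U: "U \<in> borel_measurable M" and W: "integrable M W"
    and h: "h \<in> borel_measurable borel" "\<And>z. \<bar>h z\<bar> \<le> b" and h1: "h1 \<in> borel_measurable borel" "\<And>z. \<bar>h1 z\<bar> \<le> b1"
  shows "avg M U W h (x + \<delta>) - avg M U W h x - d * avg M U W h1 x
    = avg M U W (\<lambda>z. h (z + \<delta>) - h z - d * h1 z) x"
proof -
  note i = avg_integrable[OF U h(1) W h(2)] avg_integrable[OF U h1(1) W h1(2)]
  have "avg M U W (\<lambda>z. h (z + \<delta>) - h z - d * h1 z) x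
      = expectation (\<lambda>\<omega>. h ((x + \<delta>) + U \<omega>) * W \<omega> - h (x + U \<omega>) * W \<omega> - d * (h1 (x + U \<omega>) * W \<omega>))"
    unfolding avg_def by (intro Bochner_Integration.integral_cong) (auto simp: algebra_simps)
  also have "\<dots> = avg M U W h (x + \<delta>) - avg M U W h x - d * avg M U W h1 x"
    unfolding avg_def using i by simp
  finally show ?thesis by simp
qed

lemma (in prob_space) avg_lipschitz:
  assumes U: "U \<in> borel_measurable M" and W: "integrable M W" and L: "expectation (\<lambda>\<omega>. \<bar>W \<omega>\<bar>) \<le> L"
    and h[measurable]: "h \<in> borel_measurable borel" and b: "\<And>z. \<bar>h z\<bar> \<le> b"
    and l: "\<And>z \<delta>. \<bar>h (z + \<delta>) - h z\<bar> \<le> l * \<bar>\<delta>\<bar>" "0 \<le> l"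
  shows "\<bar>avg M U W h (x + \<delta>) - avg M U W h x\<bar> \<le> l * L * \<bar>\<delta>\<bar>"
proof -
  have "\<bar>avg M U W (\<lambda>z. h (z + \<delta>) - h z - 0 * h z) x\<bar> \<le> (l * \<bar>\<delta>\<bar>) * L"
    by (rule avg_diff_bound[OF U W L]) (use l in auto)
  then show ?thesis
    using avg_shift_diff[OF U W h b h b, of x \<delta> 0] by (simp add: algebra_simps)
qed

lemma (in prob_space) avg_quadratic:
  assumes U: "U \<in> borel_measurable M" and W: "integrable M W" and L: "expectation (\<lambda>\<omega>. \<bar>W \<omega>\<bar>) \<le> L"
    and h[measurable]: "h \<in> borel_measurable borel" and b: "\<And>z. \<bar>h z\<bar> \<le> b"
    and h1[measurable]: "h1 \<in> borel_measurable borel" and b1: "\<And>z. \<bar>h1 z\<bar> \<le> b1"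
    and q: "\<And>z \<delta>. \<bar>h (z + \<delta>) - h z - \<delta> * h1 z\<bar> \<le> K * \<delta>\<^sup>2" "0 \<le> K"
  shows "\<bar>avg M U W h (x + \<delta>) - avg M U W h x - \<delta> * avg M U W h1 x\<bar> \<le> K * L * \<delta>\<^sup>2"
proof -
  have "\<bar>avg M U W (\<lambda>z. h (z + \<delta>) - h z - \<delta> * h1 z) x\<bar> \<le> (K * \<delta>\<^sup>2) * L"
    by (rule avg_diff_bound[OF U W L]) (use q in auto)
  then show ?thesis
    using avg_shift_diff[OF U W h b h1 b1, of x \<delta> \<delta>] by (simp add: algebra_simps)
qed

lemma set_integral_const_bound:
  fixes \<phi> :: "real \<Rightarrow> real"
  assumes [measurable]: "\<phi> \<in> borel_measurable borel" and b: "\<And>s. x \<le> s \<Longrightarrow> s \<le> y \<Longrightarrow> \<bar>\<phi> s\<bar> \<le> c" and "x \<le> y" "0 \<le> c"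
  shows "set_integrable lborel {x..y} \<phi>" "\<bar>\<integral>s\<in>{x..y}. \<phi> s \<partial>lborel\<bar> \<le> c * (y - x)"
proof -
  show i: "set_integrable lborel {x..y} \<phi>" unfolding set_integrable_def
    by (rule integrableI_bounded_set_indicator[of _ _ _ c]) (use b in \<open>auto simp: emeasure_lborel_Icc_eq\<close>)
  have "\<bar>\<integral>s\<in>{x..y}. \<phi> s \<partial>lborel\<bar> \<le> (\<integral>s. \<bar>indicator {x..y} s *\<^sub>R \<phi> s\<bar> \<partial>lborel)"
    unfolding set_lebesgue_integral_def by (rule integral_abs_bound)
  also have "\<dots> \<le> (\<integral>s. indicator {x..y} s * c \<partial>lborel)"
  proof (rule integral_mono)
    show "integrable lborel (\<lambda>s. \<bar>indicator {x..y} s *\<^sub>R \<phi> s\<bar>)" using i unfolding set_integrable_def by (rule integrable_abs)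
    show "integrable lborel (\<lambda>s. indicator {x..y} s * c)"
      by (intro integrable_mult_left integrable_real_indicator) (auto simp: emeasure_lborel_Icc_eq)
    show "\<bar>indicator {x..y} s *\<^sub>R \<phi> s\<bar> \<le> indicator {x..y} s * c" for s using b[of s] by (auto simp: indicator_def)
  qed
  also have "\<dots> = c * (y - x)" using assms by simp
  finally show "\<bar>\<integral>s\<in>{x..y}. \<phi> s \<partial>lborel\<bar> \<le> c * (y - x)" .
qed

context
  fixes P :: "'w measure" and U R :: "'w \<Rightarrow> real" and L :: real and h :: "real \<Rightarrow> real" and b :: real
  assumes sc: "has_score P U R" and L: "(\<integral>\<omega>. \<bar>R \<omega>\<bar> \<partial>P) \<le> L"
    and hm[measurable]: "h \<in> borel_measurable borel" and hb: "\<And>z. \<bar>h z\<bar> \<le> b"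
begin

interpretation prob_space P by (rule has_scoreD(1)[OF sc])

lemma score_avg_meas: "avg P U (\<lambda>\<omega>. - R \<omega>) h \<in> borel_measurable borel"
  using has_scoreD(2,3)[OF sc] by (intro avg_measurable) auto

lemma score_avg_bound: "\<bar>avg P U (\<lambda>\<omega>. - R \<omega>) h x\<bar> \<le> b * L"
proof -
  have "0 \<le> b" using hb[of 0] by linarith
  then show ?thesis using has_scoreD(2,3)[OF sc] L hb by (intro avg_diff_bound) auto
qed

lemma score_FTC:
  assumes "x \<le> y"
  shows "avg P U (\<lambda>_. 1) h y - avg P U (\<lambda>_. 1) h x = (\<integral>s\<in>{x..y}. avg P U (\<lambda>\<omega>. - R \<omega>) h s \<partial>lborel)"
proof -
  have "bounded (range h)" unfolding bounded_iff using hb by (auto simp: intro!: exI[of _ b])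
  from has_scoreD(4)[OF sc hm this assms] show ?thesis
    unfolding avg_def set_lebesgue_integral_def by simp
qed

text \<open>A bound on \<open>h\<close> alone makes its average Lipschitz: the derivative is the
  average with weight \<open>- R\<close>, at most \<open>b * L\<close>.\<close>

lemma score_lipschitz: "\<bar>avg P U (\<lambda>_. 1) h (x + \<delta>) - avg P U (\<lambda>_. 1) h x\<bar> \<le> b * L * \<bar>\<delta>\<bar>"
proof -
  have "0 \<le> L" using L by (meson Bochner_Integration.integral_nonneg abs_ge_zero order_trans)
  then have bL: "0 \<le> b * L" using hb[of 0] by (intro mult_nonneg_nonneg) linarith+
  have *: "\<bar>avg P U (\<lambda>_. 1) h v - avg P U (\<lambda>_. 1) h u\<bar> \<le> b * L * (v - u)" if "u \<le> v" for u v
    unfolding score_FTC[OF that] by (rule set_integral_const_bound(2)[OF score_avg_meas _ that bL]) (rule score_avg_bound)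
  show ?thesis using *[of x "x + \<delta>"] *[of "x + \<delta>" x] by (cases "0 \<le> \<delta>") (auto simp: abs_minus_commute)
qed

text \<open>If \<open>h\<close> is already Lipschitz, the derivative of its average is Lipschitz
  with constant \<open>l * L\<close>, because the weight acts on differences of \<open>h\<close>.
  Integrating the derivative along the step gives the quadratic remainder.\<close>

lemma score_quadratic:
  assumes l: "\<And>z \<delta>. \<bar>h (z + \<delta>) - h z\<bar> \<le> l * \<bar>\<delta>\<bar>" "0 \<le> l"
  shows "\<bar>avg P U (\<lambda>_. 1) h (x + \<delta>) - avg P U (\<lambda>_. 1) h x - \<delta> * avg P U (\<lambda>\<omega>. - R \<omega>) h x\<bar> \<le> l * L * \<delta>\<^sup>2"
proof -
  let ?g = "avg P U (\<lambda>\<omega>. - R \<omega>) h"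
  have L0: "0 \<le> L" using L by (meson Bochner_Integration.integral_nonneg abs_ge_zero order_trans)
  have lip: "\<bar>?g (z + \<delta>) - ?g z\<bar> \<le> l * L * \<bar>\<delta>\<bar>" for z \<delta>
    using has_scoreD(2,3)[OF sc] L hb l by (intro avg_lipschitz) auto
  note gm[measurable] = score_avg_meas
  have *: "\<bar>avg P U (\<lambda>_. 1) h v - avg P U (\<lambda>_. 1) h u - (v - u) * ?g x\<bar> \<le> l * L * (v - u) * (v - u)"
    if uv: "u \<le> v" "x = u \<or> x = v" for u v
  proof -
    have c: "0 \<le> l * L * (v - u)" using l L0 uv by auto
    have b: "\<bar>?g s - ?g x\<bar> \<le> l * L * (v - u)" if "u \<le> s" "s \<le> v" for s
    proof -
      have "\<bar>?g s - ?g x\<bar> \<le> l * L * \<bar>s - x\<bar>" using lip[of x "s - x"] by simp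
      also have "\<dots> \<le> l * L * (v - u)" using uv that l L0 by (intro mult_left_mono) auto
      finally show ?thesis .
    qed
    have si: "set_integrable lborel {u..v} ?g"
    proof (rule set_integral_const_bound(1)[OF gm _ uv(1)])
      show "\<bar>?g s\<bar> \<le> b * L" for s by (rule score_avg_bound)
      show "0 \<le> b * L" using score_avg_bound[of 0] by linarith
    qed
    have ci: "set_integrable lborel {u..v} (\<lambda>_. ?g x)"
      by (rule set_integral_const_bound(1)[OF _ _ uv(1), of _ "\<bar>?g x\<bar>"]) auto
    have "(\<integral>s\<in>{u..v}. ?g s - ?g x \<partial>lborel) = (avg P U (\<lambda>_. 1) h v - avg P U (\<lambda>_. 1) h u) - (v - u) * ?g x"
      using set_integral_diff(2)[OF si ci] score_FTC[OF uv(1)] uv(1) by (simp add: set_integral_const)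
    moreover have "\<bar>\<integral>s\<in>{u..v}. ?g s - ?g x \<partial>lborel\<bar> \<le> l * L * (v - u) * (v - u)"
      by (rule set_integral_const_bound(2)[OF _ _ uv(1) c]) (use b in auto)
    ultimately show ?thesis by simp
  qed
  show ?thesis
  proof (cases "0 \<le> \<delta>")
    case True then show ?thesis using *[of x "x + \<delta>"] by (simp add: power2_eq_square mult.assoc)
  next
    case False
    then have "\<bar>avg P U (\<lambda>_. 1) h x - avg P U (\<lambda>_. 1) h (x + \<delta>) - (- \<delta>) * ?g x\<bar> \<le> l * L * (- \<delta>) * (- \<delta>)"
      using *[of "x + \<delta>" x] by simp
    also have "l * L * (- \<delta>) * (- \<delta>) = l * L * \<delta>\<^sup>2" by (simp add: power2_eq_square)
    finally show ?thesis by (simp add: abs_minus_commute algebra_simps)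
  qed
qed

end

text \<open>The remainder \<open>G\<close> of \<open>H\<close> has as derivative the first-order
  remainder of \<open>H1\<close>, at most \<open>K * \<delta>\<^sup>2\<close> on the whole step; the
  mean value inequality supplies the last factor. The quadratic estimate for \<open>H\<close>
  identifies \<open>H1\<close> as its derivative, and no third derivative is ever formed.\<close>

lemma third_order_taylor:
  fixes H H1 :: "real \<Rightarrow> real"
  assumes q1: "\<And>\<delta>. \<bar>H1 (x + \<delta>) - H1 x - \<delta> * D\<bar> \<le> K * \<delta>\<^sup>2" and K: "0 \<le> K"
    and q0: "\<And>z \<delta>. \<bar>H (z + \<delta>) - H z - \<delta> * H1 z\<bar> \<le> K' * \<delta>\<^sup>2"
  shows "\<bar>H (x + \<delta>) - H x - \<delta> * H1 x - \<delta>\<^sup>2 / 2 * D\<bar> \<le> K * \<bar>\<delta>\<bar> ^ 3"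
proof -
  have der: "(H has_real_derivative H1 z) (at z)" for z
    unfolding DERIV_def
  proof (rule Lim_null[THEN iffD2], rule Lim_null_comparison)
    show "\<forall>\<^sub>F h in at 0. norm ((H (z + h) - H z) / h - H1 z) \<le> K' * \<bar>h\<bar>"
      unfolding eventually_at
    proof (intro exI[of _ 1] conjI ballI impI)
      fix h :: real assume h: "h \<noteq> 0 \<and> dist h 0 < 1"
      have "(H (z + h) - H z) / h - H1 z = (H (z + h) - H z - h * H1 z) / h" using h by (simp add: field_simps)
      then have "\<bar>(H (z + h) - H z) / h - H1 z\<bar> \<le> K' * h\<^sup>2 / \<bar>h\<bar>"
        using q0[of z h] h by (simp add: abs_divide divide_right_mono)
      also have "K' * h\<^sup>2 / \<bar>h\<bar> = K' * \<bar>h\<bar>" using h by (simp add: power2_eq_square abs_mult[symmetric] field_simps)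
      finally show "norm ((H (z + h) - H z) / h - H1 z) \<le> K' * \<bar>h\<bar>" by simp
    qed simp
    show "((\<lambda>h. K' * \<bar>h\<bar>) \<longlongrightarrow> 0) (at 0)" by (auto intro!: tendsto_eq_intros)
  qed
  define G where "G s = H (x + s) - s * H1 x - s\<^sup>2 / 2 * D" for s
  have dG: "(G has_real_derivative (H1 (x + s) - H1 x - s * D)) (at s)" for s
  proof -
    have "((\<lambda>s. H (x + s)) has_real_derivative H1 (x + s)) (at s)"
      using DERIV_shift[of H "H1 (x + s)" s x] der by (simp add: add.commute)
    then show ?thesis unfolding G_def by (auto intro!: derivative_eq_intros)
  qed
  have "norm (G \<delta> - G 0) \<le> (K * \<delta>\<^sup>2) * norm (\<delta> - 0)"
  proof (rule field_differentiable_bound[of "{-\<bar>\<delta>\<bar>..\<bar>\<delta>\<bar>}" G "\<lambda>s. H1 (x + s) - H1 x - s * D"])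
    fix s assume s: "s \<in> {-\<bar>\<delta>\<bar>..\<bar>\<delta>\<bar>}"
    then have "s\<^sup>2 \<le> \<delta>\<^sup>2" by (auto simp: abs_le_square_iff[symmetric])
    then have "K * s\<^sup>2 \<le> K * \<delta>\<^sup>2" using K by (rule mult_left_mono)
    then show "norm (H1 (x + s) - H1 x - s * D) \<le> K * \<delta>\<^sup>2" using q1[of s] by simp
    show "(G has_field_derivative H1 (x + s) - H1 x - s * D) (at s within {-\<bar>\<delta>\<bar>..\<bar>\<delta>\<bar>})"
      using dG by (rule has_field_derivative_at_within)
  qed auto
  then show ?thesis unfolding G_def
    by (simp add: power2_eq_square power3_eq_cube abs_mult_self_eq mult.assoc[symmetric])
qed

text \<open>Each average gains one order and contributes one factor: over \<open>C\<close> a bounded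
  function becomes Lipschitz, over \<open>B\<close> it acquires a derivative with quadratic
  remainder, over \<open>A\<close> a further derivative.\<close>

lemma third_order_expansion:
  assumes A: "has_score PA UA RA" and LA: "(\<integral>\<omega>. \<bar>RA \<omega>\<bar> \<partial>PA) \<le> LA"
    and B: "has_score PB UB RB" and LB: "(\<integral>\<omega>. \<bar>RB \<omega>\<bar> \<partial>PB) \<le> LB"
    and C: "has_score PC UC RC" and LC: "(\<integral>\<omega>. \<bar>RC \<omega>\<bar> \<partial>PC) \<le> LC"
    and k[measurable]: "k \<in> borel_measurable borel" and kb: "\<And>z. \<bar>k z\<bar> \<le> 1"
  shows "\<exists>H1 H2. \<forall>\<delta>. \<bar>avg PA UA (\<lambda>_. 1) (avg PB UB (\<lambda>_. 1) (avg PC UC (\<lambda>_. 1) k)) (x + \<delta>)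
     - avg PA UA (\<lambda>_. 1) (avg PB UB (\<lambda>_. 1) (avg PC UC (\<lambda>_. 1) k)) x - \<delta> * H1 - \<delta>\<^sup>2 / 2 * H2\<bar> \<le> LA * LB * LC * \<bar>\<delta>\<bar> ^ 3"
proof -
  interpret A: prob_space PA by (rule has_scoreD(1)[OF A])
  interpret B: prob_space PB by (rule has_scoreD(1)[OF B])
  interpret C: prob_space PC by (rule has_scoreD(1)[OF C])
  note UA = has_scoreD(2)[OF A] and UB = has_scoreD(2)[OF B] and UC = has_scoreD(2)[OF C]
  note RA = has_scoreD(3)[OF A] and RB = has_scoreD(3)[OF B]
  have L0: "0 \<le> LA" "0 \<le> LB" "0 \<le> LC"
    using LA LB LC by (meson Bochner_Integration.integral_nonneg abs_ge_zero order_trans)+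
  define kC where "kC = avg PC UC (\<lambda>_. 1) k"
  have kCm[measurable]: "kC \<in> borel_measurable borel" unfolding kC_def by (rule C.avg_measurable[OF UC]) auto
  have kCb: "\<bar>kC z\<bar> \<le> 1" for z
    unfolding kC_def using C.avg_diff_bound[OF UC, of "\<lambda>_. 1" 1 k 1 z] kb by (simp add: C.prob_space)
  have kCl: "\<bar>kC (z + \<delta>) - kC z\<bar> \<le> LC * \<bar>\<delta>\<bar>" for z \<delta>
    unfolding kC_def using score_lipschitz[OF C LC k kb] by simp
  define kB where "kB = avg PB UB (\<lambda>_. 1) kC"
  define kB1 where "kB1 = avg PB UB (\<lambda>\<omega>. - RB \<omega>) kC"
  have kBm[measurable]: "kB \<in> borel_measurable borel" unfolding kB_def by (rule B.avg_measurable[OF UB]) auto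
  have kBb: "\<bar>kB z\<bar> \<le> 1" for z
    unfolding kB_def using B.avg_diff_bound[OF UB, of "\<lambda>_. 1" 1 kC 1 z] kCb by (simp add: B.prob_space)
  have kB1m[measurable]: "kB1 \<in> borel_measurable borel" unfolding kB1_def by (rule score_avg_meas[OF B LB kCm kCb])
  have kB1b: "\<bar>kB1 z\<bar> \<le> LB" for z unfolding kB1_def using score_avg_bound[OF B LB kCm kCb] by simp
  have kBl: "\<bar>kB (z + \<delta>) - kB z\<bar> \<le> LB * \<bar>\<delta>\<bar>" for z \<delta>
    unfolding kB_def using score_lipschitz[OF B LB kCm kCb] by simp
  have kBq: "\<bar>kB (z + \<delta>) - kB z - \<delta> * kB1 z\<bar> \<le> LC * LB * \<delta>\<^sup>2" for z \<delta>
    unfolding kB_def kB1_def by (rule score_quadratic[OF B LB kCm kCb kCl L0(3)])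
  define H where "H = avg PA UA (\<lambda>_. 1) kB"
  define H1 where "H1 = avg PA UA (\<lambda>\<omega>. - RA \<omega>) kB"
  define H2 where "H2 = avg PA UA (\<lambda>\<omega>. - RA \<omega>) kB1"
  have q0: "\<bar>H (z + \<delta>) - H z - \<delta> * H1 z\<bar> \<le> LB * LA * \<delta>\<^sup>2" for z \<delta>
    unfolding H_def H1_def by (rule score_quadratic[OF A LA kBm kBb kBl L0(2)])
  \<comment> \<open>\<open>H1\<close> is an average of \<open>kB\<close> with a fixed weight, so it
    inherits the quadratic expansion of \<open>kB\<close>, multiplied by the norm \<open>LA\<close>
    of the weight.\<close>
  have q1: "\<bar>H1 (x + \<delta>) - H1 x - \<delta> * H2 x\<bar> \<le> (LC * LB) * LA * \<delta>\<^sup>2" for \<delta>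
    unfolding H1_def H2_def
    by (rule A.avg_quadratic[OF UA _ _ kBm kBb kB1m kB1b kBq]) (use RA LA L0 in auto)
  have "\<bar>H (x + \<delta>) - H x - \<delta> * H1 x - \<delta>\<^sup>2 / 2 * H2 x\<bar> \<le> LA * LB * LC * \<bar>\<delta>\<bar> ^ 3" for \<delta>
    using third_order_taylor[of H1 x "H2 x" "LC * LB * LA" H "LB * LA" \<delta>] q1 q0 L0 by (simp add: mult_ac)
  then show ?thesis unfolding H_def kB_def kC_def by blast
qed

section \<open>Averaging over blocks of independent summands\<close>

text \<open>The score is hidden behind an existential, so original and Gaussian factors can be mixed
  in one product under a common bound.\<close>

definition scored_law :: "real measure \<Rightarrow> real \<Rightarrow> bool" where
  "scored_law \<kappa> J \<longleftrightarrow> sets \<kappa> = sets borel \<and>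
     (\<exists>r. has_score \<kappa> (\<lambda>x. x) r \<and> integrable \<kappa> (\<lambda>x. (r x)\<^sup>2) \<and> (\<integral>x. (r x)\<^sup>2 \<partial>\<kappa>) \<le> J)"

lemma scored_lawD: "scored_law \<kappa> J \<Longrightarrow> prob_space \<kappa>" "scored_law \<kappa> J \<Longrightarrow> sets \<kappa> = sets borel"
  unfolding scored_law_def using has_scoreD(1) by blast+

definition sum_avg :: "('i \<Rightarrow> real measure) \<Rightarrow> 'i set \<Rightarrow> (real \<Rightarrow> real) \<Rightarrow> real \<Rightarrow> real" where
  "sum_avg \<kappa> I h = avg (Pi\<^sub>M I \<kappa>) (\<lambda>x. \<Sum>j\<in>I. x j) (\<lambda>_. 1) h"

lemma sum_avg_cong: "(\<And>i. i \<in> I \<Longrightarrow> \<kappa> i = \<kappa>' i) \<Longrightarrow> sum_avg \<kappa> I = sum_avg \<kappa>' I"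
  unfolding sum_avg_def[abs_def] using PiM_cong[OF refl, of I \<kappa> \<kappa>'] by simp

locale real_laws = product_sigma_finite \<kappa> for \<kappa> :: "nat \<Rightarrow> real measure" +
  assumes pr: "prob_space (\<kappa> j)" and st: "sets (\<kappa> j) = sets borel"
begin

lemma measurable_coord_sum:
  assumes "K \<subseteq> L" shows "(\<lambda>x. \<Sum>j\<in>K. x j) \<in> borel_measurable (Pi\<^sub>M L \<kappa>)"
proof (rule borel_measurable_sum)
  fix j assume "j \<in> K"
  then have "(\<lambda>x. x j) \<in> measurable (Pi\<^sub>M L \<kappa>) (\<kappa> j)" using assms by (intro measurable_component_singleton) auto
  then show "(\<lambda>x. x j) \<in> borel_measurable (Pi\<^sub>M L \<kappa>)" using st[of j] by (auto cong: measurable_cong_sets)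
qed

lemma sum_avg_measurable:
  assumes "h \<in> borel_measurable borel" shows "sum_avg \<kappa> I h \<in> borel_measurable borel"
proof -
  interpret prob_space "Pi\<^sub>M I \<kappa>" by (rule prob_space_PiM) (rule pr)
  show ?thesis unfolding sum_avg_def using assms measurable_coord_sum[of I I] by (intro avg_measurable) auto
qed

lemma sum_avg_bounded:
  assumes "h \<in> borel_measurable borel" "\<And>z. \<bar>h z\<bar> \<le> 1" shows "\<bar>sum_avg \<kappa> I h x\<bar> \<le> 1"
proof -
  interpret prob_space "Pi\<^sub>M I \<kappa>" by (rule prob_space_PiM) (rule pr)
  show ?thesis unfolding sum_avg_def
    using avg_diff_bound[of "\<lambda>x. \<Sum>j\<in>I. x j" "\<lambda>_. 1" 1 h 1 x] assms measurable_coord_sum[of I I] by (simp add: prob_space)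
qed

text \<open>By Fubini, adding independent partial sums amounts to composing the averaging operators,
  so blocks can be averaged one after the other.\<close>

lemma sum_avg_union:
  assumes KL: "K \<inter> L = {}" "finite K" "finite L" and h[measurable]: "h \<in> borel_measurable borel" and hb: "\<And>z. \<bar>h z\<bar> \<le> 1"
  shows "sum_avg \<kappa> (K \<union> L) h = sum_avg \<kappa> K (sum_avg \<kappa> L h)"
proof
  fix s
  interpret KL: prob_space "Pi\<^sub>M (K \<union> L) \<kappa>" by (rule prob_space_PiM) (rule pr)
  have [measurable]: "(\<lambda>x. \<Sum>j\<in>K \<union> L. x j) \<in> borel_measurable (Pi\<^sub>M (K \<union> L) \<kappa>)" by (rule measurable_coord_sum) simp
  have "integrable (Pi\<^sub>M (K \<union> L) \<kappa>) (\<lambda>x. h (s + (\<Sum>j\<in>K \<union> L. x j)))"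
    by (rule KL.integrable_const_bound[of _ 1]) (use hb in auto)
  then have "(\<integral>x. h (s + (\<Sum>j\<in>K \<union> L. x j)) \<partial>Pi\<^sub>M (K \<union> L) \<kappa>)
     = (\<integral>x. (\<integral>y. h (s + (\<Sum>j\<in>K \<union> L. merge K L (x, y) j)) \<partial>Pi\<^sub>M L \<kappa>) \<partial>Pi\<^sub>M K \<kappa>)"
    by (rule product_integral_fold[OF KL])
  moreover have "(\<Sum>j\<in>K \<union> L. merge K L (x, y) j) = (\<Sum>j\<in>K. x j) + (\<Sum>j\<in>L. y j)" for x y :: "nat \<Rightarrow> real"
  proof -
    have "(\<Sum>j\<in>K \<union> L. merge K L (x, y) j) = (\<Sum>j\<in>K. merge K L (x, y) j) + (\<Sum>j\<in>L. merge K L (x, y) j)"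
      using KL by (intro sum.union_disjoint) auto
    also have "(\<Sum>j\<in>K. merge K L (x, y) j) = (\<Sum>j\<in>K. x j)" by (intro sum.cong) (auto simp: merge_def)
    also have "(\<Sum>j\<in>L. merge K L (x, y) j) = (\<Sum>j\<in>L. y j)" using KL(1) by (intro sum.cong) (auto simp: merge_def)
    finally show ?thesis .
  qed
  ultimately show "sum_avg \<kappa> (K \<union> L) h s = sum_avg \<kappa> K (sum_avg \<kappa> L h) s"
    unfolding sum_avg_def avg_def by (simp add: add.assoc)
qed

lemma sum_avg_singleton:
  assumes [measurable]: "h \<in> borel_measurable borel"
  shows "sum_avg \<kappa> {t} h s = (\<integral>x. h (s + x) \<partial>\<kappa> t)"
proof -
  have "(\<lambda>x. h (s + x)) \<in> borel_measurable (\<kappa> t)" using st[of t] by (simp cong: measurable_cong_sets)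
  from product_integral_singleton[OF this] show ?thesis unfolding sum_avg_def avg_def by simp
qed

text \<open>The set \<open>D\<close> takes up every index outside the three blocks. Averaging over
  it comes innermost and preserves measurability and the bound 1, which is all that the expansion
  asks of its test function.\<close>

lemma block_average_expansion:
  assumes D: "finite A" "finite B" "finite C" "finite D" "A \<noteq> {}" "B \<noteq> {}" "C \<noteq> {}"
    "A \<inter> B = {}" "A \<inter> C = {}" "B \<inter> C = {}" "(A \<union> B \<union> C) \<inter> D = {}"
    and nice: "\<And>j. j \<in> A \<union> B \<union> C \<Longrightarrow> scored_law (\<kappa> j) (J j)"
    and L: "sqrt (\<Sum>j\<in>A. J j) / real (card A) \<le> L" "sqrt (\<Sum>j\<in>B. J j) / real (card B) \<le> L" "sqrt (\<Sum>j\<in>C. J j) / real (card C) \<le> L"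
    and h[measurable]: "h \<in> borel_measurable borel" and hb: "\<And>z. \<bar>h z\<bar> \<le> 1"
  shows "\<exists>H1 H2. \<forall>\<delta>. \<bar>sum_avg \<kappa> (A \<union> B \<union> C \<union> D) h (x + \<delta>) - sum_avg \<kappa> (A \<union> B \<union> C \<union> D) h x - \<delta> * H1 - \<delta>\<^sup>2 / 2 * H2\<bar>
     \<le> L ^ 3 * \<bar>\<delta>\<bar> ^ 3"
proof -
  have "\<forall>j\<in>A \<union> B \<union> C. \<exists>r. has_score (\<kappa> j) (\<lambda>x. x) r \<and> integrable (\<kappa> j) (\<lambda>x. (r x)\<^sup>2) \<and> (\<integral>x. (r x)\<^sup>2 \<partial>\<kappa> j) \<le> J j"
    using nice unfolding scored_law_def by blast
  then obtain r where r: "\<forall>j\<in>A \<union> B \<union> C. has_score (\<kappa> j) (\<lambda>x. x) (r j) \<and> integrable (\<kappa> j) (\<lambda>x. (r j x)\<^sup>2) \<and> (\<integral>x. (r j x)\<^sup>2 \<partial>\<kappa> j) \<le> J j"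
    by (rule bchoice[THEN exE])
  have block: "\<exists>R. has_score (Pi\<^sub>M E \<kappa>) (\<lambda>x. \<Sum>j\<in>E. x j) R \<and> (\<integral>x. \<bar>R x\<bar> \<partial>Pi\<^sub>M E \<kappa>) \<le> L"
    if E: "finite E" "E \<noteq> {}" "E \<subseteq> A \<union> B \<union> C" "sqrt (\<Sum>j\<in>E. J j) / real (card E) \<le> L" for E
  proof -
    obtain R where "has_score (Pi\<^sub>M E \<kappa>) (\<lambda>x. \<Sum>j\<in>E. x j) R"
      "(\<integral>x. \<bar>R x\<bar> \<partial>Pi\<^sub>M E \<kappa>) \<le> sqrt (\<Sum>j\<in>E. J j) / real (card E)"
    proof (rule block_score[OF E(1,2)])
      show "sets (\<kappa> j) = sets borel" for j by (rule st)
      show "has_score (\<kappa> j) (\<lambda>x. x) (r j)" if "j \<in> E" for j using r E(3) that by blast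
      show "integrable (\<kappa> j) (\<lambda>x. (r j x)\<^sup>2)" if "j \<in> E" for j using r E(3) that by blast
      show "(\<integral>x. (r j x)\<^sup>2 \<partial>\<kappa> j) \<le> J j" if "j \<in> E" for j using r E(3) that by blast
    qed (rule that)
    then show ?thesis using E(4) by (intro exI[of _ R]) auto
  qed
  obtain RA where RA: "has_score (Pi\<^sub>M A \<kappa>) (\<lambda>x. \<Sum>j\<in>A. x j) RA" "(\<integral>x. \<bar>RA x\<bar> \<partial>Pi\<^sub>M A \<kappa>) \<le> L"
    using block[of A] D L by blast
  obtain RB where RB: "has_score (Pi\<^sub>M B \<kappa>) (\<lambda>x. \<Sum>j\<in>B. x j) RB" "(\<integral>x. \<bar>RB x\<bar> \<partial>Pi\<^sub>M B \<kappa>) \<le> L"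
    using block[of B] D L by blast
  obtain RC where RC: "has_score (Pi\<^sub>M C \<kappa>) (\<lambda>x. \<Sum>j\<in>C. x j) RC" "(\<integral>x. \<bar>RC x\<bar> \<partial>Pi\<^sub>M C \<kappa>) \<le> L"
    using block[of C] D L by blast
  have m: "sum_avg \<kappa> E g \<in> borel_measurable borel" "\<And>z. \<bar>sum_avg \<kappa> E g z\<bar> \<le> 1"
    if "g \<in> borel_measurable borel" "\<And>z. \<bar>g z\<bar> \<le> 1" for E g
    using sum_avg_measurable[OF that(1)] sum_avg_bounded[OF that] by auto
  note kD = m[OF h hb, of D]
  note kC = m[OF kD, of C]
  have "sum_avg \<kappa> (A \<union> B \<union> C \<union> D) h = sum_avg \<kappa> (A \<union> B \<union> C) (sum_avg \<kappa> D h)"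
    using D by (intro sum_avg_union h hb) auto
  also have "\<dots> = sum_avg \<kappa> (A \<union> B) (sum_avg \<kappa> C (sum_avg \<kappa> D h))"
    using D by (intro sum_avg_union kD) auto
  also have "\<dots> = sum_avg \<kappa> A (sum_avg \<kappa> B (sum_avg \<kappa> C (sum_avg \<kappa> D h)))"
    using D by (intro sum_avg_union kC) auto
  finally have eq: "sum_avg \<kappa> (A \<union> B \<union> C \<union> D) h = sum_avg \<kappa> A (sum_avg \<kappa> B (sum_avg \<kappa> C (sum_avg \<kappa> D h)))" .
  show ?thesis
    using third_order_expansion[OF RA RB RC kD, of x] unfolding eq unfolding sum_avg_def
    by (simp add: power3_eq_cube mult.assoc)
qed

end

section \<open>Replacing one summand at a time\<close>

lemma power_le_one_plus: "k \<le> m \<Longrightarrow> \<bar>d::real\<bar> ^ k \<le> 1 + \<bar>d\<bar> ^ m"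
proof (cases "\<bar>d\<bar> \<le> 1")
  case True then show ?thesis using power_le_one[of "\<bar>d\<bar>" k] zero_le_power[OF abs_ge_zero, of d m] by linarith
next
  case False assume "k \<le> m"
  then show ?thesis using False power_increasing[of k m "\<bar>d\<bar>"] by linarith
qed

text \<open>Both laws are tested against one expansion about \<open>m\<close>. Its terms up to
  second order have the same integral under both, so only the two cubic remainders survive.\<close>

lemma matched_moments_bound:
  fixes F :: "real \<Rightarrow> real"
  assumes F[measurable]: "F \<in> borel_measurable borel" and Fb: "\<And>z. \<bar>F z\<bar> \<le> 1"
    and ex: "\<And>\<delta>. \<bar>F (m + \<delta>) - F m - \<delta> * a - \<delta>\<^sup>2 / 2 * b\<bar> \<le> K * \<bar>\<delta>\<bar> ^ 3"
    and \<mu>: "prob_space \<mu>" "sets \<mu> = sets borel" "integrable \<mu> (\<lambda>x. \<bar>x - m\<bar> ^ 3)"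
    and \<nu>: "prob_space \<nu>" "sets \<nu> = sets borel" "integrable \<nu> (\<lambda>x. \<bar>x - m\<bar> ^ 3)"
    and eq1: "(\<integral>x. x - m \<partial>\<mu>) = (\<integral>x. x - m \<partial>\<nu>)" and eq2: "(\<integral>x. (x - m)\<^sup>2 \<partial>\<mu>) = (\<integral>x. (x - m)\<^sup>2 \<partial>\<nu>)"
  shows "\<bar>(\<integral>x. F x \<partial>\<mu>) - (\<integral>x. F x \<partial>\<nu>)\<bar> \<le> K * ((\<integral>x. \<bar>x - m\<bar> ^ 3 \<partial>\<mu>) + (\<integral>x. \<bar>x - m\<bar> ^ 3 \<partial>\<nu>))"
proof -
  have one: "\<bar>(\<integral>x. F x \<partial>\<mu>) - F m - (\<integral>x. x - m \<partial>\<mu>) * a - (\<integral>x. (x - m)\<^sup>2 \<partial>\<mu>) / 2 * b\<bar> \<le> K * (\<integral>x. \<bar>x - m\<bar> ^ 3 \<partial>\<mu>)"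
    if \<mu>: "prob_space \<mu>" "sets \<mu> = sets borel" "integrable \<mu> (\<lambda>x. \<bar>x - m\<bar> ^ 3)" for \<mu>
  proof -
    interpret prob_space \<mu> by (rule \<mu>(1))
    have [measurable_cong]: "sets \<mu> = sets borel" by (rule \<mu>(2))
    have i0: "integrable \<mu> (\<lambda>x. 1 + \<bar>x - m\<bar> ^ 3)" using \<mu>(3) by auto
    have i1: "integrable \<mu> (\<lambda>x. x - m)"
      by (rule Bochner_Integration.integrable_bound[OF i0]) (use power_le_one_plus[of 1 3] in auto)
    have i2: "integrable \<mu> (\<lambda>x. (x - m)\<^sup>2)"
      by (rule Bochner_Integration.integrable_bound[OF i0]) (use power_le_one_plus[of 2 3] in auto)
    have iF: "integrable \<mu> F" by (rule integrable_const_bound[of _ 1]) (use Fb in auto)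
    have iR: "integrable \<mu> (\<lambda>x. F x - F m - (x - m) * a - (x - m)\<^sup>2 / 2 * b)"
      using iF i1 i2 by auto
    have eq: "(\<integral>x. F x \<partial>\<mu>) - F m - (\<integral>x. x - m \<partial>\<mu>) * a - (\<integral>x. (x - m)\<^sup>2 \<partial>\<mu>) / 2 * b
        = (\<integral>x. F x - F m - (x - m) * a - (x - m)\<^sup>2 / 2 * b \<partial>\<mu>)"
    proof -
      have "(\<integral>x. F x - F m - (x - m) * a - (x - m)\<^sup>2 / 2 * b \<partial>\<mu>)
         = (\<integral>x. F x - F m - (x - m) * a \<partial>\<mu>) - (\<integral>x. (x - m)\<^sup>2 / 2 * b \<partial>\<mu>)"
        using iF i1 i2 by (intro Bochner_Integration.integral_diff) auto
      also have "(\<integral>x. F x - F m - (x - m) * a \<partial>\<mu>) = (\<integral>x. F x - F m \<partial>\<mu>) - (\<integral>x. (x - m) * a \<partial>\<mu>)"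
        using iF i1 by (intro Bochner_Integration.integral_diff) auto
      also have "(\<integral>x. F x - F m \<partial>\<mu>) = (\<integral>x. F x \<partial>\<mu>) - F m"
        using iF by (simp add: prob_space)
      finally show ?thesis by simp
    qed
    have "\<bar>(\<integral>x. F x - F m - (x - m) * a - (x - m)\<^sup>2 / 2 * b \<partial>\<mu>)\<bar> \<le> (\<integral>x. \<bar>F x - F m - (x - m) * a - (x - m)\<^sup>2 / 2 * b\<bar> \<partial>\<mu>)" by (rule integral_abs_bound)
    also have "\<dots> \<le> (\<integral>x. K * \<bar>x - m\<bar> ^ 3 \<partial>\<mu>)"
    proof (rule integral_mono[OF integrable_abs[OF iR] integrable_mult_right[OF \<mu>(3)]])
      show "\<bar>F x - F m - (x - m) * a - (x - m)\<^sup>2 / 2 * b\<bar> \<le> K * \<bar>x - m\<bar> ^ 3" for x using ex[of "x - m"] by simp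
    qed
    finally show ?thesis unfolding eq by simp
  qed
  show ?thesis using one[OF \<mu>] one[OF \<nu>] eq1 eq2 by (simp add: distrib_left)
qed

text \<open>Four disjoint blocks fit below \<open>n\<close> and \<open>t\<close> lies in at most one
  of them. What remains of the indices goes into \<open>D\<close>.\<close>

lemma three_blocks_avoiding:
  fixes n m t :: nat
  assumes m: "0 < m" "4 * m \<le> n" and t: "t < n"
  obtains A B C D where "finite A" "finite B" "finite C" "finite D" "card A = m" "card B = m" "card C = m"
    "A \<inter> B = {}" "A \<inter> C = {}" "B \<inter> C = {}" "(A \<union> B \<union> C) \<inter> D = {}" "{..<n} - {t} = A \<union> B \<union> C \<union> D"
proof -
  define b where "b k = {k * m..<k * m + m}" for k
  have card: "card (b k) = m" "finite (b k)" for k by (auto simp: b_def)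
  have disj: "b k \<inter> b l = {}" if "k < l" for k l
  proof -
    have "k * m + m \<le> l * m" using mult_le_mono1[of "Suc k" l m] that by simp
    then show ?thesis by (auto simp: b_def)
  qed
  have sub: "b k \<subseteq> {..<n}" if "k < 4" for k
  proof -
    have "Suc k * m \<le> 4 * m" by (rule mult_le_mono1) (use that in simp)
    then have "m + k * m \<le> n" using m(2) unfolding mult_Suc by linarith
    then have "k * m + m \<le> n" by simp
    then show ?thesis by (auto simp: b_def)
  qed
  have "\<exists>k1 k2 k3. k1 < k2 \<and> k2 < k3 \<and> k3 < (4::nat) \<and> t \<notin> b k1 \<and> t \<notin> b k2 \<and> t \<notin> b k3"
  proof (cases "t \<in> b 0 \<or> t \<in> b 1")
    case True
    then have "t \<notin> b 2" "t \<notin> b 3" "t \<notin> b 0 \<or> t \<notin> b 1"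
      using disj[of 0 2] disj[of 0 3] disj[of 1 2] disj[of 1 3] disj[of 0 1] by auto
    show ?thesis
    proof (cases "t \<in> b 0")
      case True then show ?thesis using \<open>t \<notin> b 2\<close> \<open>t \<notin> b 3\<close> \<open>t \<notin> b 0 \<or> t \<notin> b 1\<close>
        by (intro exI[of _ 1] exI[of _ 2] exI[of _ 3]) auto
    next
      case False then show ?thesis using \<open>t \<notin> b 2\<close> \<open>t \<notin> b 3\<close>
        by (intro exI[of _ 0] exI[of _ 2] exI[of _ 3]) auto
    qed
  next
    case False
    have "t \<notin> b 2 \<or> t \<notin> b 3" using disj[of 2 3] by auto
    then show ?thesis
    proof
      assume "t \<notin> b 2" then show ?thesis using False by (intro exI[of _ 0] exI[of _ 1] exI[of _ 2]) auto
    next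
      assume "t \<notin> b 3" then show ?thesis using False by (intro exI[of _ 0] exI[of _ 1] exI[of _ 3]) auto
    qed
  qed
  then obtain k1 k2 k3 where k: "k1 < k2" "k2 < k3" "k3 < 4" "t \<notin> b k1" "t \<notin> b k2" "t \<notin> b k3" by blast
  show ?thesis
  proof (rule that[of "b k1" "b k2" "b k3" "{..<n} - {t} - (b k1 \<union> b k2 \<union> b k3)"])
    show "{..<n} - {t} = b k1 \<union> b k2 \<union> b k3 \<union> ({..<n} - {t} - (b k1 \<union> b k2 \<union> b k3))"
      using sub[of k1] sub[of k2] sub[of k3] k by auto
  qed (use k card disj[of k1 k2] disj[of k1 k3] disj[of k2 k3] in auto)
qed

text \<open>The difference telescopes over products with \<open>t\<close> original and
  \<open>n - t\<close> Gaussian factors. At step \<open>t\<close> the other coordinates are averaged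
  to a function \<open>F\<close> with a third-order expansion. Every mixed product obeys the same
  bounds \<open>J\<close>, so one constant \<open>L\<close> serves for all steps.\<close>

lemma lindeberg_total_variation:
  fixes \<kappa> \<gamma> :: "nat \<Rightarrow> real measure" and J m :: "nat \<Rightarrow> real"
  assumes n: "4 \<le> n" and \<kappa>: "\<And>j. scored_law (\<kappa> j) (J j)" and \<gamma>: "\<And>j. scored_law (\<gamma> j) (J j)"
    and i3: "\<And>j. integrable (\<kappa> j) (\<lambda>x. \<bar>x - m j\<bar> ^ 3)" "\<And>j. integrable (\<gamma> j) (\<lambda>x. \<bar>x - m j\<bar> ^ 3)"
    and eq1: "\<And>j. (\<integral>x. x - m j \<partial>\<kappa> j) = (\<integral>x. x - m j \<partial>\<gamma> j)"
    and eq2: "\<And>j. (\<integral>x. (x - m j)\<^sup>2 \<partial>\<kappa> j) = (\<integral>x. (x - m j)\<^sup>2 \<partial>\<gamma> j)"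
    and J: "\<And>j. 0 \<le> J j"
    and h[measurable]: "h \<in> borel_measurable borel" and hb: "\<And>z. \<bar>h z\<bar> \<le> 1"
  shows "\<bar>(\<integral>x. h (\<Sum>j<n. x j) \<partial>Pi\<^sub>M {..<n} \<kappa>) - (\<integral>x. h (\<Sum>j<n. x j) \<partial>Pi\<^sub>M {..<n} \<gamma>)\<bar>
    \<le> (sqrt (\<Sum>j<n. J j) / real (n div 4)) ^ 3 * (\<Sum>j<n. (\<integral>x. \<bar>x - m j\<bar> ^ 3 \<partial>\<kappa> j) + (\<integral>x. \<bar>x - m j\<bar> ^ 3 \<partial>\<gamma> j))"
proof -
  define q where "q = n div 4"
  have q: "0 < q" "4 * q \<le> n" using n by (auto simp: q_def)
  define L where "L = sqrt (\<Sum>j<n. J j) / real q"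
  \<comment> \<open>The product \<open>\<eta> t\<close> carries original laws at indices below
    \<open>t\<close>. Neighbouring products differ at index \<open>t\<close> only: \<gamma> before
    the replacement, \<kappa> after it.\<close>
  define \<eta> where "\<eta> t j = (if j < t then \<kappa> j else \<gamma> j)" for t j
  have nl: "scored_law (\<eta> t j) (J j)" for t j unfolding \<eta>_def using \<kappa> \<gamma> by auto
  have rl: "real_laws (\<eta> t)" for t
    unfolding real_laws_def real_laws_axioms_def product_sigma_finite_def
    using scored_lawD[OF nl] prob_space_imp_sigma_finite by blast
  define T where "T t = sum_avg (\<eta> t) {..<n} h 0" for t
  have step: "\<bar>T (Suc t) - T t\<bar> \<le> L ^ 3 * ((\<integral>x. \<bar>x - m t\<bar> ^ 3 \<partial>\<kappa> t) + (\<integral>x. \<bar>x - m t\<bar> ^ 3 \<partial>\<gamma> t))" if t: "t < n" for t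
  proof -
    interpret R: real_laws "\<eta> t" by (rule rl)
    interpret R': real_laws "\<eta> (Suc t)" by (rule rl)
    define I where "I = {..<n} - {t}"
    define F where "F = sum_avg (\<eta> t) I h"
    have F': "sum_avg (\<eta> (Suc t)) I h = F"
      unfolding F_def by (rule fun_cong[OF sum_avg_cong]) (auto simp: I_def \<eta>_def)
    have Fm[measurable]: "F \<in> borel_measurable borel" unfolding F_def by (rule R.sum_avg_measurable[OF h])
    have Fb: "\<bar>F z\<bar> \<le> 1" for z unfolding F_def by (rule R.sum_avg_bounded[OF h hb])
    have nI: "{..<n} = {t} \<union> I" using t by (auto simp: I_def)
    have "T t = sum_avg (\<eta> t) {t} F 0"
      unfolding T_def nI F_def by (rule fun_cong[OF R.sum_avg_union[OF _ _ _ h hb]]) (auto simp: I_def)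
    then have T0: "T t = (\<integral>x. F x \<partial>\<gamma> t)" by (simp add: R.sum_avg_singleton \<eta>_def)
    have "T (Suc t) = sum_avg (\<eta> (Suc t)) {t} F 0"
      unfolding T_def nI F'[symmetric] by (rule fun_cong[OF R'.sum_avg_union[OF _ _ _ h hb]]) (auto simp: I_def)
    then have T1: "T (Suc t) = (\<integral>x. F x \<partial>\<kappa> t)" by (simp add: R'.sum_avg_singleton \<eta>_def)
    obtain A B C D where D: "finite A" "finite B" "finite C" "finite D" "card A = q" "card B = q" "card C = q"
      "A \<inter> B = {}" "A \<inter> C = {}" "B \<inter> C = {}" "(A \<union> B \<union> C) \<inter> D = {}" "{..<n} - {t} = A \<union> B \<union> C \<union> D"
      by (rule three_blocks_avoiding[OF q t])
    have ne: "A \<noteq> {}" "B \<noteq> {}" "C \<noteq> {}" using D q by auto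
    \<comment> \<open>The sum over a block is enlarged to all indices, which makes the bound
      independent of the block and of the step.\<close>
    have le: "sqrt (\<Sum>j\<in>E. J j) / real (card E) \<le> L" if "E \<subseteq> {..<n}" "card E = q" for E
      unfolding L_def that(2) using that(1) J q
      by (intro divide_right_mono real_sqrt_le_mono sum_mono2) auto
    have subs: "A \<subseteq> {..<n}" "B \<subseteq> {..<n}" "C \<subseteq> {..<n}" using D(12) by auto
    obtain H1 H2 where H: "\<And>\<delta>. \<bar>F (m t + \<delta>) - F (m t) - \<delta> * H1 - \<delta>\<^sup>2 / 2 * H2\<bar> \<le> L ^ 3 * \<bar>\<delta>\<bar> ^ 3"
      using R.block_average_expansion[OF D(1-4) ne D(8-11) nl le[OF subs(1) D(5)] le[OF subs(2) D(6)] le[OF subs(3) D(7)] h hb, of "m t"]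
      unfolding D(12)[symmetric] I_def[symmetric] F_def[symmetric] by blast
    show ?thesis
      unfolding T0 T1 by (rule matched_moments_bound[OF Fm Fb H scored_lawD(1)[OF \<kappa>] scored_lawD(2)[OF \<kappa>] i3(1) scored_lawD(1)[OF \<gamma>] scored_lawD(2)[OF \<gamma>] i3(2) eq1 eq2])
  qed
  have "T n - T 0 = (\<Sum>t<n. T (Suc t) - T t)" by (rule sum_lessThan_telescope[symmetric])
  then have "\<bar>T n - T 0\<bar> \<le> (\<Sum>t<n. \<bar>T (Suc t) - T t\<bar>)" by simp
  also have "\<dots> \<le> (\<Sum>t<n. L ^ 3 * ((\<integral>x. \<bar>x - m t\<bar> ^ 3 \<partial>\<kappa> t) + (\<integral>x. \<bar>x - m t\<bar> ^ 3 \<partial>\<gamma> t)))"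
    by (rule sum_mono) (use step in auto)
  finally have "\<bar>T n - T 0\<bar> \<le> L ^ 3 * (\<Sum>t<n. (\<integral>x. \<bar>x - m t\<bar> ^ 3 \<partial>\<kappa> t) + (\<integral>x. \<bar>x - m t\<bar> ^ 3 \<partial>\<gamma> t))"
    by (simp add: sum_distrib_left)
  moreover have "T n = (\<integral>x. h (\<Sum>j<n. x j) \<partial>Pi\<^sub>M {..<n} \<kappa>)"
  proof -
    have "T n = sum_avg \<kappa> {..<n} h 0" unfolding T_def
      by (rule fun_cong[OF fun_cong[OF sum_avg_cong]]) (simp add: \<eta>_def)
    then show ?thesis unfolding sum_avg_def avg_def by simp
  qed
  moreover have "T 0 = (\<integral>x. h (\<Sum>j<n. x j) \<partial>Pi\<^sub>M {..<n} \<gamma>)"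
    unfolding T_def \<eta>_def sum_avg_def avg_def by simp
  ultimately show ?thesis unfolding L_def q_def by simp
qed

section \<open>From total variation to divergence\<close>

lemma (in fisher_density) scored_law:
  assumes "J \<le> J'" shows "scored_law (density lborel f) J'"
  unfolding scored_law_def using has_score_law score_second_moment assms
  by (intro conjI exI[of _ score]) (auto simp: law_def)

text \<open>The score is linear with slope \<open>- 1 / \<sigma>\<^sup>2\<close>, so the information
  is the variance divided by \<open>\<sigma> ^ 4\<close>.\<close>

lemma fisher_density_normal:
  assumes \<sigma>: "0 < \<sigma>"
  shows "fisher_density (normal_density \<mu> \<sigma>) (\<lambda>x. - ((x - \<mu>) / \<sigma>\<^sup>2) * normal_density \<mu> \<sigma> x) (1 / \<sigma>\<^sup>2)"
proof -
  let ?f = "normal_density \<mu> \<sigma>" and ?f' = "\<lambda>x. - ((x - \<mu>) / \<sigma>\<^sup>2) * normal_density \<mu> \<sigma> x"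
  have der: "(?f has_real_derivative ?f' x) (at x)" for x
  proof -
    have "((\<lambda>x. - (x - \<mu>)\<^sup>2 / (2 * \<sigma>\<^sup>2)) has_real_derivative - ((x - \<mu>) / \<sigma>\<^sup>2)) (at x)"
      using \<sigma> by (auto intro!: derivative_eq_intros simp: field_simps)
    from DERIV_cmult[OF DERIV_fun_exp[OF this], of "1 / sqrt (2 * pi * \<sigma>\<^sup>2)"]
    show ?thesis unfolding normal_density_def by (simp add: mult_ac)
  qed
  have cont: "continuous_on A ?f'" for A
    unfolding normal_density_def using \<sigma> by (auto intro!: continuous_intros)
  have isC: "isCont ?f' x" for x using cont[of UNIV] by (simp add: continuous_on_eq_continuous_at)
  show ?thesis
  proof
    show "(\<integral>\<^sup>+x. ennreal (?f x) \<partial>lborel) = 1"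
      using nn_integral_eq_integral[OF integrable_normal_density[OF \<sigma>, of \<mu>]] \<sigma> by simp
    show "set_integrable lborel {x..y} ?f'" for x y by (rule borel_integrable_atLeastAtMost'[OF cont])
    show "?f y - ?f x = (\<integral>z\<in>{x..y}. ?f' z \<partial>lborel)" if "x \<le> y" for x y
      using integral_FTC_Icc_real[OF that der isC] unfolding set_lebesgue_integral_def by (simp add: mult.commute)
    have eq: "(?f' x)\<^sup>2 / ?f x = (1 / \<sigma>^4) * (?f x * (x - \<mu>)^(2 * 1))" for x
    proof -
      have "(- a * b)\<^sup>2 / b = a\<^sup>2 * b" if "0 < b" for a b :: real using that by (simp add: power2_eq_square)
      from this[OF normal_density_pos[OF \<sigma>], of "(x - \<mu>) / \<sigma>\<^sup>2"]
      have "(?f' x)\<^sup>2 / ?f x = ((x - \<mu>) / \<sigma>\<^sup>2)\<^sup>2 * ?f x" by blast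
      then show ?thesis by (simp add: power_divide mult.commute)
    qed
    have i: "has_bochner_integral lborel (\<lambda>x. ?f x * (x - \<mu>)^(2 * 1)) (\<sigma>\<^sup>2)"
      using normal_moment_even[OF \<sigma>, of \<mu> 1] by (simp add: fact_numeral)
    have "(\<integral>\<^sup>+x. ennreal ((?f' x)\<^sup>2 / ?f x) \<partial>lborel) = ennreal (1 / \<sigma>^4 * \<sigma>\<^sup>2)"
      unfolding eq using has_bochner_integral_mult_right[OF i, of "1 / \<sigma>^4"]
      by (intro nn_integral_eq_integral[THEN trans]) (auto simp: has_bochner_integral_iff)
    also have "1 / \<sigma>^4 * \<sigma>\<^sup>2 = 1 / \<sigma>\<^sup>2" using \<sigma> by (simp add: power2_eq_square power4_eq_xxxx)
    finally show "(\<integral>\<^sup>+x. ennreal ((?f' x)\<^sup>2 / ?f x) \<partial>lborel) \<le> ennreal (1 / \<sigma>\<^sup>2)" by simp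
  qed (use normal_density_pos[OF \<sigma>] in \<open>auto simp: less_imp_neq[THEN not_sym]\<close>)
qed

lemma integral_normal_law:
  fixes g :: "real \<Rightarrow> real"
  assumes "has_bochner_integral lborel (\<lambda>x. normal_density \<mu> \<sigma> x * g x) c" "g \<in> borel_measurable borel"
  shows "integrable (density lborel (normal_density \<mu> \<sigma>)) g" "(\<integral>x. g x \<partial>density lborel (normal_density \<mu> \<sigma>)) = c"
  using assms by (auto simp: integrable_density integral_density has_bochner_integral_iff)

lemma normal_law_moments:
  fixes \<mu> \<sigma> :: real
  assumes \<sigma>: "0 < \<sigma>"
  defines "\<gamma> \<equiv> density lborel (normal_density \<mu> \<sigma>)"
  shows "integrable \<gamma> (\<lambda>x. \<bar>x - \<mu>\<bar> ^ 3)" "(\<integral>x. \<bar>x - \<mu>\<bar> ^ 3 \<partial>\<gamma>) \<le> 2 * \<sigma> ^ 3"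
    "(\<integral>x. x - \<mu> \<partial>\<gamma>) = 0" "(\<integral>x. (x - \<mu>)\<^sup>2 \<partial>\<gamma>) = \<sigma>\<^sup>2"
proof -
  have "has_bochner_integral lborel (\<lambda>x. normal_density \<mu> \<sigma> x * \<bar>x - \<mu>\<bar> ^ 3) (2 * \<sigma> ^ 3 * sqrt (2 / pi))"
    using normal_moment_abs_odd[OF \<sigma>, of \<mu> 1] by simp
  note m3 = integral_normal_law[OF this]
  show "integrable \<gamma> (\<lambda>x. \<bar>x - \<mu>\<bar> ^ 3)" unfolding \<gamma>_def by (rule m3) simp
  have "sqrt (2 / pi) \<le> 1" using pi_ge_two by (simp add: divide_le_eq)
  then have "2 * \<sigma> ^ 3 * sqrt (2 / pi) \<le> 2 * \<sigma> ^ 3" using \<sigma> by (intro mult_left_le) auto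
  then show "(\<integral>x. \<bar>x - \<mu>\<bar> ^ 3 \<partial>\<gamma>) \<le> 2 * \<sigma> ^ 3" unfolding \<gamma>_def by (subst m3(2)) auto
  have "has_bochner_integral lborel (\<lambda>x. normal_density \<mu> \<sigma> x * (x - \<mu>)) 0"
    using normal_moment_odd[OF \<sigma>, of \<mu> 0] by simp
  from integral_normal_law(2)[OF this] show "(\<integral>x. x - \<mu> \<partial>\<gamma>) = 0" unfolding \<gamma>_def by simp
  have "has_bochner_integral lborel (\<lambda>x. normal_density \<mu> \<sigma> x * (x - \<mu>)\<^sup>2) (\<sigma>\<^sup>2)"
    using normal_moment_even[OF \<sigma>, of \<mu> 1] by (simp add: fact_numeral)
  from integral_normal_law(2)[OF this] show "(\<integral>x. (x - \<mu>)\<^sup>2 \<partial>\<gamma>) = \<sigma>\<^sup>2" unfolding \<gamma>_def by simp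
qed

section \<open>Divergence bounded by the L1 distance\<close>

text \<open>Where \<open>q\<close> is larger, \<open>g * ln (q / g) \<le> q - g\<close> leaves at
  most \<open>(q - g) * ln (q / g)\<close>, and the logarithm is controlled by the height bound
  \<open>M\<close>. Where \<open>g\<close> is larger, the logarithmic term is nonpositive.\<close>

lemma KL_integrand_le:
  fixes q g M :: real
  assumes q: "0 \<le> q" "q \<le> M" and g: "0 < g" and T: "ln (M / g) \<le> T" "0 \<le> T"
  shows "q * ln (q / g) - q + g \<le> max 0 (q - g) * T + max 0 (g - q)"
proof (cases "g \<le> q")
  case True
  then have qp: "0 < q" using g by simp
  have "ln (q / g) \<le> q / g - 1" using qp g by (intro ln_le_minus_one) simp
  then have "g * ln (q / g) \<le> g * (q / g - 1)" using g by (intro mult_left_mono) auto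
  then have 1: "g * ln (q / g) \<le> q - g" using g by (simp add: right_diff_distrib)
  have "ln (q / g) \<le> ln (M / g)" using qp q g by (intro ln_mono) (auto simp: divide_right_mono)
  then have "(q - g) * ln (q / g) \<le> (q - g) * T" using True T by (intro mult_left_mono) auto
  moreover have "q * ln (q / g) - q + g \<le> (q - g) * ln (q / g)" using 1 by (simp add: left_diff_distrib)
  ultimately show ?thesis using True by (simp add: max_def)
next
  case False
  have "q * ln (q / g) \<le> 0"
  proof (cases "q = 0")
    case False
    then have "ln (q / g) \<le> 0" using \<open>\<not> g \<le> q\<close> q g by (intro ln_le_zero_iff[THEN iffD2]) auto
    then show ?thesis using q by (simp add: mult_nonneg_nonpos)
  qed simp
  then show ?thesis using False by (simp add: max_def)
qed

text \<open>Cauchy-Schwarz for \<open>sqrt w\<close> and \<open>sqrt w * y\<^sup>2\<close>: a small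
  mass together with a bounded fourth moment forces a small second moment.\<close>

lemma integral_mult_sqrt_le:
  fixes w y :: "real \<Rightarrow> real"
  assumes w: "\<And>x. 0 \<le> w x" and [measurable]: "w \<in> borel_measurable lborel" "y \<in> borel_measurable lborel"
    and iw: "integrable lborel w" and iw4: "integrable lborel (\<lambda>x. w x * (y x)^4)"
  shows "integrable lborel (\<lambda>x. w x * (y x)\<^sup>2)"
    "(\<integral>x. w x * (y x)\<^sup>2 \<partial>lborel)\<^sup>2 \<le> (\<integral>x. w x \<partial>lborel) * (\<integral>x. w x * (y x)^4 \<partial>lborel)"
proof -
  show i2: "integrable lborel (\<lambda>x. w x * (y x)\<^sup>2)"
  proof (rule Bochner_Integration.integrable_bound[of _ "\<lambda>x. w x + w x * (y x)^4"])
    have "b\<^sup>2 \<le> 1 + b^4" for b :: real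
    proof -
      have "2 * b\<^sup>2 \<le> 1 + b^4" using sum_squares_bound[of 1 "b\<^sup>2"] by simp
      then show ?thesis using zero_le_power2[of b] by linarith
    qed
    then have "w x * (y x)\<^sup>2 \<le> w x * (1 + (y x)^4)" for x using w by (intro mult_left_mono) auto
    then show "AE x in lborel. norm (w x * (y x)\<^sup>2) \<le> norm (w x + w x * (y x)^4)"
      using w by (auto simp: distrib_left)
  qed (use iw iw4 in auto)
  have "ennreal ((\<integral>x. w x * (y x)\<^sup>2 \<partial>lborel)\<^sup>2) = (\<integral>\<^sup>+x. ennreal (w x * (y x)\<^sup>2) \<partial>lborel)\<^sup>2"
    using w by (subst nn_integral_eq_integral[OF i2]) (auto simp: ennreal_power Bochner_Integration.integral_nonneg)
  also have "(\<lambda>x. ennreal (w x * (y x)\<^sup>2)) = (\<lambda>x. ennreal (sqrt (w x)) * ennreal (sqrt (w x) * (y x)\<^sup>2))"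
    using w by (auto simp: ennreal_mult[symmetric] mult.assoc[symmetric])
  also have "(\<integral>\<^sup>+x. ennreal (sqrt (w x)) * ennreal (sqrt (w x) * (y x)\<^sup>2) \<partial>lborel)\<^sup>2
     \<le> (\<integral>\<^sup>+x. (ennreal (sqrt (w x)))\<^sup>2 \<partial>lborel) * (\<integral>\<^sup>+x. (ennreal (sqrt (w x) * (y x)\<^sup>2))\<^sup>2 \<partial>lborel)"
    by (rule Cauchy_Schwarz_nn_integral) auto
  also have "(\<lambda>x. (ennreal (sqrt (w x)))\<^sup>2) = (\<lambda>x. ennreal (w x))" using w by (auto simp: ennreal_power)
  also have "(\<lambda>x. (ennreal (sqrt (w x) * (y x)\<^sup>2))\<^sup>2) = (\<lambda>x. ennreal (w x * (y x)^4))"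
    using w by (auto simp: ennreal_power power_mult_distrib)
  also have "(\<integral>\<^sup>+x. ennreal (w x) \<partial>lborel) = ennreal (\<integral>x. w x \<partial>lborel)"
    using w by (intro nn_integral_eq_integral iw) auto
  also have "(\<integral>\<^sup>+x. ennreal (w x * (y x)^4) \<partial>lborel) = ennreal (\<integral>x. w x * (y x)^4 \<partial>lborel)"
    using w by (intro nn_integral_eq_integral iw4) auto
  also have "ennreal (\<integral>x. w x \<partial>lborel) * ennreal (\<integral>x. w x * (y x)^4 \<partial>lborel)
     = ennreal ((\<integral>x. w x \<partial>lborel) * (\<integral>x. w x * (y x)^4 \<partial>lborel))"
    using w by (intro ennreal_mult[symmetric]) (auto intro!: Bochner_Integration.integral_nonneg)
  finally show "(\<integral>x. w x * (y x)\<^sup>2 \<partial>lborel)\<^sup>2 \<le> (\<integral>x. w x \<partial>lborel) * (\<integral>x. w x * (y x)^4 \<partial>lborel)"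
    using w by (subst (asm) ennreal_le_iff) (auto intro!: mult_nonneg_nonneg Bochner_Integration.integral_nonneg)
qed

text \<open>Since \<open>q\<close> and the Gaussian density \<open>g\<close> have the same variance, \<open>\<integral> (q - g)\<^sup>+ (x - m)\<^sup>2 = \<integral> (g - q)\<^sup>+ (x - m)\<^sup>2\<close>,
  and the right-hand side only involves Gaussian tails.\<close>
lemma gauss_KL_le:
  fixes q :: "real \<Rightarrow> real"
  assumes qm[measurable]: "q \<in> borel_measurable borel" and q0: "\<And>x. 0 \<le> q x" and qM: "AE x in lborel. q x \<le> M"
    and iq: "integrable lborel q" and i2: "integrable lborel (\<lambda>x. (x - dens_mean q)\<^sup>2 * q x)"
    and v: "0 < dens_var q"
    and \<delta>: "(\<integral>x. \<bar>q x - normal_density (dens_mean q) (sqrt (dens_var q)) x\<bar> \<partial>lborel) \<le> \<delta>" and M0: "0 \<le> M"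
  shows "gauss_KL q \<le> ennreal ((1 + ln (1 + M * sqrt (2 * pi * dens_var q))) * \<delta> + sqrt \<delta>)"
proof -
  define m where "m = dens_mean q"
  define v where "v = dens_var q"
  define s where "s = sqrt v"
  define g where "g = normal_density m s"
  have s: "0 < s" "s\<^sup>2 = v" "0 < v" using assms(6) by (auto simp: s_def v_def)
  have gp: "0 < g x" for x unfolding g_def by (rule normal_density_pos[OF s(1)])
  have gm[measurable]: "g \<in> borel_measurable borel" unfolding g_def by simp
  have ig: "integrable lborel g" unfolding g_def by (rule integrable_normal_density[OF s(1)])
  have g2: "has_bochner_integral lborel (\<lambda>x. g x * (x - m)\<^sup>2) v"
    using normal_moment_even[OF s(1), of m 1] s by (simp add: fact_numeral g_def)
  have g4: "has_bochner_integral lborel (\<lambda>x. g x * (x - m)^4) (3 * v\<^sup>2)"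
    using normal_moment_even[OF s(1), of m 2] s by (simp add: fact_numeral g_def power_divide)
  \<comment> \<open>The added 1 inside the logarithm keeps \<open>A\<close> nonnegative even for
    small \<open>M\<close>.\<close>
  define A where "A = ln (1 + M * sqrt (2 * pi * v))"
  have Mv: "0 \<le> M * sqrt (2 * pi * v)" using M0 s by auto
  have A0: "0 \<le> A" unfolding A_def using Mv by simp
  define P where "P x = max 0 (q x - g x)" for x
  define N where "N x = max 0 (g x - q x)" for x
  have [measurable]: "P \<in> borel_measurable borel" "N \<in> borel_measurable borel" unfolding P_def N_def by measurable
  have PN: "0 \<le> P x" "0 \<le> N x" "P x \<le> \<bar>q x - g x\<bar>" "N x \<le> \<bar>q x - g x\<bar>" "N x \<le> g x" "q x - g x = P x - N x" for x
    unfolding P_def N_def using q0[of x] gp[of x] by auto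
  have iabs: "integrable lborel (\<lambda>x. \<bar>q x - g x\<bar>)" using iq ig by auto
  have iP: "integrable lborel P" by (rule Bochner_Integration.integrable_bound[OF iabs]) (use PN in auto)
  have iN: "integrable lborel N" by (rule Bochner_Integration.integrable_bound[OF iabs]) (use PN in auto)
  have \<delta>': "(\<integral>x. \<bar>q x - g x\<bar> \<partial>lborel) \<le> \<delta>" using \<delta> unfolding g_def m_def s_def v_def .
  have P\<delta>: "(\<integral>x. P x \<partial>lborel) \<le> \<delta>"
    by (rule order_trans[OF integral_mono[OF iP iabs] \<delta>']) (use PN in auto)
  have N\<delta>: "(\<integral>x. N x \<partial>lborel) \<le> \<delta>"
    by (rule order_trans[OF integral_mono[OF iN iabs] \<delta>']) (use PN in auto)
  have \<delta>0: "0 \<le> \<delta>" using N\<delta> PN(2) by (meson Bochner_Integration.integral_nonneg order_trans)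
  have iN4: "integrable lborel (\<lambda>x. N x * (x - m)^4)"
  proof (rule Bochner_Integration.integrable_bound[of _ "\<lambda>x. g x * (x - m)^4"])
    show "integrable lborel (\<lambda>x. g x * (x - m)^4)" using g4 by (simp add: has_bochner_integral_iff)
    have "N x * (x - m)^4 \<le> g x * (x - m)^4" "0 \<le> N x * (x - m)^4" for x
      using PN[of x] by (auto intro: mult_right_mono)
    then have "\<bar>N x * (x - m)^4\<bar> \<le> \<bar>g x * (x - m)^4\<bar>" for x by (metis abs_of_nonneg order_trans)
    then show "AE x in lborel. norm (N x * (x - m)^4) \<le> norm (g x * (x - m)^4)" by simp
  qed measurable
  note N2 = integral_mult_sqrt_le[of N "\<lambda>x. x - m", OF PN(2) _ _ iN iN4]
  have iN2: "integrable lborel (\<lambda>x. N x * (x - m)\<^sup>2)" by (rule N2(1)) auto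
  have "(\<integral>x. N x * (x - m)^4 \<partial>lborel) \<le> (\<integral>x. g x * (x - m)^4 \<partial>lborel)"
    by (rule integral_mono[OF iN4]) (use g4 PN in \<open>auto simp: has_bochner_integral_iff intro!: mult_right_mono\<close>)
  also have "\<dots> = 3 * v\<^sup>2" using g4 by (simp add: has_bochner_integral_iff)
  finally have N4: "(\<integral>x. N x * (x - m)^4 \<partial>lborel) \<le> 3 * v\<^sup>2" .
  have "(\<integral>x. N x * (x - m)\<^sup>2 \<partial>lborel)\<^sup>2 \<le> (\<integral>x. N x \<partial>lborel) * (\<integral>x. N x * (x - m)^4 \<partial>lborel)"
    by (rule N2(2)) auto
  also have "\<dots> \<le> \<delta> * (3 * v\<^sup>2)"
    using N\<delta> N4 \<delta>0 by (intro mult_mono) (auto intro!: Bochner_Integration.integral_nonneg simp: PN)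
  \<comment> \<open>The factor 3 of the Gaussian fourth moment is rounded up to 4, so that the
    square root is exact.\<close>
  also have "\<dots> \<le> (2 * v * sqrt \<delta>)\<^sup>2" using \<delta>0 by (simp add: power_mult_distrib mult.commute mult_left_mono)
  finally have N2b: "(\<integral>x. N x * (x - m)\<^sup>2 \<partial>lborel) \<le> 2 * v * sqrt \<delta>"
    by (rule power2_le_imp_le) (use s \<delta>0 in auto)
  have iq2: "integrable lborel (\<lambda>x. q x * (x - m)\<^sup>2)" using i2 by (simp add: m_def mult.commute)
  have q2: "(\<integral>x. q x * (x - m)\<^sup>2 \<partial>lborel) = v" unfolding v_def dens_var_def m_def by (simp add: mult.commute)
  have Peq: "P x * (x - m)\<^sup>2 = q x * (x - m)\<^sup>2 - g x * (x - m)\<^sup>2 + N x * (x - m)\<^sup>2" for x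
    using PN(6)[of x] by (simp add: left_diff_distrib[symmetric] distrib_right[symmetric])
  have ig2: "integrable lborel (\<lambda>x. g x * (x - m)\<^sup>2)" "(\<integral>x. g x * (x - m)\<^sup>2 \<partial>lborel) = v"
    using g2 by (auto simp: has_bochner_integral_iff)
  have iP2: "integrable lborel (\<lambda>x. P x * (x - m)\<^sup>2)" unfolding Peq using iq2 ig2 iN2 by auto
  have "(\<integral>x. P x * (x - m)\<^sup>2 \<partial>lborel) = (\<integral>x. N x * (x - m)\<^sup>2 \<partial>lborel)"
    unfolding Peq using iq2 ig2 iN2 q2 by simp
  with N2b have P2b: "(\<integral>x. P x * (x - m)\<^sup>2 \<partial>lborel) \<le> 2 * v * sqrt \<delta>" by simp
  \<comment> \<open>The Gaussian log-density is quadratic, so the logarithm grows no faster than the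
    square whose integral against \<open>P\<close> has just been estimated.\<close>
  have lnM: "ln (M / g x) \<le> A + (x - m)\<^sup>2 / (2 * v)" for x
  proof (cases "M = 0")
    case True then show ?thesis using A0 s by simp
  next
    case False
    then have Mp: "0 < M" using M0 by simp
    have rt: "0 < sqrt (2 * pi * v)" using s by simp
    have "M / g x = M * sqrt (2 * pi * v) * exp ((x - m)\<^sup>2 / (2 * v))"
      unfolding g_def normal_density_def s(2) using rt by (simp add: exp_minus field_simps)
    then have "ln (M / g x) = ln (M * sqrt (2 * pi * v)) + (x - m)\<^sup>2 / (2 * v)"
      using Mp rt by (simp only:) (subst ln_mult, auto)
    moreover have "ln (M * sqrt (2 * pi * v)) \<le> A" unfolding A_def using Mp rt by (intro ln_mono) auto
    ultimately show ?thesis by simp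
  qed
  define B where "B x = P x * (A + (x - m)\<^sup>2 / (2 * v)) + N x" for x
  have Beq: "B x = A * P x + (1 / (2 * v)) * (P x * (x - m)\<^sup>2) + N x" for x unfolding B_def by (simp add: algebra_simps)
  have iB: "integrable lborel B" unfolding Beq using iP iP2 iN by auto
  have B0: "0 \<le> B x" for x unfolding B_def using PN A0 s by auto
  have "(\<integral>x. B x \<partial>lborel) = A * (\<integral>x. P x \<partial>lborel) + (1 / (2 * v)) * (\<integral>x. P x * (x - m)\<^sup>2 \<partial>lborel) + (\<integral>x. N x \<partial>lborel)"
    unfolding Beq using iP iP2 iN by simp
  also have "\<dots> \<le> A * \<delta> + (1 / (2 * v)) * (2 * v * sqrt \<delta>) + \<delta>"
    using P\<delta> P2b N\<delta> A0 s by (intro add_mono mult_left_mono) auto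
  also have "\<dots> = (1 + A) * \<delta> + sqrt \<delta>" using s by (simp add: algebra_simps)
  finally have Bb: "(\<integral>x. B x \<partial>lborel) \<le> (1 + A) * \<delta> + sqrt \<delta>" .
  have "gauss_KL q = (\<integral>\<^sup>+x. ennreal (q x * ln (q x / g x) - q x + g x) \<partial>lborel)"
    unfolding gauss_KL_def Let_def g_def m_def s_def v_def ..
  also have "\<dots> \<le> (\<integral>\<^sup>+x. ennreal (B x) \<partial>lborel)"
  proof (rule nn_integral_mono_AE, use qM in eventually_elim)
    fix x assume "q x \<le> M"
    then show "ennreal (q x * ln (q x / g x) - q x + g x) \<le> ennreal (B x)"
      unfolding B_def P_def N_def using q0 gp lnM A0 s by (intro ennreal_leI KL_integrand_le) auto
  qed
  also have "\<dots> = ennreal (\<integral>x. B x \<partial>lborel)" by (rule nn_integral_eq_integral[OF iB]) (use B0 in auto)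
  also have "\<dots> \<le> ennreal ((1 + A) * \<delta> + sqrt \<delta>)" using Bb by (rule ennreal_leI)
  finally show ?thesis unfolding A_def v_def .
qed

section \<open>Power inequalities for moments\<close>

text \<open>The tangent of the cube at \<open>a\<close>; the gap is
  \<open>(y - a)\<^sup>2 * (y + 2 * a)\<close>. Averaged with \<open>a\<close> equal to the mean, it
  becomes the Jensen inequality for cubes.\<close>

lemma cube_tangent: "3 * (a::real)\<^sup>2 * y - 2 * a ^ 3 \<le> y ^ 3" if "0 \<le> a" "0 \<le> y"
proof -
  have "0 \<le> (y - a)\<^sup>2 * (y + 2 * a)" using that by simp
  also have "\<dots> = y ^ 3 - (3 * a\<^sup>2 * y - 2 * a ^ 3)" by (simp add: power2_eq_square power3_eq_cube algebra_simps)
  finally show ?thesis by simp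
qed

lemma (in prob_space) expectation_cube_le:
  fixes Y :: "'a \<Rightarrow> real"
  assumes "\<And>x. 0 \<le> Y x" "integrable M Y" "integrable M (\<lambda>x. Y x ^ 3)"
  shows "(expectation Y) ^ 3 \<le> expectation (\<lambda>x. Y x ^ 3)"
proof -
  define a where "a = expectation Y"
  have a: "0 \<le> a" unfolding a_def using assms(1) by simp
  have "expectation (\<lambda>x. 3 * a\<^sup>2 * Y x - 2 * a ^ 3) \<le> expectation (\<lambda>x. Y x ^ 3)"
    using assms cube_tangent[OF a assms(1)] by (intro integral_mono) auto
  moreover have "expectation (\<lambda>x. 3 * a\<^sup>2 * Y x - 2 * a ^ 3) = 3 * a\<^sup>2 * a - 2 * a ^ 3"
    using assms(2) by (simp add: prob_space a_def)
  moreover have "3 * a\<^sup>2 * a - 2 * a ^ 3 = a ^ 3" by (simp add: power2_eq_square power3_eq_cube)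
  ultimately show ?thesis by (simp add: a_def)
qed

lemma sixth_power_diff_le: "((x::real) - y) ^ 6 \<le> 32 * (x ^ 6 + y ^ 6)"
proof -
  have "0 \<le> (x + y)\<^sup>2" by simp
  then have "(x - y)\<^sup>2 \<le> 2 * (x\<^sup>2 + y\<^sup>2)" by (simp add: power2_eq_square algebra_simps)
  then have 1: "((x - y)\<^sup>2) ^ 3 \<le> (2 * (x\<^sup>2 + y\<^sup>2)) ^ 3" by (rule power_mono) simp
  have "(a + b) ^ 3 \<le> 4 * (a ^ 3 + b ^ 3)" if "0 \<le> a" "0 \<le> b" for a b :: real
  proof -
    have "0 \<le> 3 * ((a - b)\<^sup>2 * (a + b))" using that by simp
    also have "\<dots> = 4 * (a ^ 3 + b ^ 3) - (a + b) ^ 3" by (simp add: power2_eq_square power3_eq_cube algebra_simps)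
    finally show ?thesis by simp
  qed
  from this[of "x\<^sup>2" "y\<^sup>2"] have "8 * (x\<^sup>2 + y\<^sup>2) ^ 3 \<le> 32 * (x ^ 6 + y ^ 6)" by (simp flip: power_mult)
  moreover have "(2 * (x\<^sup>2 + y\<^sup>2)) ^ 3 = 8 * (x\<^sup>2 + y\<^sup>2) ^ 3" by (simp only: power_mult_distrib) simp
  moreover have "((x - y)\<^sup>2) ^ 3 = (x - y) ^ 6" by (simp flip: power_mult)
  ultimately show ?thesis using 1 by linarith
qed

text \<open>Everything passes through the centred sixth moment, at most
  \<open>32 * (c + \<mu> ^ 6)\<close> and hence \<open>64 * c\<close>. Jensen for cubes then bounds
  the variance, and Cauchy-Schwarz the third absolute moment.\<close>

lemma sixth_moment_bounds:
  fixes \<kappa> :: "real measure"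
  assumes "prob_space \<kappa>" and sets[measurable_cong]: "sets \<kappa> = sets borel" and i6: "integrable \<kappa> (\<lambda>x. x ^ 6)"
  defines "\<mu> \<equiv> (\<integral>x. x \<partial>\<kappa>)" and "c \<equiv> (\<integral>x. x ^ 6 \<partial>\<kappa>)"
  defines "v \<equiv> (\<integral>x. (x - \<mu>)\<^sup>2 \<partial>\<kappa>)"
  shows "integrable \<kappa> (\<lambda>x. x)" "integrable \<kappa> (\<lambda>x. (x - \<mu>)\<^sup>2)" "integrable \<kappa> (\<lambda>x. \<bar>x - \<mu>\<bar> ^ 3)" "0 \<le> c" "0 \<le> v"
    "v ^ 3 \<le> 64 * c" "(\<integral>x. \<bar>x - \<mu>\<bar> ^ 3 \<partial>\<kappa>) \<le> sqrt (64 * c)"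
proof -
  interpret prob_space \<kappa> by fact
  have ik: "integrable \<kappa> (\<lambda>x. \<bar>x\<bar> ^ k)" if "k \<le> 6" for k
  proof (rule Bochner_Integration.integrable_bound[of _ "\<lambda>x. 1 + x ^ 6"])
    show "AE x in \<kappa>. norm (\<bar>x\<bar> ^ k) \<le> norm (1 + x ^ 6)"
      using power_le_one_plus[OF that] by (auto simp: power_even_abs abs_of_nonneg)
  qed (use i6 in auto)
  have i1: "integrable \<kappa> (\<lambda>x. x)"
    by (rule Bochner_Integration.integrable_bound[OF ik[of 1]]) auto
  then show "integrable \<kappa> (\<lambda>x. x)" .
  have i2: "integrable \<kappa> (\<lambda>x. x\<^sup>2)" using ik[of 2] by simp
  have d6: "integrable \<kappa> (\<lambda>x. (x - \<mu>) ^ 6)"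
  proof (rule Bochner_Integration.integrable_bound[of _ "\<lambda>x. 32 * (x ^ 6 + \<mu> ^ 6)"])
    show "AE x in \<kappa>. norm ((x - \<mu>) ^ 6) \<le> norm (32 * (x ^ 6 + \<mu> ^ 6))"
      using sixth_power_diff_le[of _ \<mu>] by (auto simp: abs_of_nonneg)
  qed (use i6 in auto)
  have dk: "integrable \<kappa> (\<lambda>x. \<bar>x - \<mu>\<bar> ^ k)" if "k \<le> 6" for k
  proof (rule Bochner_Integration.integrable_bound[of _ "\<lambda>x. 1 + (x - \<mu>) ^ 6"])
    show "AE x in \<kappa>. norm (\<bar>x - \<mu>\<bar> ^ k) \<le> norm (1 + (x - \<mu>) ^ 6)"
      using power_le_one_plus[OF that] by (auto simp: power_even_abs abs_of_nonneg)
  qed (use d6 in auto)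
  show d2: "integrable \<kappa> (\<lambda>x. (x - \<mu>)\<^sup>2)" using dk[of 2] by simp
  show "integrable \<kappa> (\<lambda>x. \<bar>x - \<mu>\<bar> ^ 3)" by (rule dk) simp
  show "0 \<le> c" "0 \<le> v" unfolding c_def v_def by auto
  have "expectation (\<lambda>x. \<bar>x\<bar>) \<le> sqrt (expectation (\<lambda>x. x\<^sup>2))" by (rule expectation_abs_le_sqrt) (use i2 in auto)
  moreover have "\<bar>\<mu>\<bar> \<le> expectation (\<lambda>x. \<bar>x\<bar>)" unfolding \<mu>_def by (rule integral_abs_bound)
  ultimately have "\<bar>\<mu>\<bar>\<^sup>2 \<le> (sqrt (expectation (\<lambda>x. x\<^sup>2)))\<^sup>2" by (intro power_mono) auto
  then have "\<mu>\<^sup>2 \<le> expectation (\<lambda>x. x\<^sup>2)" by simp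
  then have "(\<mu>\<^sup>2) ^ 3 \<le> (expectation (\<lambda>x. x\<^sup>2)) ^ 3" by (rule power_mono) simp
  also have "\<dots> \<le> expectation (\<lambda>x. (x\<^sup>2) ^ 3)"
    by (rule expectation_cube_le) (use i2 i6 in \<open>auto simp flip: power_mult\<close>)
  finally have \<mu>6: "\<mu> ^ 6 \<le> c" unfolding c_def by (simp flip: power_mult)
  have "expectation (\<lambda>x. (x - \<mu>) ^ 6) \<le> expectation (\<lambda>x. 32 * (x ^ 6 + \<mu> ^ 6))"
    using d6 i6 sixth_power_diff_le by (intro integral_mono) auto
  also have "\<dots> = 32 * (c + \<mu> ^ 6)" using i6 by (simp add: prob_space c_def)
  finally have d6c: "expectation (\<lambda>x. (x - \<mu>) ^ 6) \<le> 64 * c" using \<mu>6 by simp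
  have "v ^ 3 \<le> expectation (\<lambda>x. ((x - \<mu>)\<^sup>2) ^ 3)" unfolding v_def
    by (rule expectation_cube_le) (use d2 d6 in \<open>auto simp flip: power_mult\<close>)
  then show "v ^ 3 \<le> 64 * c" using d6c by (simp flip: power_mult)
  have "expectation (\<lambda>x. \<bar>\<bar>x - \<mu>\<bar> ^ 3\<bar>) \<le> sqrt (expectation (\<lambda>x. (\<bar>x - \<mu>\<bar> ^ 3)\<^sup>2))"
    by (rule expectation_abs_le_sqrt(2)) (use d6 in \<open>auto simp: power_even_abs simp flip: power_mult\<close>)
  also have "\<dots> \<le> sqrt (64 * c)" using d6c by (intro real_sqrt_le_mono) (simp add: power_even_abs flip: power_mult)
  finally show "expectation (\<lambda>x. \<bar>x - \<mu>\<bar> ^ 3) \<le> sqrt (64 * c)" by simp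
qed

section \<open>Height of the density and the Gaussian limit law of the normalized sum\<close>

text \<open>For fixed other coordinates the sum is a translate of coordinate 0, whose density is at
  most \<open>sqrt J\<close>; dividing by \<open>sqrt (real n)\<close> multiplies the height by that
  factor. A single summand therefore controls the height of the whole sum.\<close>

lemma normalized_sum_law_le:
  fixes \<kappa> :: "nat \<Rightarrow> real measure"
  assumes n: "0 < n" and pr: "\<And>j. prob_space (\<kappa> j)" and st: "\<And>j. sets (\<kappa> j) = sets borel"
    and fd: "fisher_density f f' J" "\<kappa> 0 = density lborel f" and A[measurable]: "A \<in> sets borel"
  shows "emeasure (distr (Pi\<^sub>M {..<n} \<kappa>) borel (\<lambda>x. (\<Sum>j<n. x j) / sqrt (real n))) A
    \<le> ennreal (sqrt (real n * J)) * emeasure lborel A"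
proof -
  interpret F: fisher_density f f' J by (rule fd)
  interpret K: real_laws \<kappa>
    unfolding real_laws_def real_laws_axioms_def product_sigma_finite_def
    using pr st prob_space_imp_sigma_finite by blast
  define I where "I = {..<n} - {0}"
  have I: "{..<n} = insert 0 I" "finite I" "0 \<notin> I" using n by (auto simp: I_def)
  interpret P: prob_space "Pi\<^sub>M I \<kappa>" by (rule prob_space_PiM) (rule pr)
  have Sm[measurable]: "(\<lambda>x. \<Sum>j\<in>L. x j) \<in> borel_measurable (Pi\<^sub>M L \<kappa>)" for L by (rule K.measurable_coord_sum) simp
  have r: "0 < sqrt (real n)" using n by simp
  have "emeasure (distr (Pi\<^sub>M {..<n} \<kappa>) borel (\<lambda>x. (\<Sum>j<n. x j) / sqrt (real n))) A
     = (\<integral>\<^sup>+x. indicator A ((\<Sum>j<n. x j) / sqrt (real n)) \<partial>Pi\<^sub>M {..<n} \<kappa>)"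
  proof -
    have "emeasure (distr (Pi\<^sub>M {..<n} \<kappa>) borel (\<lambda>x. (\<Sum>j<n. x j) / sqrt (real n))) A
      = (\<integral>\<^sup>+z. indicator A z \<partial>distr (Pi\<^sub>M {..<n} \<kappa>) borel (\<lambda>x. (\<Sum>j<n. x j) / sqrt (real n)))" by simp
    also have "\<dots> = (\<integral>\<^sup>+x. indicator A ((\<Sum>j<n. x j) / sqrt (real n)) \<partial>Pi\<^sub>M {..<n} \<kappa>)"
      by (rule nn_integral_distr) measurable
    finally show ?thesis .
  qed
  also have "\<dots> = (\<integral>\<^sup>+x. \<integral>\<^sup>+y. indicator A ((\<Sum>j\<in>insert 0 I. (x(0 := y)) j) / sqrt (real n)) \<partial>\<kappa> 0 \<partial>Pi\<^sub>M I \<kappa>)"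
    unfolding I(1) by (rule K.product_nn_integral_insert[OF I(2,3)]) measurable
  also have "\<dots> \<le> (\<integral>\<^sup>+x. ennreal (sqrt (real n * J)) * emeasure lborel A \<partial>Pi\<^sub>M I \<kappa>)"
  proof (rule nn_integral_mono)
    fix x :: "nat \<Rightarrow> real"
    define b where "b = (\<Sum>j\<in>I. x j)"
    have "(\<Sum>j\<in>insert 0 I. (x(0 := y)) j) = b + y" for y
    proof -
      have "(\<Sum>j\<in>I. (x(0 := y)) j) = b" unfolding b_def using I(3) by (intro sum.cong) auto
      then show ?thesis using I(2,3) by (simp del: fun_upd_apply) simp
    qed
    then have "(\<integral>\<^sup>+y. indicator A ((\<Sum>j\<in>insert 0 I. (x(0 := y)) j) / sqrt (real n)) \<partial>\<kappa> 0)
       = (\<integral>\<^sup>+y. ennreal (f y) * indicator A ((b + y) / sqrt (real n)) \<partial>lborel)"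
      unfolding fd(2) by (simp only:) (subst nn_integral_density, auto)
    also have "\<dots> \<le> (\<integral>\<^sup>+y. ennreal (sqrt J) * indicator A ((b + y) / sqrt (real n)) \<partial>lborel)"
      using F.density_le_sqrt_info by (intro nn_integral_mono mult_right_mono ennreal_leI) auto
    also have "\<dots> = ennreal (sqrt J) * (\<integral>\<^sup>+y. indicator A ((b + y) / sqrt (real n)) \<partial>lborel)"
      by (rule nn_integral_cmult) measurable
    also have "(\<integral>\<^sup>+y. indicator A ((b + y) / sqrt (real n)) \<partial>lborel)
       = ennreal (sqrt (real n)) * (\<integral>\<^sup>+z. indicator A z \<partial>lborel)"
      using nn_integral_real_affine[of "\<lambda>y. indicator A ((b + y) / sqrt (real n)) :: ennreal" "sqrt (real n)" "- b"] r
      by simp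
    also have "ennreal (sqrt J) * (ennreal (sqrt (real n)) * (\<integral>\<^sup>+z. indicator A z \<partial>lborel)) = ennreal (sqrt (real n * J)) * emeasure lborel A"
      using F.J_nonneg by (simp add: mult.assoc[symmetric] ennreal_mult[symmetric] real_sqrt_mult mult.commute)
    finally show "(\<integral>\<^sup>+y. indicator A ((\<Sum>j\<in>insert 0 I. (x(0 := y)) j) / sqrt (real n)) \<partial>\<kappa> 0) \<le> ennreal (sqrt (real n * J)) * emeasure lborel A" .
  qed
  also have "\<dots> = ennreal (sqrt (real n * J)) * emeasure lborel A" by (simp add: P.emeasure_space_1)
  finally show ?thesis .
qed

text \<open>The set where \<open>q\<close> exceeds \<open>M\<close> has mass at most
  \<open>M\<close> times its length, so the excess of \<open>q\<close> over \<open>M\<close>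
  integrates to zero there. Finiteness of the mass permits the subtraction.\<close>

lemma AE_density_le:
  fixes q :: "real \<Rightarrow> real"
  assumes [measurable]: "q \<in> borel_measurable borel" and M: "0 < M"
    and fin: "emeasure (density lborel q) UNIV < \<infinity>"
    and le: "\<And>A. A \<in> sets borel \<Longrightarrow> emeasure (density lborel q) A \<le> ennreal M * emeasure lborel A"
  shows "AE x in lborel. q x \<le> M"
proof -
  define A where "A = {x. M < q x}"
  have A[measurable]: "A \<in> sets borel" unfolding A_def by measurable
  have eA: "emeasure (density lborel q) A = (\<integral>\<^sup>+x. ennreal (q x) * indicator A x \<partial>lborel)" by (simp add: emeasure_density)
  have "ennreal M * emeasure lborel A = (\<integral>\<^sup>+x. ennreal M * indicator A x \<partial>lborel)" by (simp add: nn_integral_cmult_indicator)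
  also have "\<dots> \<le> (\<integral>\<^sup>+x. ennreal (q x) * indicator A x \<partial>lborel)"
    by (intro nn_integral_mono) (auto simp: A_def indicator_def intro!: ennreal_leI)
  also have "\<dots> = emeasure (density lborel q) A" by (rule eA[symmetric])
  also have "\<dots> \<le> emeasure (density lborel q) UNIV" by (rule emeasure_mono) auto
  finally have fA: "ennreal M * emeasure lborel A < \<infinity>" using fin by (rule le_less_trans)
  have "(\<integral>\<^sup>+x. ennreal (q x - M) * indicator A x \<partial>lborel) + ennreal M * emeasure lborel A
      = (\<integral>\<^sup>+x. ennreal (q x - M) * indicator A x \<partial>lborel) + (\<integral>\<^sup>+x. ennreal M * indicator A x \<partial>lborel)"
    by (simp add: nn_integral_cmult_indicator)
  also have "\<dots> = (\<integral>\<^sup>+x. ennreal (q x - M) * indicator A x + ennreal M * indicator A x \<partial>lborel)"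
    by (rule nn_integral_add[symmetric]) auto
  also have "\<dots> = emeasure (density lborel q) A" unfolding eA
    using M by (intro nn_integral_cong) (auto simp: A_def indicator_def ennreal_plus[symmetric] simp del: ennreal_plus)
  also have "\<dots> \<le> 0 + ennreal M * emeasure lborel A" using le[OF A] by simp
  finally have "(\<integral>\<^sup>+x. ennreal (q x - M) * indicator A x \<partial>lborel) \<le> 0"
    using fA by (auto simp: ennreal_add_left_cancel_le add.commute)
  then have "(\<integral>\<^sup>+x. ennreal (q x - M) * indicator A x \<partial>lborel) = 0" by simp
  then have "AE x in lborel. ennreal (q x - M) * indicator A x = 0"
    by (subst (asm) nn_integral_0_iff_AE) auto
  then show ?thesis by eventually_elim (auto simp: A_def indicator_def ennreal_eq_0_iff)
qed

lemma indep_coordinates: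
  fixes \<gamma> :: "nat \<Rightarrow> real measure"
  assumes pr: "\<And>j. prob_space (\<gamma> j)" and st: "\<And>j. sets (\<gamma> j) = sets borel" and n: "0 < n"
  shows "prob_space.indep_vars (Pi\<^sub>M {..<n} \<gamma>) (\<lambda>_. borel) (\<lambda>i x. x i) {..<n}"
proof -
  interpret P: prob_space "Pi\<^sub>M {..<n} \<gamma>" by (rule prob_space_PiM) (rule pr)
  have rv: "(\<lambda>x. x i) \<in> borel_measurable (Pi\<^sub>M {..<n} \<gamma>)" if "i \<in> {..<n}" for i
    using measurable_component_singleton[OF that, of \<gamma>] st[of i] by (auto cong: measurable_cong_sets)
  have comp: "distr (Pi\<^sub>M {..<n} \<gamma>) borel (\<lambda>x. x i) = \<gamma> i" if "i \<in> {..<n}" for i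
  proof -
    have "distr (Pi\<^sub>M {..<n} \<gamma>) borel (\<lambda>x. x i) = distr (Pi\<^sub>M {..<n} \<gamma>) (\<gamma> i) (\<lambda>x. x i)"
      by (rule distr_cong) (auto simp: st)
    also have "\<dots> = \<gamma> i" by (rule distr_PiM_component) (use pr that in auto)
    finally show ?thesis .
  qed
  have sP: "sets (Pi\<^sub>M {..<n} (\<lambda>_. borel)) = sets (Pi\<^sub>M {..<n} \<gamma>)" by (rule sets_PiM_cong) (auto simp: st)
  have "distr (Pi\<^sub>M {..<n} \<gamma>) (Pi\<^sub>M {..<n} (\<lambda>_. borel)) (\<lambda>x. \<lambda>i\<in>{..<n}. x i) = distr (Pi\<^sub>M {..<n} \<gamma>) (Pi\<^sub>M {..<n} \<gamma>) (\<lambda>x. x)"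
    by (rule distr_cong) (auto simp: sP space_PiM PiE_def extensional_def restrict_def fun_eq_iff)
  also have "\<dots> = Pi\<^sub>M {..<n} \<gamma>" by simp
  also have "\<dots> = Pi\<^sub>M {..<n} (\<lambda>i. distr (Pi\<^sub>M {..<n} \<gamma>) borel (\<lambda>x. x i))"
    by (rule PiM_cong) (use comp in auto)
  finally show ?thesis
    by (subst P.indep_vars_iff_distr_eq_PiM') (use n rv in auto)
qed

lemma normal_density_scale:
  assumes "0 < r" "0 < s"
  shows "r * normal_density (r * m) (r * s) (r * z) = normal_density m s z"
proof -
  have 1: "(r * z - r * m)\<^sup>2 / (2 * (r * s)\<^sup>2) = (z - m)\<^sup>2 / (2 * s\<^sup>2)"
    using assms by (simp add: right_diff_distrib[symmetric] power_mult_distrib)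
  have 2: "r / sqrt (2 * pi * (r * s)\<^sup>2) = 1 / sqrt (2 * pi * s\<^sup>2)"
  proof -
    have "2 * pi * (r * s)\<^sup>2 = r\<^sup>2 * (2 * pi * s\<^sup>2)" by (simp add: power_mult_distrib)
    then have "sqrt (2 * pi * (r * s)\<^sup>2) = r * sqrt (2 * pi * s\<^sup>2)" using assms(1) by (simp only: real_sqrt_mult) simp
    then show ?thesis using assms(1) by simp
  qed
  have "r * normal_density (r * m) (r * s) (r * z) = r / sqrt (2 * pi * (r * s)\<^sup>2) * exp (- ((r * z - r * m)\<^sup>2 / (2 * (r * s)\<^sup>2)))"
    unfolding normal_density_def by (simp only: minus_divide_left times_divide_eq_right times_divide_eq_left mult_1_right mult_1_left)
  also have "\<dots> = normal_density m s z"
    unfolding 1 2 normal_density_def by (simp only: minus_divide_left)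
  finally show ?thesis .
qed

text \<open>Sums of independent Gaussians are Gaussian with added means and variances, and rescaling
  keeps them so. The replacement thus ends at precisely the Gaussian that the divergence compares
  with.\<close>

lemma integral_normal_product:
  fixes \<mu> \<sigma> :: "nat \<Rightarrow> real" and h :: "real \<Rightarrow> real"
  assumes n: "0 < n" and \<sigma>: "\<And>j. 0 < \<sigma> j" and [measurable]: "h \<in> borel_measurable borel"
  shows "(\<integral>x. h ((\<Sum>j<n. x j) / sqrt (real n)) \<partial>Pi\<^sub>M {..<n} (\<lambda>j. density lborel (normal_density (\<mu> j) (\<sigma> j))))
    = (\<integral>z. normal_density ((\<Sum>j<n. \<mu> j) / sqrt (real n)) (sqrt ((\<Sum>j<n. (\<sigma> j)\<^sup>2) / real n)) z * h z \<partial>lborel)"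
proof -
  define \<gamma> where "\<gamma> j = density lborel (normal_density (\<mu> j) (\<sigma> j))" for j
  have pr: "prob_space (\<gamma> j)" and st: "sets (\<gamma> j) = sets borel" for j
    unfolding \<gamma>_def using prob_space_normal_density[OF \<sigma>] by auto
  interpret P: prob_space "Pi\<^sub>M {..<n} \<gamma>" by (rule prob_space_PiM) (rule pr)
  have rv: "(\<lambda>x. x i) \<in> borel_measurable (Pi\<^sub>M {..<n} \<gamma>)" if "i < n" for i
    using measurable_component_singleton[of i "{..<n}" \<gamma>] st[of i] that by (auto cong: measurable_cong_sets)
  have comp: "distr (Pi\<^sub>M {..<n} \<gamma>) lborel (\<lambda>x. x i) = \<gamma> i" if "i < n" for i
  proof -
    have "distr (Pi\<^sub>M {..<n} \<gamma>) lborel (\<lambda>x. x i) = distr (Pi\<^sub>M {..<n} \<gamma>) (\<gamma> i) (\<lambda>x. x i)"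
      by (rule distr_cong) (auto simp: st)
    also have "\<dots> = \<gamma> i" by (rule distr_PiM_component) (use pr that in auto)
    finally show ?thesis .
  qed
  have "distributed (Pi\<^sub>M {..<n} \<gamma>) lborel (\<lambda>x. \<Sum>i<n. x i) (\<lambda>x. ennreal (normal_density (sum \<mu> {..<n}) (sqrt (\<Sum>i<n. (\<sigma> i)\<^sup>2)) x))"
  proof (rule P.sum_indep_normal)
    show "P.indep_vars (\<lambda>i. borel) (\<lambda>i x. x i) {..<n}" by (rule indep_coordinates[OF pr st n])
    show "distributed (Pi\<^sub>M {..<n} \<gamma>) lborel (\<lambda>x. x i) (\<lambda>x. ennreal (normal_density (\<mu> i) (\<sigma> i) x))" if "i \<in> {..<n}" for i
      unfolding distributed_def using that comp rv by (auto simp: \<gamma>_def)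
  qed (use n \<sigma> in auto)
  then have d: "distr (Pi\<^sub>M {..<n} \<gamma>) lborel (\<lambda>x. \<Sum>i<n. x i) = density lborel (normal_density (sum \<mu> {..<n}) (sqrt (\<Sum>i<n. (\<sigma> i)\<^sup>2)))"
    and [measurable]: "(\<lambda>x. \<Sum>i<n. x i) \<in> borel_measurable (Pi\<^sub>M {..<n} \<gamma>)"
    unfolding distributed_def by auto
  define r where "r = sqrt (real n)"
  define m where "m = (\<Sum>j<n. \<mu> j) / r"
  define s where "s = sqrt ((\<Sum>j<n. (\<sigma> j)\<^sup>2) / real n)"
  have S: "0 < (\<Sum>j<n. (\<sigma> j)\<^sup>2)" using n \<sigma> by (intro sum_pos zero_less_power \<sigma>) (auto simp: lessThan_empty_iff)
  have r: "0 < r" and s: "0 < s" using n S by (auto simp: r_def s_def)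
  have e: "sum \<mu> {..<n} = r * m" "sqrt (\<Sum>i<n. (\<sigma> i)\<^sup>2) = r * s"
    using r n by (auto simp: m_def s_def r_def real_sqrt_mult[symmetric])
  have "(\<integral>x. h ((\<Sum>j<n. x j) / r) \<partial>Pi\<^sub>M {..<n} \<gamma>) = (\<integral>y. h (y / r) \<partial>distr (Pi\<^sub>M {..<n} \<gamma>) lborel (\<lambda>x. \<Sum>i<n. x i))"
    by (rule integral_distr[symmetric]) auto
  also have "\<dots> = (\<integral>y. normal_density (r * m) (r * s) y * h (y / r) \<partial>lborel)"
    unfolding d e by (subst integral_density) auto
  also have "\<dots> = r * (\<integral>z. normal_density (r * m) (r * s) (r * z) * h z \<partial>lborel)"
    using lborel_integral_real_affine[of r "\<lambda>y. normal_density (r * m) (r * s) y * h (y / r)" 0] r by simp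
  also have "\<dots> = (\<integral>z. r * normal_density (r * m) (r * s) (r * z) * h z \<partial>lborel)" by (simp add: mult.assoc)
  also have "\<dots> = (\<integral>z. normal_density m s z * h z \<partial>lborel)" unfolding normal_density_scale[OF r s] ..
  finally show ?thesis unfolding \<gamma>_def r_def m_def s_def .
qed

section \<open>Error terms and powers of n\<close>

lemma mean_cube_le:
  fixes x :: "nat \<Rightarrow> real"
  assumes "0 < n" "\<And>j. 0 \<le> x j"
  shows "((\<Sum>j<n. x j) / real n) ^ 3 \<le> (\<Sum>j<n. x j ^ 3) / real n"
proof -
  define a where "a = (\<Sum>j<n. x j) / real n"
  have a: "0 \<le> a" unfolding a_def using assms by (intro divide_nonneg_nonneg sum_nonneg) auto
  have s: "(\<Sum>j<n. x j) = real n * a" using assms by (simp add: a_def)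
  have "(\<Sum>j<n. 3 * a\<^sup>2 * x j - 2 * a ^ 3) \<le> (\<Sum>j<n. x j ^ 3)"
    by (rule sum_mono) (rule cube_tangent[OF a assms(2)])
  moreover have "(\<Sum>j<n. 3 * a\<^sup>2 * x j - 2 * a ^ 3) = real n * a ^ 3"
    by (simp add: sum_subtractf sum_distrib_left[symmetric] s power2_eq_square power3_eq_cube)
  ultimately show ?thesis using assms(1) by (simp add: a_def[symmetric] field_simps)
qed

lemma mean_square_le:
  fixes x :: "nat \<Rightarrow> real"
  assumes "0 < n"
  shows "((\<Sum>j<n. x j) / real n)\<^sup>2 \<le> (\<Sum>j<n. (x j)\<^sup>2) / real n"
proof -
  define a where "a = (\<Sum>j<n. x j) / real n"
  have s: "(\<Sum>j<n. x j) = real n * a" using assms by (simp add: a_def)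
  have "0 \<le> (\<Sum>j<n. (x j - a)\<^sup>2)" by (rule sum_nonneg) simp
  also have "\<dots> = (\<Sum>j<n. (x j)\<^sup>2) - real n * a\<^sup>2"
    by (simp add: power2_diff sum.distrib sum_subtractf sum_distrib_left[symmetric] sum_distrib_right[symmetric] s)
      (simp add: power2_eq_square)
  finally show ?thesis using assms(1) by (simp add: a_def[symmetric] field_simps)
qed

text \<open>With \<open>a\<close> and \<open>b\<close> the means of \<open>J\<close> and of
  \<open>sqrt c\<close>, the left side is of order \<open>a^(3/2) * b / sqrt n\<close>. Young
  separates this into \<open>a ^ 3\<close> and \<open>b\<^sup>2\<close>, and power means turn these
  into means of \<open>J ^ 3\<close> and \<open>c\<close>: the origin of the cube and of the sixth
  moment.\<close>

lemma lindeberg_error_le: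
  fixes J c \<beta> :: "nat \<Rightarrow> real"
  assumes n: "4 \<le> n" and J: "\<And>j. 0 \<le> J j" and c: "\<And>j. 0 \<le> c j" and \<beta>: "\<And>j. 0 \<le> \<beta> j" "\<And>j. \<beta> j \<le> 24 * sqrt (c j)"
  shows "(sqrt (\<Sum>j<n. 32 * J j) / real (n div 4)) ^ 3 * (\<Sum>j<n. \<beta> j)
    \<le> 1500000 * ((\<Sum>j<n. J j ^ 3 + c j) / real n) / sqrt (real n)"
proof -
  have n0: "0 < real n" using n by simp
  define a where "a = (\<Sum>j<n. J j) / real n"
  define b where "b = (\<Sum>j<n. sqrt (c j)) / real n"
  have a: "0 \<le> a" unfolding a_def using J by (intro divide_nonneg_nonneg sum_nonneg) auto
  have b: "0 \<le> b" unfolding b_def using c by (intro divide_nonneg_nonneg sum_nonneg) auto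
  \<comment> \<open>For \<open>4 \<le> n\<close> the ratio of \<open>n\<close> to
    \<open>n div 4\<close> is largest at \<open>n = 7\<close>, where it equals 7; the factor 8 is
    safe.\<close>
  have "n \<le> 8 * (n div 4)" using n by presburger
  then have "real n \<le> real (8 * (n div 4))" by (simp only: of_nat_le_iff)
  then have "real n \<le> 8 * real (n div 4)" by simp
  then have d: "1 / real (n div 4) \<le> 8 / real n" using n0 n by (simp add: field_simps)
  have s: "sqrt (\<Sum>j<n. 32 * J j) \<le> 6 * (sqrt (real n) * sqrt a)"
  proof -
    have "(\<Sum>j<n. 32 * J j) = 32 * (real n * a)" using n0 by (simp add: a_def sum_distrib_left[symmetric])
    also have "\<dots> \<le> 36 * (real n * a)" using a by (intro mult_right_mono) auto
    finally have "sqrt (\<Sum>j<n. 32 * J j) \<le> sqrt (6\<^sup>2 * (real n * a))" by (simp add: real_sqrt_le_mono)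
    also have "\<dots> = 6 * (sqrt (real n) * sqrt a)" by (simp add: real_sqrt_mult)
    finally show ?thesis .
  qed
  have "sqrt (\<Sum>j<n. 32 * J j) / real (n div 4) \<le> (6 * (sqrt (real n) * sqrt a)) * (8 / real n)"
    using mult_mono[OF s d] a J by (simp add: sum_nonneg)
  also have "\<dots> = 48 * sqrt a / sqrt (real n)"
    using n0 by (simp add: field_simps)
  finally have "(sqrt (\<Sum>j<n. 32 * J j) / real (n div 4)) ^ 3 \<le> (48 * sqrt a / sqrt (real n)) ^ 3"
    using J by (intro power_mono) (auto intro!: divide_nonneg_nonneg sum_nonneg)
  moreover have "(\<Sum>j<n. \<beta> j) \<le> 24 * (real n * b)"
  proof -
    have "(\<Sum>j<n. \<beta> j) \<le> (\<Sum>j<n. 24 * sqrt (c j))" by (rule sum_mono) (rule \<beta>)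
    then show ?thesis using n0 by (simp add: b_def sum_distrib_left[symmetric])
  qed
  ultimately have "(sqrt (\<Sum>j<n. 32 * J j) / real (n div 4)) ^ 3 * (\<Sum>j<n. \<beta> j) \<le> (48 * sqrt a / sqrt (real n)) ^ 3 * (24 * (real n * b))"
    using \<beta>(1) a by (intro mult_mono) (auto intro!: sum_nonneg)
  \<comment> \<open>The constant is \<open>48 ^ 3 * 24\<close>, where 48 is 6, a bound for the root
    of 32, times 8. Young halves it below, and 1500000 is a rounding.\<close>
  also have "\<dots> = 2654208 * (sqrt a ^ 3 * b) / sqrt (real n)"
  proof -
    have "real n = sqrt (real n) * sqrt (real n)" by simp
    then have "(48 * sqrt a / sqrt (real n)) ^ 3 * (24 * (real n * b)) = (48 * sqrt a / sqrt (real n)) ^ 3 * (24 * ((sqrt (real n) * sqrt (real n)) * b))" by simp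
    also have "\<dots> = 2654208 * (sqrt a ^ 3 * b) / sqrt (real n)"
      using n0 by (simp add: power3_eq_cube field_simps)
    finally show ?thesis .
  qed
  also have "sqrt a ^ 3 * b \<le> (a ^ 3 + b\<^sup>2) / 2"
  proof -
    have "2 * (sqrt a ^ 3) * b \<le> (sqrt a ^ 3)\<^sup>2 + b\<^sup>2" by (rule sum_squares_bound)
    moreover have "(sqrt a ^ 3)\<^sup>2 = ((sqrt a)\<^sup>2) ^ 3" by (simp only: power_mult[symmetric] mult.commute)
    ultimately show ?thesis using a by simp
  qed
  also have "a ^ 3 \<le> (\<Sum>j<n. J j ^ 3) / real n" unfolding a_def by (rule mean_cube_le) (use n J in auto)
  also have "b\<^sup>2 \<le> (\<Sum>j<n. c j) / real n" unfolding b_def using mean_square_le[of n "\<lambda>j. sqrt (c j)"] n c by simp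
  finally have "(sqrt (\<Sum>j<n. 32 * J j) / real (n div 4)) ^ 3 * (\<Sum>j<n. \<beta> j)
     \<le> 2654208 * (((\<Sum>j<n. J j ^ 3) / real n + (\<Sum>j<n. c j) / real n) / 2) / sqrt (real n)"
    by (simp add: divide_right_mono)
  also have "\<dots> = 1327104 * ((\<Sum>j<n. J j ^ 3 + c j) / real n) / sqrt (real n)"
    by (simp add: sum.distrib add_divide_distrib)
  also have "\<dots> \<le> 1500000 * ((\<Sum>j<n. J j ^ 3 + c j) / real n) / sqrt (real n)"
    using J c by (intro divide_right_mono mult_right_mono divide_nonneg_nonneg sum_nonneg) auto
  finally show ?thesis .
qed

text \<open>As \<delta> is at most \<open>2 * sqrt \<delta>\<close>, both terms are covered by
  \<open>(3 + 2 * A) * sqrt \<delta>\<close>. Young with weight \<open>r = n^(1/4)\<close> balances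
  \<open>r * \<delta>\<close>, which is of order \<open>W / r\<close>, against
  \<open>(3 + 2 * A)\<^sup>2 / r\<close>. The logarithm \<open>A\<close> is split into half of
  \<open>ln n\<close> and a part \<open>y\<close> free of \<open>n\<close>.\<close>

lemma entropy_bound_arith:
  fixes \<delta> V J0 W :: real
  assumes n: "4 \<le> n" and J0: "0 \<le> J0" and V: "0 \<le> V" "V ^ 3 \<le> 64 * W" and W: "0 \<le> W"
    and \<delta>: "0 \<le> \<delta>" "\<delta> \<le> 2" "\<delta> \<le> 1500000 * W / sqrt (real n)"
  shows "(1 + ln (1 + sqrt (real n * J0) * sqrt (2 * pi * V))) * \<delta> + sqrt \<delta>
    \<le> 3000000 * real n powr (- 1 / 4) * (W + J0 ^ 3 + (3 + ln (real n))\<^sup>2)"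
proof -
  define A where "A = ln (1 + sqrt (real n * J0) * sqrt (2 * pi * V))"
  define r where "r = real n powr (1 / 4)"
  have n0: "0 < real n" "1 \<le> real n" using n by auto
  have r: "0 < r" "r * r = sqrt (real n)" "real n powr (- 1 / 4) = 1 / r"
    using n0 by (auto simp: r_def powr_add[symmetric] powr_half_sqrt powr_minus_divide)
  define y where "y = sqrt (2 * pi * J0 * V)"
  have y: "0 \<le> y" using J0 V by (simp add: y_def)
  have A0: "0 \<le> A" unfolding A_def using J0 V by simp
  have "A \<le> ln (sqrt (real n) * (1 + y))"
  proof -
    have "sqrt (real n * J0) * sqrt (2 * pi * V) = sqrt (real n) * y"
      by (simp add: y_def real_sqrt_mult)
    moreover have "1 \<le> sqrt (real n)" using n0 by simp
    ultimately show ?thesis unfolding A_def using y by (intro ln_mono) (auto simp: distrib_left add_pos_nonneg)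
  qed
  also have "\<dots> = ln (sqrt (real n)) + ln (1 + y)" using n0 y by (subst ln_mult) auto
  also have "ln (sqrt (real n)) = ln (real n) / 2" using n0 by (simp add: ln_sqrt)
  also have "ln (1 + y) \<le> y" using y by (rule ln_add_one_self_le_self)
  finally have A1: "A \<le> ln (real n) / 2 + y" by simp
  define L where "L = 3 + ln (real n)"
  have L: "3 \<le> L" using n0 by (simp add: L_def)
  have "(3 + 2 * A)\<^sup>2 \<le> (L + 2 * y)\<^sup>2" using A1 A0 by (intro power_mono) (auto simp: L_def)
  also have "\<dots> \<le> 2 * L\<^sup>2 + 8 * y\<^sup>2" using sum_squares_bound[of L "2 * y"] by (simp add: power2_sum power_mult_distrib)
  also have "y\<^sup>2 = 2 * pi * (J0 * V)" unfolding y_def using J0 V by simp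
  also have "2 * pi * (J0 * V) \<le> 4 * (J0\<^sup>2 + V\<^sup>2)"
  proof -
    have "2 * (J0 * V) \<le> J0\<^sup>2 + V\<^sup>2" using sum_squares_bound[of J0 V] by (simp add: mult.assoc)
    then have "pi * (2 * (J0 * V)) \<le> pi * (J0\<^sup>2 + V\<^sup>2)" by (intro mult_left_mono) auto
    also have "\<dots> \<le> 4 * (J0\<^sup>2 + V\<^sup>2)" using pi_less_4 by (intro mult_right_mono) auto
    finally show ?thesis by (simp add: mult_ac)
  qed
  \<comment> \<open>The squares coming from \<open>y\<^sup>2\<close> are exchanged for cubes, whose
    expectations are the ones available.\<close>
  also have "J0\<^sup>2 \<le> 1 + J0 ^ 3" using power_le_one_plus[of 2 3 J0] J0 by simp
  also have "V\<^sup>2 \<le> 1 + 64 * W" using power_le_one_plus[of 2 3 V] V by simp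
  finally have A2: "(3 + 2 * A)\<^sup>2 \<le> 2 * L\<^sup>2 + 8 * (4 * ((1 + J0 ^ 3) + (1 + 64 * W)))" by simp
  have L9: "9 \<le> L\<^sup>2" using power_mono[OF L, of 2] by simp
  have "\<delta> = sqrt \<delta> * sqrt \<delta>" using \<delta> by simp
  also have "\<dots> \<le> 2 * sqrt \<delta>"
  proof (rule mult_right_mono)
    have "sqrt \<delta> \<le> sqrt 4" using \<delta> by (intro real_sqrt_le_mono) simp
    then show "sqrt \<delta> \<le> 2" by simp
  qed (use \<delta> in simp)
  finally have d2: "\<delta> \<le> 2 * sqrt \<delta>" .
  have "(1 + A) * \<delta> + sqrt \<delta> \<le> (1 + A) * (2 * sqrt \<delta>) + sqrt \<delta>"
    using d2 A0 by (intro add_right_mono mult_left_mono) auto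
  also have "\<dots> = (3 + 2 * A) * sqrt \<delta>" by (simp add: algebra_simps)
  also have "\<dots> \<le> (r * \<delta> + (3 + 2 * A)\<^sup>2 / r) / 2"
  proof -
    have "2 * (r * sqrt \<delta>) * (3 + 2 * A) \<le> (r * sqrt \<delta>)\<^sup>2 + (3 + 2 * A)\<^sup>2" by (rule sum_squares_bound)
    also have "(r * sqrt \<delta>)\<^sup>2 = r * (r * \<delta>)" using \<delta> by (simp add: power_mult_distrib power2_eq_square)
    finally have "r * (2 * ((3 + 2 * A) * sqrt \<delta>)) \<le> r * (r * \<delta> + (3 + 2 * A)\<^sup>2 / r)"
      using r by (simp add: distrib_left mult_ac)
    then have "2 * ((3 + 2 * A) * sqrt \<delta>) \<le> r * \<delta> + (3 + 2 * A)\<^sup>2 / r" using r(1) by (simp only: mult_le_cancel_left_pos)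
    then show ?thesis by simp
  qed
  also have "r * \<delta> \<le> 1500000 * W / r"
  proof -
    have "r * \<delta> \<le> r * (1500000 * W / (r * r))" using \<delta>(3) r by (intro mult_left_mono) auto
    then show ?thesis using r(1) by simp
  qed
  finally have "(1 + A) * \<delta> + sqrt \<delta> \<le> (1500000 * W / r + (3 + 2 * A)\<^sup>2 / r) / 2" by simp
  also have "\<dots> = (1 / r) * ((1500000 * W + (3 + 2 * A)\<^sup>2) / 2)" by (simp add: add_divide_distrib)
  also have "\<dots> \<le> (1 / r) * (3000000 * (W + J0 ^ 3 + L\<^sup>2))"
  proof (rule mult_left_mono)
    define X where "X = J0 ^ 3"
    have "0 \<le> X" using J0 by (simp add: X_def)
    moreover have "(1500000 * W + S) / 2 \<le> 3000000 * (W + X + Q)"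
      if "0 \<le> X" "S \<le> 2 * Q + 8 * (4 * (1 + X + (1 + 64 * W)))" "9 \<le> Q" for S Q X
      using that W by (simp add: algebra_simps)
    ultimately have "(1500000 * W + (3 + 2 * A)\<^sup>2) / 2 \<le> 3000000 * (W + X + L\<^sup>2)"
      using A2[folded X_def] L9 by blast
    then show "(1500000 * W + (3 + 2 * A)\<^sup>2) / 2 \<le> 3000000 * (W + J0 ^ 3 + L\<^sup>2)"
      unfolding X_def .
  qed (use r in simp)
  finally show ?thesis unfolding A_def[symmetric] L_def[symmetric] r(3) by simp
qed

text \<open>The result for frozen conditioning values: \<open>f j\<close> stands for the conditional
  density of summand \<open>j\<close>. The separate term in \<open>J 0\<close> comes from the
  logarithm of the height of \<open>q\<close>, for which summand 0 is used.\<close>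

theorem normalized_sum_gauss_KL_le:
  fixes f f' :: "nat \<Rightarrow> real \<Rightarrow> real" and J :: "nat \<Rightarrow> real" and q :: "real \<Rightarrow> real"
  assumes n: "4 \<le> n" and fd: "\<And>j. fisher_density (f j) (f' j) (J j)"
    and i6: "\<And>j. integrable (density lborel (f j)) (\<lambda>x. x ^ 6)"
    and qm[measurable]: "q \<in> borel_measurable borel" and q0: "\<And>x. 0 \<le> q x"
    and law: "distr (Pi\<^sub>M {..<n} (\<lambda>j. density lborel (f j))) borel (\<lambda>x. (\<Sum>j<n. x j) / sqrt (real n)) = density lborel q"
  shows "gauss_KL q \<le> ennreal (3000000 * real n powr (- 1 / 4) *
    ((\<Sum>j<n. J j ^ 3 + (\<integral>x. x ^ 6 \<partial>density lborel (f j))) / real n + J 0 ^ 3 + (3 + ln (real n))\<^sup>2))"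
proof -
  define \<kappa> where "\<kappa> j = density lborel (f j)" for j
  define c where "c j = (\<integral>x. x ^ 6 \<partial>\<kappa> j)" for j
  define \<mu> where "\<mu> j = (\<integral>x. x \<partial>\<kappa> j)" for j
  define v where "v j = (\<integral>x. (x - \<mu> j)\<^sup>2 \<partial>\<kappa> j)" for j
  define r where "r = sqrt (real n)"
  have n0: "0 < n" and r: "0 < r" using n by (auto simp: r_def)
  have pr: "prob_space (\<kappa> j)" and st: "sets (\<kappa> j) = sets borel" for j
    using fisher_density.prob_law[OF fd[of j]] unfolding \<kappa>_def fisher_density.law_def[OF fd[of j]] by auto
  have Jp: "0 < J j" for j by (rule fisher_density.J_pos[OF fd])
  note mom = sixth_moment_bounds[OF pr st i6[folded \<kappa>_def], folded \<mu>_def c_def, folded v_def]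
  have vJ: "1 / (32 * J j) \<le> v j" for j
    using fisher_density.second_moment_ge[OF fd[of j], of "\<mu> j"] mom(2)[of j]
    unfolding fisher_density.law_def[OF fd[of j]] v_def \<kappa>_def by simp
  have vp: "0 < v j" for j
  proof -
    have "0 < 1 / (32 * J j)" using Jp[of j] by simp
    then show ?thesis using vJ[of j] by linarith
  qed
  define \<sigma> where "\<sigma> j = sqrt (v j)" for j
  have \<sigma>: "0 < \<sigma> j" "(\<sigma> j)\<^sup>2 = v j" for j using vp[of j] by (auto simp: \<sigma>_def)
  define \<gamma> where "\<gamma> j = density lborel (normal_density (\<mu> j) (\<sigma> j))" for j
  have mom\<gamma>: "integrable (\<gamma> j) (\<lambda>x. \<bar>x - \<mu> j\<bar> ^ 3)" "(\<integral>x. \<bar>x - \<mu> j\<bar> ^ 3 \<partial>\<gamma> j) \<le> 2 * \<sigma> j ^ 3"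
    "(\<integral>x. x - \<mu> j \<partial>\<gamma> j) = 0" "(\<integral>x. (x - \<mu> j)\<^sup>2 \<partial>\<gamma> j) = (\<sigma> j)\<^sup>2" for j
    unfolding \<gamma>_def by (rule normal_law_moments[OF \<sigma>(1)])+
  \<comment> \<open>The constant 32 is spent here in order to share one bound with the Gaussian,
    whose information \<open>1 / v j\<close> is at most \<open>32 * J j\<close>.\<close>
  have sc\<kappa>: "scored_law (\<kappa> j) (32 * J j)" for j
    unfolding \<kappa>_def using Jp[of j] by (intro fisher_density.scored_law[OF fd]) simp
  have sc\<gamma>: "scored_law (\<gamma> j) (32 * J j)" for j
    unfolding \<gamma>_def
  proof (rule fisher_density.scored_law[OF fisher_density_normal[OF \<sigma>(1)]])
    show "1 / (\<sigma> j)\<^sup>2 \<le> 32 * J j" unfolding \<sigma>(2) using vJ[of j] vp[of j] Jp[of j] by (simp add: field_simps)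
  qed
  interpret P: prob_space "Pi\<^sub>M {..<n} \<kappa>" by (rule prob_space_PiM) (rule pr)
  interpret K: real_laws \<kappa>
    unfolding real_laws_def real_laws_axioms_def product_sigma_finite_def
    using pr st prob_space_imp_sigma_finite by blast
  have Sm[measurable]: "(\<lambda>x. \<Sum>j<n. x j) \<in> borel_measurable (Pi\<^sub>M {..<n} \<kappa>)" by (rule K.measurable_coord_sum) simp
  have law': "distr (Pi\<^sub>M {..<n} \<kappa>) borel (\<lambda>x. (\<Sum>j<n. x j) / r) = density lborel q"
    using law unfolding \<kappa>_def r_def .
  have Qint: "(\<integral>x. g x * q x \<partial>lborel) = (\<integral>x. g ((\<Sum>j<n. x j) / r) \<partial>Pi\<^sub>M {..<n} \<kappa>)"
    and Qi: "integrable lborel (\<lambda>x. g x * q x) \<longleftrightarrow> integrable (Pi\<^sub>M {..<n} \<kappa>) (\<lambda>x. g ((\<Sum>j<n. x j) / r))"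
    if [measurable]: "g \<in> borel_measurable borel" for g :: "real \<Rightarrow> real"
  proof -
    have "(\<integral>x. g x * q x \<partial>lborel) = (\<integral>x. g x \<partial>density lborel q)" using q0 by (subst integral_density) (auto simp: mult.commute)
    then show "(\<integral>x. g x * q x \<partial>lborel) = (\<integral>x. g ((\<Sum>j<n. x j) / r) \<partial>Pi\<^sub>M {..<n} \<kappa>)"
      unfolding law'[symmetric] by (simp add: integral_distr)
    have "integrable lborel (\<lambda>x. g x * q x) \<longleftrightarrow> integrable (density lborel q) g" using q0 by (subst integrable_density) (auto simp: mult.commute)
    then show "integrable lborel (\<lambda>x. g x * q x) \<longleftrightarrow> integrable (Pi\<^sub>M {..<n} \<kappa>) (\<lambda>x. g ((\<Sum>j<n. x j) / r))"
      unfolding law'[symmetric] by (simp add: integrable_distr_eq)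
  qed
  have coord: "integrable (Pi\<^sub>M {..<n} \<kappa>) (\<lambda>x. x j - \<mu> j)" "(\<integral>x. x j - \<mu> j \<partial>Pi\<^sub>M {..<n} \<kappa>) = 0" if "j < n" for j
  proof -
    have cm: "(\<lambda>x. x j) \<in> measurable (Pi\<^sub>M {..<n} \<kappa>) (\<kappa> j)" using that by (intro measurable_component_singleton) auto
    have e: "distr (Pi\<^sub>M {..<n} \<kappa>) (\<kappa> j) (\<lambda>x. x j) = \<kappa> j" by (rule distr_PiM_component) (use pr that in auto)
    have m: "(\<lambda>x. x - \<mu> j) \<in> borel_measurable (\<kappa> j)" using st[of j] by (simp cong: measurable_cong_sets)
    interpret Kj: prob_space "\<kappa> j" by (rule pr)
    have "integrable (\<kappa> j) (\<lambda>x. x - \<mu> j)" using mom(1)[of j] by simp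
    then show "integrable (Pi\<^sub>M {..<n} \<kappa>) (\<lambda>x. x j - \<mu> j)" using integrable_distr_eq[OF cm m] unfolding e by simp
    have "(\<integral>x. x - \<mu> j \<partial>\<kappa> j) = 0" using mom(1)[of j] by (simp add: \<mu>_def Kj.prob_space)
    then show "(\<integral>x. x j - \<mu> j \<partial>Pi\<^sub>M {..<n} \<kappa>) = 0" using integral_distr[OF cm m] unfolding e by simp
  qed
  have cen: "integrable (\<kappa> j) (\<lambda>x. x - \<mu> j)" "(\<integral>x. x - \<mu> j \<partial>\<kappa> j) = 0" for j
  proof -
    interpret Kj: prob_space "\<kappa> j" by (rule pr)
    show "integrable (\<kappa> j) (\<lambda>x. x - \<mu> j)" "(\<integral>x. x - \<mu> j \<partial>\<kappa> j) = 0"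
      using mom(1)[of j] by (auto simp: \<mu>_def Kj.prob_space)
  qed
  define m where "m = (\<Sum>j<n. \<mu> j) / r"
  define V where "V = (\<Sum>j<n. v j) / real n"
  define Z where "Z x = (\<Sum>j<n. x j - \<mu> j)" for x :: "nat \<Rightarrow> real"
  have ZS: "(\<Sum>j<n. x j) / r = Z x / r + m" for x unfolding Z_def m_def by (simp add: sum_subtractf diff_divide_distrib)
  note orth = PiM_orthogonal_sum[of "{..<n}" \<kappa> "\<lambda>j x. x - \<mu> j", OF finite_lessThan pr cen mom(2), folded Z_def v_def]
  have Zi: "integrable (Pi\<^sub>M {..<n} \<kappa>) Z" "(\<integral>x. Z x \<partial>Pi\<^sub>M {..<n} \<kappa>) = 0"
    unfolding Z_def using coord by (auto simp: Bochner_Integration.integral_sum)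
  have mean: "dens_mean q = m"
    unfolding dens_mean_def using Qint[of "\<lambda>x. x"] Zi by (simp add: ZS P.prob_space)
  have Zr: "(Z x / r)\<^sup>2 = (Z x)\<^sup>2 / real n" for x by (simp add: power_divide r_def)
  have var: "dens_var q = V"
    unfolding dens_var_def mean using Qint[of "\<lambda>x. (x - m)\<^sup>2"] orth(3) by (simp add: ZS Zr V_def)
  have iq2: "integrable lborel (\<lambda>x. (x - dens_mean q)\<^sup>2 * q x)"
    unfolding mean using Qi[of "\<lambda>x. (x - m)\<^sup>2"] orth(2) by (simp add: ZS Zr)
  have iq: "integrable lborel q" and q1: "(\<integral>x. q x \<partial>lborel) = 1"
    using Qi[of "\<lambda>_. 1"] Qint[of "\<lambda>_. 1"] by (auto simp: P.prob_space)
  have Vp: "0 < V" unfolding V_def using n0 vp by (intro divide_pos_pos sum_pos) (auto simp: lessThan_empty_iff)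
  define g where "g = normal_density m (sqrt V)"
  have gm[measurable]: "g \<in> borel_measurable borel" unfolding g_def by simp
  have ig: "integrable lborel g" "(\<integral>x. g x \<partial>lborel) = 1" "\<And>x. 0 \<le> g x"
    unfolding g_def using integrable_normal_density Vp by auto
  define \<delta> where "\<delta> = (\<integral>x. \<bar>q x - g x\<bar> \<partial>lborel)"
  \<comment> \<open>This sign attains the L1 distance, so the comparison of expectations is an exact
    evaluation of \<delta>. It is in general discontinuous.\<close>
  define h where "h x = sgn (q x - g x)" for x
  have hm[measurable]: "h \<in> borel_measurable borel" unfolding h_def by measurable
  have hb: "\<bar>h x\<bar> \<le> 1" for x unfolding h_def by (simp add: sgn_real_def)
  have ih: "integrable lborel (\<lambda>x. h x * q x)" "integrable lborel (\<lambda>x. g x * h x)"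
    by (rule Bochner_Integration.integrable_bound[OF iq], measurable, use hb q0 in \<open>auto simp: abs_mult intro!: mult_left_le_one_le\<close>)
       (rule Bochner_Integration.integrable_bound[OF ig(1)], measurable, use hb ig in \<open>auto simp: abs_mult intro!: mult_right_le_one_le\<close>)
  have "\<delta> = (\<integral>x. h x * q x - g x * h x \<partial>lborel)"
    unfolding \<delta>_def by (intro Bochner_Integration.integral_cong) (auto simp: h_def abs_sgn algebra_simps)
  also have "\<dots> = (\<integral>x. h x * q x \<partial>lborel) - (\<integral>x. g x * h x \<partial>lborel)" using ih by simp
  also have "(\<integral>x. h x * q x \<partial>lborel) = (\<integral>x. h ((\<Sum>j<n. x j) / r) \<partial>Pi\<^sub>M {..<n} \<kappa>)" by (rule Qint[OF hm])
  also have "(\<integral>x. g x * h x \<partial>lborel) = (\<integral>x. h ((\<Sum>j<n. x j) / r) \<partial>Pi\<^sub>M {..<n} \<gamma>)"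
    unfolding \<gamma>_def r_def using integral_normal_product[OF n0 \<sigma>(1) hm, of \<mu>] by (simp add: g_def m_def V_def r_def \<sigma>(2))
  finally have "\<delta> = (\<integral>x. h ((\<Sum>j<n. x j) / r) \<partial>Pi\<^sub>M {..<n} \<kappa>) - (\<integral>x. h ((\<Sum>j<n. x j) / r) \<partial>Pi\<^sub>M {..<n} \<gamma>)" .
  also have "\<dots> \<le> (sqrt (\<Sum>j<n. 32 * J j) / real (n div 4)) ^ 3 * (\<Sum>j<n. (\<integral>x. \<bar>x - \<mu> j\<bar> ^ 3 \<partial>\<kappa> j) + (\<integral>x. \<bar>x - \<mu> j\<bar> ^ 3 \<partial>\<gamma> j))"
  proof (rule order_trans[OF abs_ge_self], rule lindeberg_total_variation[where h = "\<lambda>z. h (z / r)", OF n sc\<kappa> sc\<gamma> mom(3) mom\<gamma>(1)])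
    show "(\<integral>x. x - \<mu> j \<partial>\<kappa> j) = (\<integral>x. x - \<mu> j \<partial>\<gamma> j)" for j using cen(2) mom\<gamma>(3) by simp
    show "(\<integral>x. (x - \<mu> j)\<^sup>2 \<partial>\<kappa> j) = (\<integral>x. (x - \<mu> j)\<^sup>2 \<partial>\<gamma> j)" for j using mom\<gamma>(4)[of j] \<sigma>(2)[of j] by (simp add: v_def)
    show "0 \<le> 32 * J j" for j using Jp[of j] by simp
  qed (use hb in auto)
  also have "\<dots> \<le> 1500000 * ((\<Sum>j<n. J j ^ 3 + c j) / real n) / sqrt (real n)"
  proof (rule lindeberg_error_le[OF n])
    fix j
    show "0 \<le> J j" using Jp[of j] by simp
    show "0 \<le> c j" by (rule mom(4))
    show "0 \<le> (\<integral>x. \<bar>x - \<mu> j\<bar> ^ 3 \<partial>\<kappa> j) + (\<integral>x. \<bar>x - \<mu> j\<bar> ^ 3 \<partial>\<gamma> j)" by simp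
    \<comment> \<open>The original law contributes \<open>8 * sqrt (c j)\<close> and the Gaussian
      twice that, whence 24.\<close>
    have "(\<sigma> j ^ 3)\<^sup>2 = v j ^ 3" unfolding \<sigma>(2)[symmetric] by (simp flip: power_mult)
    then have "\<sigma> j ^ 3 \<le> sqrt (64 * c j)" using mom(6)[of j] by (intro real_le_rsqrt) simp
    moreover have "sqrt (64 * c j) = 8 * sqrt (c j)" using real_sqrt_mult[of "8\<^sup>2" "c j"] by simp
    ultimately show "(\<integral>x. \<bar>x - \<mu> j\<bar> ^ 3 \<partial>\<kappa> j) + (\<integral>x. \<bar>x - \<mu> j\<bar> ^ 3 \<partial>\<gamma> j) \<le> 24 * sqrt (c j)"
      using mom(7)[of j] mom\<gamma>(2)[of j] by linarith
  qed
  finally have \<delta>W: "\<delta> \<le> 1500000 * ((\<Sum>j<n. J j ^ 3 + c j) / real n) / sqrt (real n)" .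
  define W where "W = (\<Sum>j<n. J j ^ 3 + c j) / real n"
  have W0: "0 \<le> W" unfolding W_def using Jp mom(4) by (intro divide_nonneg_nonneg sum_nonneg add_nonneg_nonneg) (auto simp: less_imp_le)
  have \<delta>0: "0 \<le> \<delta>" unfolding \<delta>_def by simp
  have "\<delta> \<le> (\<integral>x. q x + g x \<partial>lborel)" unfolding \<delta>_def
    by (rule integral_mono) (use iq ig q0 in \<open>auto simp: abs_le_iff intro: order_trans[OF _ add_increasing]\<close>)
  then have \<delta>2: "\<delta> \<le> 2" using iq ig q1 by simp
  have V3: "V ^ 3 \<le> 64 * W"
  proof -
    have "V ^ 3 \<le> (\<Sum>j<n. v j ^ 3) / real n" unfolding V_def by (rule mean_cube_le) (use n0 vp in \<open>auto simp: less_imp_le\<close>)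
    also have "\<dots> \<le> (\<Sum>j<n. 64 * (J j ^ 3 + c j)) / real n"
    proof (intro divide_right_mono sum_mono)
      fix j
      have "0 < J j ^ 3" using Jp[of j] by simp
      then have "64 * c j \<le> 64 * (J j ^ 3 + c j)" by (intro mult_left_mono) auto
      then show "v j ^ 3 \<le> 64 * (J j ^ 3 + c j)" using mom(6)[of j] by (rule order_trans[rotated])
    qed simp
    finally show ?thesis unfolding W_def by (simp only: sum_distrib_left[symmetric] times_divide_eq_right)
  qed
  have M: "0 < sqrt (real n * J 0)" using n0 Jp[of 0] by simp
  have qM: "AE x in lborel. q x \<le> sqrt (real n * J 0)"
  proof (rule AE_density_le[OF qm M])
    have "emeasure (density lborel q) UNIV = 1"
      unfolding law'[symmetric] using P.emeasure_space_1 by (subst emeasure_distr) auto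
    then show "emeasure (density lborel q) UNIV < \<infinity>" by simp
    show "emeasure (density lborel q) A \<le> ennreal (sqrt (real n * J 0)) * emeasure lborel A" if "A \<in> sets borel" for A
      unfolding law'[symmetric] r_def by (rule normalized_sum_law_le[OF n0 pr st fd[of 0] _ that]) (simp add: \<kappa>_def)
  qed
  have "gauss_KL q \<le> ennreal ((1 + ln (1 + sqrt (real n * J 0) * sqrt (2 * pi * dens_var q))) * \<delta> + sqrt \<delta>)"
    by (rule gauss_KL_le[OF qm q0 qM iq iq2]) (use Vp M in \<open>auto simp: mean var \<delta>_def g_def less_imp_le\<close>)
  also have "\<dots> \<le> ennreal (3000000 * real n powr (- 1 / 4) * (W + J 0 ^ 3 + (3 + ln (real n))\<^sup>2))"
    unfolding var
    by (intro ennreal_leI entropy_bound_arith[OF n _ _ V3 W0 \<delta>0 \<delta>2]) (use Jp[of 0] Vp \<delta>W in \<open>auto simp: W_def less_imp_le\<close>)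
  finally show ?thesis unfolding W_def c_def \<kappa>_def .
qed

section \<open>Conditional laws of the normalized sum\<close>

lemma emeasure_density_pair_rectangle:
  fixes q :: "'b \<Rightarrow> real \<Rightarrow> real"
  assumes sn: "sets \<nu> = sets N" and [measurable]: "(\<lambda>(w, x). q w x) \<in> borel_measurable (N \<Otimes>\<^sub>M borel)"
    and B: "B \<in> sets N" and A: "A \<in> sets borel"
  shows "emeasure (density (\<nu> \<Otimes>\<^sub>M lborel) (\<lambda>(w, x). ennreal (q w x))) (B \<times> A)
    = (\<integral>\<^sup>+w. indicator B w * (\<integral>\<^sup>+x. ennreal (q w x) * indicator A x \<partial>lborel) \<partial>\<nu>)"
proof -
  have [measurable_cong]: "sets \<nu> = sets N" by (rule sn)
  have [measurable]: "B \<in> sets \<nu>" "A \<in> sets lborel" using B A sn by auto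
  have "emeasure (density (\<nu> \<Otimes>\<^sub>M lborel) (\<lambda>(w, x). ennreal (q w x))) (B \<times> A)
    = (\<integral>\<^sup>+v. (case v of (w, x) \<Rightarrow> ennreal (q w x)) * indicator (B \<times> A) v \<partial>(\<nu> \<Otimes>\<^sub>M lborel))"
    by (rule emeasure_density) measurable
  also have "\<dots> = (\<integral>\<^sup>+w. \<integral>\<^sup>+x. ennreal (q w x) * indicator (B \<times> A) (w, x) \<partial>lborel \<partial>\<nu>)"
    by (subst lborel.nn_integral_fst[symmetric]) (auto simp: case_prod_beta)
  also have "\<dots> = (\<integral>\<^sup>+w. indicator B w * (\<integral>\<^sup>+x. ennreal (q w x) * indicator A x \<partial>lborel) \<partial>\<nu>)"
    by (intro nn_integral_cong) (auto simp: indicator_def)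
  finally show ?thesis .
qed

text \<open>Rectangles are an intersection-stable generator, so the defining equations say that the
  joint law has density \<open>q\<close> with respect to the law of \<open>W\<close> times Lebesgue
  measure. In this form Tonelli and Radon-Nikodym apply.\<close>

lemma cond_density_iff_distr:
  assumes "prob_space M" and Z[measurable]: "Z \<in> borel_measurable M" and W[measurable]: "W \<in> measurable M N"
  shows "cond_density M Z W N q \<longleftrightarrow> (\<lambda>(w, x). q w x) \<in> borel_measurable (N \<Otimes>\<^sub>M borel) \<and> (\<forall>w x. 0 \<le> q w x) \<and>
    distr M (N \<Otimes>\<^sub>M borel) (\<lambda>\<omega>. (W \<omega>, Z \<omega>)) = density (distr M N W \<Otimes>\<^sub>M lborel) (\<lambda>(w, x). ennreal (q w x))"
    (is "_ \<longleftrightarrow> ?m \<and> ?p \<and> ?L = ?R")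
proof -
  interpret prob_space M by fact
  have L: "emeasure ?L (B \<times> A) = emeasure M {\<omega>\<in>space M. Z \<omega> \<in> A \<and> W \<omega> \<in> B}" if "B \<in> sets N" "A \<in> sets borel" for A B
    using that by (subst emeasure_distr) (auto intro!: arg_cong[where f="emeasure M"])
  show ?thesis
  proof
    assume c: "cond_density M Z W N q"
    then have m: ?m and p: ?p unfolding cond_density_def by auto
    have "?L = ?R"
    proof (rule measure_eqI_generator_eq[OF Int_stable_pair_measure_generator[of N borel]])
      show "{a \<times> b |a b. a \<in> sets N \<and> b \<in> sets borel} \<subseteq> Pow (space N \<times> space borel)"
        using sets.sets_into_space by auto
      show "sets ?L = sigma_sets (space N \<times> space borel) {a \<times> b |a b. a \<in> sets N \<and> b \<in> sets (borel :: real measure)}"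
        by (simp add: sets_pair_measure)
      show "sets ?R = sigma_sets (space N \<times> space borel) {a \<times> b |a b. a \<in> sets N \<and> b \<in> sets (borel :: real measure)}"
        by (simp add: sets_pair_measure)
      show "range (\<lambda>_::nat. space N \<times> (UNIV :: real set)) \<subseteq> {a \<times> b |a b. a \<in> sets N \<and> b \<in> sets borel}"
        by (rule image_subsetI, rule CollectI, rule exI[of _ "space N"], rule exI[of _ UNIV]) simp
      show "(\<Union>i::nat. space N \<times> UNIV) = space N \<times> space (borel :: real measure)" by auto
      show "emeasure ?L (space N \<times> UNIV) \<noteq> \<infinity>" by (subst L) auto
      fix E assume "E \<in> {a \<times> b |a b. a \<in> sets N \<and> b \<in> sets (borel :: real measure)}"
      then obtain B A where E: "E = B \<times> A" "B \<in> sets N" "A \<in> sets borel" by auto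
      show "emeasure ?L E = emeasure ?R E"
        unfolding E(1) L[OF E(2,3)] using c E m unfolding cond_density_def
        by (subst emeasure_density_pair_rectangle[OF _ m E(2,3)]) auto
    qed
    with m p show "?m \<and> ?p \<and> ?L = ?R" by blast
  next
    assume *: "?m \<and> ?p \<and> ?L = ?R"
    have "emeasure M {\<omega>\<in>space M. Z \<omega> \<in> A \<and> W \<omega> \<in> B}
        = (\<integral>\<^sup>+ w. indicator B w * (\<integral>\<^sup>+ x. ennreal (q w x) * indicator A x \<partial>lborel) \<partial>distr M N W)"
      if "A \<in> sets borel" "B \<in> sets N" for A B
      unfolding L[OF that(2,1), symmetric] using * that by (simp add: emeasure_density_pair_rectangle)
    then show "cond_density M Z W N q" using * unfolding cond_density_def by blast
  qed
qed

lemma density_PiM: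
  fixes f :: "'i \<Rightarrow> real \<Rightarrow> real"
  assumes fin: "finite I" and fm[measurable]: "\<And>i. f i \<in> borel_measurable borel"
    and f1: "\<And>i. (\<integral>\<^sup>+x. ennreal (f i x) \<partial>lborel) = 1"
  shows "density (Pi\<^sub>M I (\<lambda>_. lborel)) (\<lambda>x. \<Prod>i\<in>I. ennreal (f i (x i))) = Pi\<^sub>M I (\<lambda>i. density lborel (f i))"
proof -
  have pr: "prob_space (density lborel (f i))" for i
    by (rule prob_spaceI) (simp add: emeasure_density f1)
  interpret D: product_sigma_finite "\<lambda>i. density lborel (f i)"
    unfolding product_sigma_finite_def using pr prob_space_imp_sigma_finite by blast
  interpret L: product_sigma_finite "\<lambda>i::'i. lborel :: real measure"
    unfolding product_sigma_finite_def using sigma_finite_lborel by blast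
  have [measurable]: "(\<lambda>x. \<Prod>i\<in>I. ennreal (f i (x i))) \<in> borel_measurable (Pi\<^sub>M I (\<lambda>_. lborel))"
    by (intro borel_measurable_prod_ennreal) measurable
  show ?thesis
  proof (rule D.PiM_eqI[OF fin])
    show "sets (density (Pi\<^sub>M I (\<lambda>_. lborel)) (\<lambda>x. \<Prod>i\<in>I. ennreal (f i (x i)))) = sets (Pi\<^sub>M I (\<lambda>i. density lborel (f i)))"
      by (simp cong: sets_PiM_cong)
    fix A assume A: "\<And>i. i \<in> I \<Longrightarrow> A i \<in> sets (density lborel (f i))"
    then have A': "A i \<in> sets borel" if "i \<in> I" for i using that by simp
    have AP: "Pi\<^sub>E I A \<in> sets (Pi\<^sub>M I (\<lambda>_. lborel))" using A' fin by (intro sets_PiM_I_finite) auto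
    have "emeasure (density (Pi\<^sub>M I (\<lambda>_. lborel)) (\<lambda>x. \<Prod>i\<in>I. ennreal (f i (x i)))) (Pi\<^sub>E I A)
      = (\<integral>\<^sup>+x. (\<Prod>i\<in>I. ennreal (f i (x i))) * indicator (Pi\<^sub>E I A) x \<partial>Pi\<^sub>M I (\<lambda>_. lborel))"
      by (rule emeasure_density) (use AP in auto)
    also have "\<dots> = (\<integral>\<^sup>+x. (\<Prod>i\<in>I. ennreal (f i (x i)) * indicator (A i) (x i)) \<partial>Pi\<^sub>M I (\<lambda>_. lborel))"
    proof (rule nn_integral_cong)
      fix x assume "x \<in> space (Pi\<^sub>M I (\<lambda>_. lborel :: real measure))"
      then have "indicator (Pi\<^sub>E I A) x = (\<Prod>i\<in>I. indicator (A i) (x i) :: ennreal)"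
        using fin by (auto simp: indicator_def space_PiM PiE_def Pi_def prod_eq_1_iff intro!: prod_zero[symmetric])
      then show "(\<Prod>i\<in>I. ennreal (f i (x i))) * indicator (Pi\<^sub>E I A) x = (\<Prod>i\<in>I. ennreal (f i (x i)) * indicator (A i) (x i))"
        by (simp add: prod.distrib)
    qed
    also have "\<dots> = (\<Prod>i\<in>I. \<integral>\<^sup>+x. ennreal (f i x) * indicator (A i) x \<partial>lborel)"
      by (rule L.product_nn_integral_prod[OF fin]) (use A' in measurable)
    also have "\<dots> = (\<Prod>i\<in>I. emeasure (density lborel (f i)) (A i))"
      using A' by (intro prod.cong) (auto simp: emeasure_density)
    finally show "emeasure (density (Pi\<^sub>M I (\<lambda>_. lborel)) (\<lambda>x. \<Prod>i\<in>I. ennreal (f i (x i)))) (Pi\<^sub>E I A)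
      = (\<Prod>i\<in>I. emeasure (density lborel (f i)) (A i))" .
  qed
qed

text \<open>The values of \<open>Y\<close> lie in an arbitrary measurable space. The conditional law
  of \<open>X\<close> enters only through its density \<open>p\<close>, so no disintegration is
  invoked.\<close>

locale iid_conditional = prob_space M for M :: "'a measure" +
  fixes N :: "'b measure" and X :: "nat \<Rightarrow> 'a \<Rightarrow> real" and Y :: "nat \<Rightarrow> 'a \<Rightarrow> 'b" and p :: "'b \<Rightarrow> real \<Rightarrow> real"
  assumes X[measurable]: "\<And>i. X i \<in> borel_measurable M" and Y[measurable]: "\<And>i. Y i \<in> measurable M N"
    and indep: "indep_vars (\<lambda>_. borel \<Otimes>\<^sub>M N) (\<lambda>i \<omega>. (X i \<omega>, Y i \<omega>)) UNIV"
    and ident: "\<And>i. distr M (borel \<Otimes>\<^sub>M N) (\<lambda>\<omega>. (X i \<omega>, Y i \<omega>)) = distr M (borel \<Otimes>\<^sub>M N) (\<lambda>\<omega>. (X 0 \<omega>, Y 0 \<omega>))"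
    and p: "cond_density M (X 0) (Y 0) N p"
begin

definition \<nu> :: "'b measure" where "\<nu> = distr M N (Y 0)"

lemma sets_\<nu>[simp, measurable_cong]: "sets \<nu> = sets N" unfolding \<nu>_def by simp

lemma space_\<nu>[simp]: "space \<nu> = space N" unfolding \<nu>_def by simp

lemma prob_\<nu>: "prob_space \<nu>" unfolding \<nu>_def by (rule prob_space_distr[OF Y])

lemma p_meas[measurable]: "(\<lambda>(w, x). p w x) \<in> borel_measurable (N \<Otimes>\<^sub>M borel)" and p_nonneg: "0 \<le> p w x"
  using p unfolding cond_density_def by auto

lemma p_meas1: "y \<in> space N \<Longrightarrow> p y \<in> borel_measurable borel"
  using measurable_Pair2[OF p_meas, of y] by simp

lemma joint_law0:
  assumes [measurable]: "g \<in> borel_measurable (borel \<Otimes>\<^sub>M N)"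
  shows "(\<integral>\<^sup>+\<omega>. g (X 0 \<omega>, Y 0 \<omega>) \<partial>M) = (\<integral>\<^sup>+y. \<integral>\<^sup>+x. ennreal (p y x) * g (x, y) \<partial>lborel \<partial>\<nu>)"
proof -
  have eq: "distr M (N \<Otimes>\<^sub>M borel) (\<lambda>\<omega>. (Y 0 \<omega>, X 0 \<omega>)) = density (\<nu> \<Otimes>\<^sub>M lborel) (\<lambda>(w, x). ennreal (p w x))"
    using p cond_density_iff_distr[OF prob_space_axioms X Y, of 0 0 p] unfolding \<nu>_def by blast
  have "(\<integral>\<^sup>+\<omega>. g (X 0 \<omega>, Y 0 \<omega>) \<partial>M) = (\<integral>\<^sup>+v. g (snd v, fst v) \<partial>distr M (N \<Otimes>\<^sub>M borel) (\<lambda>\<omega>. (Y 0 \<omega>, X 0 \<omega>)))"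
    by (subst nn_integral_distr) auto
  also have "\<dots> = (\<integral>\<^sup>+v. (case v of (w, x) \<Rightarrow> ennreal (p w x)) * g (snd v, fst v) \<partial>(\<nu> \<Otimes>\<^sub>M lborel))"
    unfolding eq by (subst nn_integral_density) auto
  also have "\<dots> = (\<integral>\<^sup>+y. \<integral>\<^sup>+x. ennreal (p y x) * g (x, y) \<partial>lborel \<partial>\<nu>)"
    by (subst lborel.nn_integral_fst[symmetric]) auto
  finally show ?thesis .
qed

lemma AE_p_one: "AE y in \<nu>. (\<integral>\<^sup>+x. ennreal (p y x) \<partial>lborel) = 1"
proof -
  interpret V: prob_space \<nu> by (rule prob_\<nu>)
  have "AE y in \<nu>. (\<integral>\<^sup>+x. ennreal (p y x) \<partial>lborel) = (\<lambda>_. 1) y"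
  proof (rule V.density_unique)
    show "density \<nu> (\<lambda>y. \<integral>\<^sup>+x. ennreal (p y x) \<partial>lborel) = density \<nu> (\<lambda>_. 1)"
    proof (rule measure_eqI)
      fix B assume "B \<in> sets (density \<nu> (\<lambda>y. \<integral>\<^sup>+x. ennreal (p y x) \<partial>lborel))"
      then have B[measurable]: "B \<in> sets N" by simp
      have "emeasure \<nu> B = (\<integral>\<^sup>+\<omega>. indicator B (Y 0 \<omega>) \<partial>M)"
        unfolding \<nu>_def by (subst nn_integral_distr[of _ _ N, symmetric]) auto
      also have "\<dots> = (\<integral>\<^sup>+y. \<integral>\<^sup>+x. ennreal (p y x) * indicator B y \<partial>lborel \<partial>\<nu>)"
        using joint_law0[of "\<lambda>v. indicator B (snd v)"] by simp
      also have "\<dots> = (\<integral>\<^sup>+y. (\<integral>\<^sup>+x. ennreal (p y x) \<partial>lborel) * indicator B y \<partial>\<nu>)"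
        by (intro nn_integral_cong) (auto simp: indicator_def)
      finally show "emeasure (density \<nu> (\<lambda>y. \<integral>\<^sup>+x. ennreal (p y x) \<partial>lborel)) B = emeasure (density \<nu> (\<lambda>_. 1)) B"
        by (simp add: emeasure_density)
    qed simp
  qed auto
  then show ?thesis by simp
qed

section \<open>The joint law of all pairs and the law of the sum given the conditioning
  vector\<close>

definition \<nu>n :: "nat \<Rightarrow> (nat \<Rightarrow> 'b) measure" where "\<nu>n n = Pi\<^sub>M {..<n} (\<lambda>_. \<nu>)"

lemma sets_\<nu>n[simp, measurable_cong]: "sets (\<nu>n n) = sets (Pi\<^sub>M {..<n} (\<lambda>_. N))"
  unfolding \<nu>n_def by (rule sets_PiM_cong) auto

lemma space_\<nu>n[simp]: "space (\<nu>n n) = space (Pi\<^sub>M {..<n} (\<lambda>_. N))"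
  using sets_eq_imp_space_eq[OF sets_\<nu>n] .

lemma prob_\<nu>n: "prob_space (\<nu>n n)" unfolding \<nu>n_def by (rule prob_space_PiM) (rule prob_\<nu>)

lemma p_coord_meas[measurable]:
  "(\<lambda>v. \<Prod>i<n. ennreal (p (fst v i) (snd v i))) \<in> borel_measurable (Pi\<^sub>M {..<n} (\<lambda>_. N) \<Otimes>\<^sub>M Pi\<^sub>M {..<n} (\<lambda>_. borel))"
proof (rule borel_measurable_prod_ennreal)
  fix i assume i: "i \<in> {..<n}"
  have "(\<lambda>v. (fst v i, snd v i)) \<in> measurable (Pi\<^sub>M {..<n} (\<lambda>_. N) \<Otimes>\<^sub>M Pi\<^sub>M {..<n} (\<lambda>_. borel)) (N \<Otimes>\<^sub>M borel)"
    using i by measurable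
  from measurable_compose[OF this p_meas] show "(\<lambda>v. ennreal (p (fst v i) (snd v i))) \<in> borel_measurable (Pi\<^sub>M {..<n} (\<lambda>_. N) \<Otimes>\<^sub>M Pi\<^sub>M {..<n} (\<lambda>_. borel))"
    by simp
qed

lemma pairing_meas: "(\<lambda>v. \<lambda>i\<in>{..<n}. (snd v i, fst v i)) \<in> measurable (Pi\<^sub>M {..<n} (\<lambda>_. N) \<Otimes>\<^sub>M Pi\<^sub>M {..<n} (\<lambda>_. borel)) (Pi\<^sub>M {..<n} (\<lambda>_. borel \<Otimes>\<^sub>M N))"
  by (rule measurable_restrict) measurable

lemma sets_lborel_PiM: "sets (Pi\<^sub>M {..<n} (\<lambda>_. lborel :: real measure)) = sets (Pi\<^sub>M {..<n} (\<lambda>_. borel))"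
  by (rule sets_PiM_cong) auto

text \<open>Both sides are compared on boxes, where the integral factorizes over \<open>x\<close>
  for fixed \<open>w\<close> and again over \<open>w\<close>. The law is written over
  \<open>\<nu>n n\<close> times Lebesgue measure, reordered by the pairing map, to make the
  conditioning vector a component of its own.\<close>

lemma vector_law:
  assumes n: "0 < n"
  shows "distr M (Pi\<^sub>M {..<n} (\<lambda>_. borel \<Otimes>\<^sub>M N)) (\<lambda>\<omega>. \<lambda>i\<in>{..<n}. (X i \<omega>, Y i \<omega>))
    = distr (density (\<nu>n n \<Otimes>\<^sub>M Pi\<^sub>M {..<n} (\<lambda>_. lborel)) (\<lambda>v. \<Prod>i<n. ennreal (p (fst v i) (snd v i))))
       (Pi\<^sub>M {..<n} (\<lambda>_. borel \<Otimes>\<^sub>M N)) (\<lambda>v. \<lambda>i\<in>{..<n}. (snd v i, fst v i))" (is "_ = distr (density ?P ?d) ?S ?f")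
proof -
  define \<Lambda> where "\<Lambda> = distr M (borel \<Otimes>\<^sub>M N) (\<lambda>\<omega>. (X 0 \<omega>, Y 0 \<omega>))"
  have pr\<Lambda>: "prob_space \<Lambda>" unfolding \<Lambda>_def by (rule prob_space_distr) measurable
  have s\<Lambda>[simp]: "sets \<Lambda> = sets (borel \<Otimes>\<^sub>M N)" unfolding \<Lambda>_def by simp
  have "indep_vars (\<lambda>_. borel \<Otimes>\<^sub>M N) (\<lambda>i \<omega>. (X i \<omega>, Y i \<omega>)) {..<n}"
    by (rule indep_vars_subset[OF indep]) simp
  then have "distr M ?S (\<lambda>\<omega>. \<lambda>i\<in>{..<n}. (X i \<omega>, Y i \<omega>)) = Pi\<^sub>M {..<n} (\<lambda>i. distr M (borel \<Otimes>\<^sub>M N) (\<lambda>\<omega>. (X i \<omega>, Y i \<omega>)))"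
    by (subst (asm) indep_vars_iff_distr_eq_PiM') (use n in auto)
  also have "\<dots> = Pi\<^sub>M {..<n} (\<lambda>_. \<Lambda>)" unfolding \<Lambda>_def by (rule PiM_cong[OF refl]) (rule ident)
  also have "\<dots> = distr (density ?P ?d) ?S ?f"
  proof (rule product_sigma_finite.PiM_eqI[symmetric])
    show "product_sigma_finite (\<lambda>_::nat. \<Lambda>)"
      unfolding product_sigma_finite_def using prob_space_imp_sigma_finite[OF pr\<Lambda>] by blast
    show "sets (distr (density ?P ?d) ?S ?f) = sets (Pi\<^sub>M {..<n} (\<lambda>_. \<Lambda>))"
      by (simp cong: sets_PiM_cong)
    fix A assume "\<And>i. i \<in> {..<n} \<Longrightarrow> A i \<in> sets \<Lambda>"
    then have A: "A i \<in> sets (borel \<Otimes>\<^sub>M N)" if "i < n" for i using that by simp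
    interpret L: product_sigma_finite "\<lambda>i::nat. lborel :: real measure"
      unfolding product_sigma_finite_def using sigma_finite_lborel by blast
    interpret V: product_sigma_finite "\<lambda>i::nat. \<nu>"
      unfolding product_sigma_finite_def using prob_space_imp_sigma_finite[OF prob_\<nu>] by blast
    interpret Ln: sigma_finite_measure "Pi\<^sub>M {..<n} (\<lambda>_. lborel :: real measure)" by (rule L.sigma_finite) simp
    have [measurable_cong]: "sets (Pi\<^sub>M {..<n} (\<lambda>_. lborel :: real measure)) = sets (Pi\<^sub>M {..<n} (\<lambda>_. borel))" by (rule sets_lborel_PiM)
    have PA[measurable]: "Pi\<^sub>E {..<n} A \<in> sets ?S" using A by (intro sets_PiM_I_finite) auto
    note pairing_meas[measurable]
    have "emeasure (distr (density ?P ?d) ?S ?f) (Pi\<^sub>E {..<n} A) = (\<integral>\<^sup>+v. indicator (Pi\<^sub>E {..<n} A) v \<partial>distr (density ?P ?d) ?S ?f)"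
      using PA by simp
    also have "\<dots> = (\<integral>\<^sup>+v. indicator (Pi\<^sub>E {..<n} A) (?f v) \<partial>density ?P ?d)"
      by (rule nn_integral_distr) measurable
    also have "\<dots> = (\<integral>\<^sup>+v. ?d v * indicator (Pi\<^sub>E {..<n} A) (?f v) \<partial>?P)"
      by (rule nn_integral_density) measurable
    also have "\<dots> = (\<integral>\<^sup>+w. \<integral>\<^sup>+x. ?d (w, x) * indicator (Pi\<^sub>E {..<n} A) (?f (w, x)) \<partial>Pi\<^sub>M {..<n} (\<lambda>_. lborel) \<partial>\<nu>n n)"
      by (rule Ln.nn_integral_fst[symmetric]) measurable
    also have "\<dots> = (\<integral>\<^sup>+w. \<integral>\<^sup>+x. (\<Prod>i<n. ennreal (p (w i) (x i)) * indicator (A i) (x i, w i)) \<partial>Pi\<^sub>M {..<n} (\<lambda>_. lborel) \<partial>\<nu>n n)"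
    proof (intro nn_integral_cong)
      fix w x
      have "indicator (Pi\<^sub>E {..<n} A) (?f (w, x)) = (\<Prod>i<n. indicator (A i) (x i, w i) :: ennreal)"
        by (auto simp: indicator_def PiE_def Pi_def prod_eq_1_iff intro!: prod_zero[symmetric])
      then show "?d (w, x) * indicator (Pi\<^sub>E {..<n} A) (?f (w, x)) = (\<Prod>i<n. ennreal (p (w i) (x i)) * indicator (A i) (x i, w i))"
        by (simp add: prod.distrib)
    qed
    also have "\<dots> = (\<integral>\<^sup>+w. (\<Prod>i<n. \<integral>\<^sup>+x. ennreal (p (w i) x) * indicator (A i) (x, w i) \<partial>lborel) \<partial>\<nu>n n)"
    proof (rule nn_integral_cong)
      fix w assume w: "w \<in> space (\<nu>n n)"
      show "(\<integral>\<^sup>+x. (\<Prod>i<n. ennreal (p (w i) (x i)) * indicator (A i) (x i, w i)) \<partial>Pi\<^sub>M {..<n} (\<lambda>_. lborel))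
         = (\<Prod>i<n. \<integral>\<^sup>+x. ennreal (p (w i) x) * indicator (A i) (x, w i) \<partial>lborel)"
      proof (rule L.product_nn_integral_prod)
        fix i assume i: "i \<in> {..<n}"
        then have wi: "w i \<in> space N" using w by (auto simp: space_PiM PiE_def)
        have [measurable]: "A i \<in> sets (borel \<Otimes>\<^sub>M N)" using A i by simp
        have "p (w i) \<in> borel_measurable borel" by (rule p_meas1[OF wi])
        then show "(\<lambda>x. ennreal (p (w i) x) * indicator (A i) (x, w i)) \<in> borel_measurable lborel" using wi by measurable
      qed simp
    qed
    also have "\<dots> = (\<Prod>i<n. \<integral>\<^sup>+y. \<integral>\<^sup>+x. ennreal (p y x) * indicator (A i) (x, y) \<partial>lborel \<partial>\<nu>)"
      unfolding \<nu>n_def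
    proof (rule V.product_nn_integral_prod)
      fix i assume "i \<in> {..<n}"
      then have [measurable]: "A i \<in> sets (borel \<Otimes>\<^sub>M N)" using A by simp
      show "(\<lambda>y. \<integral>\<^sup>+x. ennreal (p y x) * indicator (A i) (x, y) \<partial>lborel) \<in> borel_measurable \<nu>" by measurable
    qed simp
    also have "\<dots> = (\<Prod>i<n. emeasure \<Lambda> (A i))"
    proof (rule prod.cong[OF refl])
      fix i assume "i \<in> {..<n}"
      then have [measurable]: "A i \<in> sets (borel \<Otimes>\<^sub>M N)" using A by simp
      have "emeasure \<Lambda> (A i) = (\<integral>\<^sup>+\<omega>. indicator (A i) (X 0 \<omega>, Y 0 \<omega>) \<partial>M)"
        unfolding \<Lambda>_def by (subst nn_integral_distr[of _ _ "borel \<Otimes>\<^sub>M N", symmetric]) auto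
      also have "\<dots> = (\<integral>\<^sup>+y. \<integral>\<^sup>+x. ennreal (p y x) * indicator (A i) (x, y) \<partial>lborel \<partial>\<nu>)"
        by (rule joint_law0) measurable
      finally show "(\<integral>\<^sup>+y. \<integral>\<^sup>+x. ennreal (p y x) * indicator (A i) (x, y) \<partial>lborel \<partial>\<nu>) = emeasure \<Lambda> (A i)" by simp
    qed
    finally show "emeasure (distr (density ?P ?d) ?S ?f) (Pi\<^sub>E {..<n} A) = (\<Prod>i\<in>{..<n}. emeasure \<Lambda> (A i))" .
  qed simp
  finally show ?thesis .
qed

lemma AE_coord:
  assumes "AE y in \<nu>. Q y"
  shows "AE w in \<nu>n n. \<forall>i<n. Q (w i)"
proof -
  have "AE w in \<nu>n n. \<forall>i\<in>{..<n}. Q (w i)"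
    unfolding \<nu>n_def by (rule AE_finite_allI) (use prob_\<nu> assms in \<open>auto intro!: AE_PiM_component\<close>)
  then show ?thesis by eventually_elim auto
qed

text \<open>Coordinates beyond \<open>n\<close> are filled up with \<open>w 0\<close>, so that every component is a probability law.\<close>
definition cond_laws :: "nat \<Rightarrow> (nat \<Rightarrow> 'b) \<Rightarrow> nat \<Rightarrow> real measure" where
  "cond_laws n w i = density lborel (p (if i < n then w i else w 0))"

definition sum_law :: "nat \<Rightarrow> (nat \<Rightarrow> 'b) \<Rightarrow> real measure" where
  "sum_law n w = distr (Pi\<^sub>M {..<n} (cond_laws n w)) borel (\<lambda>x. (\<Sum>j<n. x j) / sqrt (real n))"

text \<open>This excludes the null set of vectors at which some section of \<open>p\<close> has
  total mass other than 1.\<close>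

definition regular :: "nat \<Rightarrow> (nat \<Rightarrow> 'b) \<Rightarrow> bool" where
  "regular n w \<longleftrightarrow> w \<in> space (\<nu>n n) \<and> (\<forall>i<n. (\<integral>\<^sup>+x. ennreal (p (w i) x) \<partial>lborel) = 1)"

lemma AE_regular: "AE w in \<nu>n n. regular n w"
  using AE_coord[OF AE_p_one] AE_space unfolding regular_def by eventually_elim auto

lemma regularD:
  assumes "regular n w" "0 < n"
  shows "p (if i < n then w i else w 0) \<in> borel_measurable borel"
    "(\<integral>\<^sup>+x. ennreal (p (if i < n then w i else w 0) x) \<partial>lborel) = 1"
proof -
  have "w j \<in> space N" if "j < n" for j using assms that unfolding regular_def by (auto simp: space_PiM)
  then show "p (if i < n then w i else w 0) \<in> borel_measurable borel" using assms(2) by (auto intro!: p_meas1)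
  show "(\<integral>\<^sup>+x. ennreal (p (if i < n then w i else w 0) x) \<partial>lborel) = 1"
    using assms unfolding regular_def by auto
qed

lemma cond_laws_prob:
  assumes "regular n w" "0 < n"
  shows "prob_space (cond_laws n w i)" "sets (cond_laws n w i) = sets borel"
  using regularD[OF assms, of i] unfolding cond_laws_def by (auto intro!: prob_spaceI simp: emeasure_density)

lemma sum_law_integral:
  assumes w: "regular n w" and n: "0 < n" and g[measurable]: "g \<in> borel_measurable borel"
  shows "(\<integral>\<^sup>+x. (\<Prod>i<n. ennreal (p (w i) (x i))) * g ((\<Sum>j<n. x j) / sqrt (real n)) \<partial>Pi\<^sub>M {..<n} (\<lambda>_. lborel))
    = (\<integral>\<^sup>+s. g s \<partial>sum_law n w)"
proof -
  define f where "f i = p (if i < n then w i else w 0)" for i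
  have fm[measurable]: "f i \<in> borel_measurable borel" for i unfolding f_def by (rule regularD[OF w n])
  have f1: "(\<integral>\<^sup>+x. ennreal (f i x) \<partial>lborel) = 1" for i unfolding f_def by (rule regularD[OF w n])
  have [measurable_cong]: "sets (Pi\<^sub>M {..<n} (\<lambda>_. lborel :: real measure)) = sets (Pi\<^sub>M {..<n} (\<lambda>_. borel))" by (rule sets_lborel_PiM)
  have sc: "sets (Pi\<^sub>M {..<n} (cond_laws n w)) = sets (Pi\<^sub>M {..<n} (\<lambda>_. borel))"
    by (rule sets_PiM_cong) (auto simp: cond_laws_prob[OF w n])
  have "(\<integral>\<^sup>+x. (\<Prod>i<n. ennreal (p (w i) (x i))) * g ((\<Sum>j<n. x j) / sqrt (real n)) \<partial>Pi\<^sub>M {..<n} (\<lambda>_. lborel))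
     = (\<integral>\<^sup>+x. (\<Prod>i<n. ennreal (f i (x i))) * g ((\<Sum>j<n. x j) / sqrt (real n)) \<partial>Pi\<^sub>M {..<n} (\<lambda>_. lborel))"
    by (simp add: f_def)
  also have "\<dots> = (\<integral>\<^sup>+x. g ((\<Sum>j<n. x j) / sqrt (real n)) \<partial>density (Pi\<^sub>M {..<n} (\<lambda>_. lborel)) (\<lambda>x. \<Prod>i<n. ennreal (f i (x i))))"
    by (rule nn_integral_density[symmetric]) (auto intro!: borel_measurable_prod_ennreal)
  also have "density (Pi\<^sub>M {..<n} (\<lambda>_. lborel)) (\<lambda>x. \<Prod>i<n. ennreal (f i (x i))) = Pi\<^sub>M {..<n} (\<lambda>i. density lborel (f i))"
    by (rule density_PiM) (use fm f1 in \<open>auto simp: f_def\<close>)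
  also have "\<dots> = Pi\<^sub>M {..<n} (cond_laws n w)" by (rule PiM_cong) (auto simp: cond_laws_def f_def)
  also have "(\<integral>\<^sup>+x. g ((\<Sum>j<n. x j) / sqrt (real n)) \<partial>Pi\<^sub>M {..<n} (cond_laws n w)) = (\<integral>\<^sup>+s. g s \<partial>sum_law n w)"
    unfolding sum_law_def by (rule nn_integral_distr[symmetric]) (use sc in \<open>auto cong: measurable_cong_sets\<close>)
  finally show ?thesis .
qed

text \<open>An integral against a fixed measure, so measurability in \<open>w\<close> is Tonelli and
  holds at irregular \<open>w\<close> as well. At regular \<open>w\<close> it is the integral
  against \<open>sum_law\<close>, which therefore need not be shown to be a measurable
  kernel.\<close>

definition kernel_integral :: "nat \<Rightarrow> ((nat \<Rightarrow> 'b) \<times> real \<Rightarrow> ennreal) \<Rightarrow> (nat \<Rightarrow> 'b) \<Rightarrow> ennreal" where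
  "kernel_integral n g w = (\<integral>\<^sup>+x. (\<Prod>i<n. ennreal (p (w i) (x i))) * g (w, (\<Sum>j<n. x j) / sqrt (real n)) \<partial>Pi\<^sub>M {..<n} (\<lambda>_. lborel))"

lemma kernel_integral_eq:
  assumes w: "regular n w" and n: "0 < n" and g[measurable]: "g \<in> borel_measurable (Pi\<^sub>M {..<n} (\<lambda>_. N) \<Otimes>\<^sub>M borel)"
  shows "kernel_integral n g w = (\<integral>\<^sup>+s. g (w, s) \<partial>sum_law n w)"
proof -
  have "w \<in> space (Pi\<^sub>M {..<n} (\<lambda>_. N))" using w unfolding regular_def by simp
  then have "(\<lambda>s. g (w, s)) \<in> borel_measurable borel" by measurable
  from sum_law_integral[OF w n this] show ?thesis unfolding kernel_integral_def .
qed

lemma kernel_integral_meas[measurable]: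
  assumes g[measurable]: "g \<in> borel_measurable (Pi\<^sub>M {..<n} (\<lambda>_. N) \<Otimes>\<^sub>M borel)"
  shows "kernel_integral n g \<in> borel_measurable (Pi\<^sub>M {..<n} (\<lambda>_. N))"
proof -
  interpret L: product_sigma_finite "\<lambda>i::nat. lborel :: real measure"
    unfolding product_sigma_finite_def using sigma_finite_lborel by blast
  interpret Ln: sigma_finite_measure "Pi\<^sub>M {..<n} (\<lambda>_. lborel :: real measure)" by (rule L.sigma_finite) simp
  have [measurable_cong]: "sets (Pi\<^sub>M {..<n} (\<lambda>_. lborel :: real measure)) = sets (Pi\<^sub>M {..<n} (\<lambda>_. borel))" by (rule sets_lborel_PiM)
  have "(\<lambda>v. (\<Prod>i<n. ennreal (p (fst v i) (snd v i))) * g (fst v, (\<Sum>j<n. snd v j) / sqrt (real n)))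
     \<in> borel_measurable (Pi\<^sub>M {..<n} (\<lambda>_. N) \<Otimes>\<^sub>M Pi\<^sub>M {..<n} (\<lambda>_. lborel))" by measurable
  then show ?thesis unfolding kernel_integral_def[abs_def]
    by (intro Ln.borel_measurable_nn_integral) (simp add: case_prod_unfold)
qed

lemma joint_sum_law:
  assumes n: "0 < n" and g[measurable]: "g \<in> borel_measurable (Pi\<^sub>M {..<n} (\<lambda>_. N) \<Otimes>\<^sub>M borel)"
  shows "(\<integral>\<^sup>+\<omega>. g (vec_prefix Y n \<omega>, normalized_sum X n \<omega>) \<partial>M) = (\<integral>\<^sup>+w. kernel_integral n g w \<partial>\<nu>n n)"
proof -
  interpret L: product_sigma_finite "\<lambda>i::nat. lborel :: real measure"
    unfolding product_sigma_finite_def using sigma_finite_lborel by blast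
  interpret Ln: sigma_finite_measure "Pi\<^sub>M {..<n} (\<lambda>_. lborel :: real measure)" by (rule L.sigma_finite) simp
  have [measurable_cong]: "sets (Pi\<^sub>M {..<n} (\<lambda>_. lborel :: real measure)) = sets (Pi\<^sub>M {..<n} (\<lambda>_. borel))" by (rule sets_lborel_PiM)
  let ?S = "Pi\<^sub>M {..<n} (\<lambda>_. borel \<Otimes>\<^sub>M N)"
  define h where "h z = g (\<lambda>i\<in>{..<n}. snd (z i), (\<Sum>i<n. fst (z i)) / sqrt (real n))" for z :: "nat \<Rightarrow> real \<times> 'b"
  have hm[measurable]: "h \<in> borel_measurable ?S"
  proof -
    have 1: "(\<lambda>z. \<lambda>i\<in>{..<n}. snd (z i)) \<in> measurable ?S (Pi\<^sub>M {..<n} (\<lambda>_. N))"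
      by (rule measurable_restrict) measurable
    have 2: "(\<lambda>z. (\<Sum>i<n. fst (z i)) / sqrt (real n)) \<in> borel_measurable ?S" by measurable
    show ?thesis unfolding h_def[abs_def] by (rule measurable_compose[OF measurable_Pair[OF 1 2] g])
  qed
  note pairing_meas[measurable]
  have Zm: "(\<lambda>\<omega>. \<lambda>i\<in>{..<n}. (X i \<omega>, Y i \<omega>)) \<in> measurable M ?S" by (rule measurable_restrict) measurable
  have "(\<integral>\<^sup>+\<omega>. g (vec_prefix Y n \<omega>, normalized_sum X n \<omega>) \<partial>M) = (\<integral>\<^sup>+\<omega>. h (\<lambda>i\<in>{..<n}. (X i \<omega>, Y i \<omega>)) \<partial>M)"
    unfolding h_def vec_prefix_def normalized_sum_def
    by (intro nn_integral_cong arg_cong[where f=g]) (auto simp: fun_eq_iff)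
  also have "\<dots> = (\<integral>\<^sup>+z. h z \<partial>distr M ?S (\<lambda>\<omega>. \<lambda>i\<in>{..<n}. (X i \<omega>, Y i \<omega>)))"
    by (rule nn_integral_distr[OF Zm, symmetric]) measurable
  also have "\<dots> = (\<integral>\<^sup>+v. h (\<lambda>i\<in>{..<n}. (snd v i, fst v i)) \<partial>density (\<nu>n n \<Otimes>\<^sub>M Pi\<^sub>M {..<n} (\<lambda>_. lborel)) (\<lambda>v. \<Prod>i<n. ennreal (p (fst v i) (snd v i))))"
    unfolding vector_law[OF n] by (rule nn_integral_distr) measurable
  also have "\<dots> = (\<integral>\<^sup>+v. (\<Prod>i<n. ennreal (p (fst v i) (snd v i))) * h (\<lambda>i\<in>{..<n}. (snd v i, fst v i)) \<partial>(\<nu>n n \<Otimes>\<^sub>M Pi\<^sub>M {..<n} (\<lambda>_. lborel)))"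
    by (rule nn_integral_density) measurable
  also have "\<dots> = (\<integral>\<^sup>+w. \<integral>\<^sup>+x. (\<Prod>i<n. ennreal (p (w i) (x i))) * h (\<lambda>i\<in>{..<n}. (x i, w i)) \<partial>Pi\<^sub>M {..<n} (\<lambda>_. lborel) \<partial>\<nu>n n)"
    by (subst Ln.nn_integral_fst[symmetric]) auto
  also have "\<dots> = (\<integral>\<^sup>+w. kernel_integral n g w \<partial>\<nu>n n)"
    unfolding kernel_integral_def
  proof (intro nn_integral_cong)
    fix w and x :: "nat \<Rightarrow> real" assume w: "w \<in> space (\<nu>n n)"
    have "(\<lambda>i\<in>{..<n}. w i) = w" using w by (auto simp: space_PiM PiE_def extensional_restrict)
    moreover have "(\<lambda>i\<in>{..<n}. snd ((\<lambda>i\<in>{..<n}. (x i, w i)) i)) = (\<lambda>i\<in>{..<n}. w i)" by (auto simp: fun_eq_iff)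
    ultimately show "(\<Prod>i<n. ennreal (p (w i) (x i))) * h (\<lambda>i\<in>{..<n}. (x i, w i)) = (\<Prod>i<n. ennreal (p (w i) (x i))) * g (w, (\<Sum>j<n. x j) / sqrt (real n))"
      unfolding h_def by simp
  qed
  finally show ?thesis .
qed

lemma vec_prefix_meas[measurable]: "vec_prefix Y n \<in> measurable M (Pi\<^sub>M {..<n} (\<lambda>_. N))"
  unfolding vec_prefix_def[abs_def] by (rule measurable_restrict) measurable

lemma normalized_sum_meas[measurable]: "normalized_sum X n \<in> borel_measurable M"
  unfolding normalized_sum_def[abs_def] by measurable

lemma prob_sum_law:
  assumes "regular n w" "0 < n"
  shows "prob_space (sum_law n w)"
proof -
  have sc: "sets (Pi\<^sub>M {..<n} (cond_laws n w)) = sets (Pi\<^sub>M {..<n} (\<lambda>_. borel))"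
    by (rule sets_PiM_cong) (auto simp: cond_laws_prob[OF assms])
  show ?thesis unfolding sum_law_def
    by (rule prob_space.prob_space_distr[OF prob_space_PiM]) (use cond_laws_prob[OF assms] sc in \<open>auto cong: measurable_cong_sets\<close>)
qed

lemma sets_sum_law[simp]: "sets (sum_law n w) = sets borel" "space (sum_law n w) = UNIV"
  unfolding sum_law_def by auto

lemma vec_prefix_law:
  assumes n: "0 < n"
  shows "distr M (Pi\<^sub>M {..<n} (\<lambda>_. N)) (vec_prefix Y n) = \<nu>n n"
proof (rule measure_eqI)
  fix B assume "B \<in> sets (distr M (Pi\<^sub>M {..<n} (\<lambda>_. N)) (vec_prefix Y n))"
  then have B[measurable]: "B \<in> sets (Pi\<^sub>M {..<n} (\<lambda>_. N))" by simp
  have "emeasure (distr M (Pi\<^sub>M {..<n} (\<lambda>_. N)) (vec_prefix Y n)) B = (\<integral>\<^sup>+\<omega>. indicator B (vec_prefix Y n \<omega>) \<partial>M)"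
    by (subst nn_integral_distr[of _ _ "Pi\<^sub>M {..<n} (\<lambda>_. N)", symmetric]) auto
  also have "\<dots> = (\<integral>\<^sup>+w. kernel_integral n (\<lambda>v. indicator B (fst v)) w \<partial>\<nu>n n)"
    using joint_sum_law[OF n, of "\<lambda>v. indicator B (fst v)"] by simp
  also have "\<dots> = (\<integral>\<^sup>+w. indicator B w \<partial>\<nu>n n)"
  proof (rule nn_integral_cong_AE, use AE_regular[of n] in eventually_elim)
    fix w assume w: "regular n w"
    interpret W: prob_space "sum_law n w" by (rule prob_sum_law[OF w n])
    show "kernel_integral n (\<lambda>v. indicator B (fst v)) w = indicator B w"
      using W.emeasure_space_1 by (subst kernel_integral_eq[OF w n]) auto
  qed
  also have "\<dots> = emeasure (\<nu>n n) B" by simp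
  finally show "emeasure (distr M (Pi\<^sub>M {..<n} (\<lambda>_. N)) (vec_prefix Y n)) B = emeasure (\<nu>n n) B" .
qed simp

text \<open>The expected divergence is formed with an unspecified version, so each version must be
  recognized. For one Borel set the agreement fails on a null set depending on that set; half-lines
  with rational endpoints leave a single null set and determine the law.\<close>

lemma AE_cond_density_eq_sum_law:
  assumes n: "0 < n" and q: "cond_density M (normalized_sum X n) (vec_prefix Y n) (Pi\<^sub>M {..<n} (\<lambda>_. N)) q"
  shows "AE w in \<nu>n n. sum_law n w = density lborel (q w)"
proof -
  interpret Vn: prob_space "\<nu>n n" by (rule prob_\<nu>n)
  have qm[measurable]: "(\<lambda>(w, x). q w x) \<in> borel_measurable (Pi\<^sub>M {..<n} (\<lambda>_. N) \<Otimes>\<^sub>M borel)"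
    and qeq: "\<And>A B. A \<in> sets borel \<Longrightarrow> B \<in> sets (Pi\<^sub>M {..<n} (\<lambda>_. N)) \<Longrightarrow>
        emeasure M {\<omega>\<in>space M. normalized_sum X n \<omega> \<in> A \<and> vec_prefix Y n \<omega> \<in> B}
        = (\<integral>\<^sup>+ w. indicator B w * (\<integral>\<^sup>+ x. ennreal (q w x) * indicator A x \<partial>lborel) \<partial>\<nu>n n)"
    using q unfolding cond_density_def vec_prefix_law[OF n] by auto
  have AEA: "AE w in \<nu>n n. emeasure (sum_law n w) A = (\<integral>\<^sup>+ x. ennreal (q w x) * indicator A x \<partial>lborel)"
    if A[measurable]: "A \<in> sets borel" for A
  proof -
    define K where "K = kernel_integral n (\<lambda>v. indicator A (snd v))"
    have Km[measurable]: "K \<in> borel_measurable (Pi\<^sub>M {..<n} (\<lambda>_. N))" unfolding K_def by measurable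
    have "AE w in \<nu>n n. K w = (\<integral>\<^sup>+ x. ennreal (q w x) * indicator A x \<partial>lborel)"
    proof (rule Vn.density_unique)
      show "density (\<nu>n n) K = density (\<nu>n n) (\<lambda>w. \<integral>\<^sup>+ x. ennreal (q w x) * indicator A x \<partial>lborel)"
      proof (rule measure_eqI)
        fix B assume "B \<in> sets (density (\<nu>n n) K)"
        then have B[measurable]: "B \<in> sets (Pi\<^sub>M {..<n} (\<lambda>_. N))" by simp
        have "emeasure (density (\<nu>n n) K) B = (\<integral>\<^sup>+w. K w * indicator B w \<partial>\<nu>n n)" by (rule emeasure_density) auto
        also have "\<dots> = (\<integral>\<^sup>+w. kernel_integral n (\<lambda>v. indicator A (snd v) * indicator B (fst v)) w \<partial>\<nu>n n)"
        proof (rule nn_integral_cong_AE, use AE_regular[of n] in eventually_elim)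
          fix w assume w: "regular n w"
          show "K w * indicator B w = kernel_integral n (\<lambda>v. indicator A (snd v) * indicator B (fst v)) w"
            unfolding K_def by (subst (1 2) kernel_integral_eq[OF w n]) (auto simp: indicator_def)
        qed
        also have "\<dots> = (\<integral>\<^sup>+\<omega>. indicator A (normalized_sum X n \<omega>) * indicator B (vec_prefix Y n \<omega>) \<partial>M)"
          using joint_sum_law[OF n, of "\<lambda>v. indicator A (snd v) * indicator B (fst v)"] by simp
        also have "\<dots> = emeasure M {\<omega>\<in>space M. normalized_sum X n \<omega> \<in> A \<and> vec_prefix Y n \<omega> \<in> B}"
        proof -
          have "(\<integral>\<^sup>+\<omega>. indicator A (normalized_sum X n \<omega>) * indicator B (vec_prefix Y n \<omega>) \<partial>M)
            = (\<integral>\<^sup>+\<omega>. indicator {\<omega>\<in>space M. normalized_sum X n \<omega> \<in> A \<and> vec_prefix Y n \<omega> \<in> B} \<omega> \<partial>M)"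
            by (intro nn_integral_cong) (auto simp: indicator_def)
          also have "\<dots> = emeasure M {\<omega>\<in>space M. normalized_sum X n \<omega> \<in> A \<and> vec_prefix Y n \<omega> \<in> B}"
            by (rule nn_integral_indicator) measurable
          finally show ?thesis .
        qed
        also have "\<dots> = (\<integral>\<^sup>+ w. indicator B w * (\<integral>\<^sup>+ x. ennreal (q w x) * indicator A x \<partial>lborel) \<partial>\<nu>n n)" by (rule qeq[OF A B])
        also have "\<dots> = emeasure (density (\<nu>n n) (\<lambda>w. \<integral>\<^sup>+ x. ennreal (q w x) * indicator A x \<partial>lborel)) B"
          by (subst emeasure_density) (auto simp: mult.commute)
        finally show "emeasure (density (\<nu>n n) K) B = emeasure (density (\<nu>n n) (\<lambda>w. \<integral>\<^sup>+ x. ennreal (q w x) * indicator A x \<partial>lborel)) B" .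
      qed simp
    qed auto
    then show ?thesis
      using AE_regular[of n]
    proof eventually_elim
      fix w assume *: "K w = (\<integral>\<^sup>+ x. ennreal (q w x) * indicator A x \<partial>lborel)" and w: "regular n w"
      have "K w = emeasure (sum_law n w) A" unfolding K_def by (subst kernel_integral_eq[OF w n]) auto
      with * show "emeasure (sum_law n w) A = (\<integral>\<^sup>+ x. ennreal (q w x) * indicator A x \<partial>lborel)" by simp
    qed
  qed
  have "AE w in \<nu>n n. \<forall>r\<in>\<rat>. emeasure (sum_law n w) {r<..} = (\<integral>\<^sup>+ x. ennreal (q w x) * indicator {r<..} x \<partial>lborel)"
    using AEA by (subst AE_ball_countable[OF countable_rat]) auto
  then show ?thesis
    using AE_regular[of n]
  proof eventually_elim
    fix w assume *: "\<forall>r\<in>\<rat>. emeasure (sum_law n w) {r<..} = (\<integral>\<^sup>+ x. ennreal (q w x) * indicator {r<..} x \<partial>lborel)" and w: "regular n w"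
    interpret W: prob_space "sum_law n w" by (rule prob_sum_law[OF w n])
    have "w \<in> space (Pi\<^sub>M {..<n} (\<lambda>_. N))" using w unfolding regular_def by simp
    then have qw[measurable]: "q w \<in> borel_measurable borel" using measurable_Pair2[OF qm] by simp
    have r: "emeasure (sum_law n w) {r<..} = emeasure (density lborel (q w)) {r<..}" if "r \<in> \<rat>" for r
      using * that by (simp add: emeasure_density)
    show "sum_law n w = density lborel (q w)"
    proof (rule measure_eqI_lessThan)
      fix x :: real
      show "emeasure (sum_law n w) {x<..} < \<infinity>" using W.emeasure_finite by (simp add: less_top[symmetric])
      have "\<forall>k. \<exists>r\<in>\<rat>. x < r \<and> r < x + 1 / real (Suc k)"
        by (intro allI) (rule Rats_dense_in_real, simp)
      then obtain r where r': "\<And>k. r k \<in> \<rat>" "\<And>k. x < r k" "\<And>k. r k < x + 1 / real (Suc k)" by metis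
      \<comment> \<open>Running minima make the approximating rationals decrease to
        \<open>x\<close>, so that the half-lines increase to \<open>{x<..}\<close>.\<close>
      define s where "s k = Min (r ` {..k})" for k
      have sr: "s k \<in> \<rat>" "x < s k" "s k \<le> r k" for k
      proof -
        have "s k \<in> r ` {..k}" unfolding s_def by (rule Min_in) auto
        then show "s k \<in> \<rat>" "x < s k" using r' by auto
        show "s k \<le> r k" unfolding s_def by (rule Min_le) auto
      qed
      have "decseq s" unfolding decseq_def s_def by (auto intro!: Min_antimono)
      then have inc: "incseq (\<lambda>k. {s k<..})" unfolding incseq_def decseq_def by (auto intro: le_less_trans)
      have U: "(\<Union>k. {s k<..}) = {x<..}"
      proof (intro equalityI subsetI)
        fix z assume "z \<in> {x<..}"
        then have "0 < z - x" by simp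
        then obtain k where "1 / real (Suc k) < z - x" using reals_Archimedean[of "z - x"] by (auto simp: inverse_eq_divide)
        then have "s k < z" using sr(3)[of k] r'(3)[of k] by linarith
        then show "z \<in> (\<Union>k. {s k<..})" by auto
      qed (use sr in \<open>auto intro: less_trans\<close>)
      have "emeasure (sum_law n w) {x<..} = (SUP k. emeasure (sum_law n w) {s k<..})"
        unfolding U[symmetric] by (rule SUP_emeasure_incseq[symmetric]) (use inc in auto)
      also have "\<dots> = (SUP k. emeasure (density lborel (q w)) {s k<..})" using r sr by simp
      also have "\<dots> = emeasure (density lborel (q w)) {x<..}"
        unfolding U[symmetric] by (rule SUP_emeasure_incseq) (use inc in auto)
      finally show "emeasure (sum_law n w) {x<..} = emeasure (density lborel (q w)) {x<..}" .
    qed auto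
  qed
qed

end

section \<open>Measurable conditional information and existence of a conditional density\<close>

text \<open>Since \<open>f\<close> is nonnegative, each of its zeros is a minimum, and the
  derivative vanishes there wherever it exists; this gives \<open>f'_zero\<close>. Existence almost
  everywhere also allows \<open>deriv\<close> and \<open>diff_limit\<close> to be exchanged under
  the integral.\<close>

lemma fisher_density_of_abs_cont:
  assumes ac: "abs_cont_real f" and f0: "\<And>x. 0 \<le> f x" and f1: "(\<integral>\<^sup>+x. ennreal (f x) \<partial>lborel) = 1"
    and fin: "fisher_info f < \<infinity>"
  shows "fisher_info f = (\<integral>\<^sup>+x. ennreal ((diff_limit f x)\<^sup>2 / f x) \<partial>lborel)"
    and "fisher_density f (diff_limit f) (enn2real (fisher_info f))"
proof -
  have [measurable]: "f \<in> borel_measurable borel"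
    using abs_cont_real_continuous[OF ac] by (rule borel_measurable_continuous_onI)
  note der = abs_cont_AE_derivative[OF ac]
  show eq: "fisher_info f = (\<integral>\<^sup>+x. ennreal ((diff_limit f x)\<^sup>2 / f x) \<partial>lborel)"
    unfolding fisher_info_def
    by (rule nn_integral_cong_AE, use der in eventually_elim) (simp add: DERIV_imp_deriv)
  show "fisher_density f (diff_limit f) (enn2real (fisher_info f))"
  proof
    show "AE x in lborel. f x = 0 \<longrightarrow> diff_limit f x = 0"
      using der
    proof eventually_elim
      fix x assume d: "(f has_real_derivative diff_limit f x) (at x)"
      show "f x = 0 \<longrightarrow> diff_limit f x = 0"
      proof
        assume "f x = 0"
        then show "diff_limit f x = 0" using f0 by (intro DERIV_local_min[OF d, of 1]) auto
      qed
    qed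
    show "(\<integral>\<^sup>+x. ennreal ((diff_limit f x)\<^sup>2 / f x) \<partial>lborel) \<le> ennreal (enn2real (fisher_info f))"
      using fin unfolding eq by (simp add: ennreal_enn2real)
  qed (use f0 f1 abs_cont_set_integrable[OF ac] abs_cont_integral_derivative[OF ac] in auto)
qed

locale iid_fisher = iid_conditional +
  assumes ac: "AE y in \<nu>. abs_cont_real (p y)" and fin: "AE y in \<nu>. fisher_info (p y) < \<infinity>"
begin

definition p' :: "'b \<Rightarrow> real \<Rightarrow> real" where "p' y = diff_limit (p y)"

text \<open>Written with \<open>p'\<close> instead of \<open>fisher_info\<close>, because joint
  measurability is at hand for \<open>p'\<close>; the two agree for almost every \<open>y\<close>.
  An infinite value would be read as 0, which can happen on a null set only.\<close>

definition info :: "'b \<Rightarrow> real" where "info y = enn2real (\<integral>\<^sup>+x. ennreal ((p' y x)\<^sup>2 / p y x) \<partial>lborel)"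

definition moment6 :: "'b \<Rightarrow> real" where "moment6 y = enn2real (\<integral>\<^sup>+x. ennreal (p y x) * ennreal (x ^ 6) \<partial>lborel)"

lemma p'_meas[measurable]: "(\<lambda>(y, x). p' y x) \<in> borel_measurable (N \<Otimes>\<^sub>M borel)"
proof -
  have "(\<lambda>v. p (fst v) (snd v + c)) \<in> borel_measurable (N \<Otimes>\<^sub>M borel)" for c
  proof -
    have "(\<lambda>v. (fst v, snd v + c)) \<in> measurable (N \<Otimes>\<^sub>M borel) (N \<Otimes>\<^sub>M borel)" by measurable
    from measurable_compose[OF this p_meas] show ?thesis by simp
  qed
  moreover have "(\<lambda>v. p (fst v) (snd v)) \<in> borel_measurable (N \<Otimes>\<^sub>M borel)" using p_meas by (simp add: case_prod_unfold)
  ultimately show ?thesis unfolding p'_def diff_limit_def case_prod_unfold by measurable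
qed

lemma info_meas[measurable]: "info \<in> borel_measurable N"
  unfolding info_def[abs_def] by measurable

lemma moment6_meas[measurable]: "moment6 \<in> borel_measurable N"
  unfolding moment6_def[abs_def] by measurable

lemma info_nonneg: "0 \<le> info y" and moment6_nonneg: "0 \<le> moment6 y"
  unfolding info_def moment6_def by auto

lemma AE_fisher: "AE y in \<nu>. fisher_density (p y) (p' y) (info y) \<and> info y = enn2real (fisher_info (p y))"
  using ac fin AE_p_one
proof eventually_elim
  fix y assume *: "abs_cont_real (p y)" "fisher_info (p y) < \<infinity>" "(\<integral>\<^sup>+x. ennreal (p y x) \<partial>lborel) = 1"
  note f = fisher_density_of_abs_cont[OF *(1) p_nonneg *(3,2)]
  have "info y = enn2real (fisher_info (p y))" unfolding info_def p'_def f(1)[symmetric] ..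
  with f(2) show "fisher_density (p y) (p' y) (info y) \<and> info y = enn2real (fisher_info (p y))"
    unfolding p'_def by simp
qed

lemma AE_fisher_coord: "AE w in \<nu>n n. \<forall>i<n. fisher_density (p (w i)) (p' (w i)) (info (w i))"
  by (rule AE_coord, use AE_fisher in eventually_elim) (elim conjE)

lemma sum_law_le:
  assumes w: "regular n w" and n: "0 < n" and fd: "\<forall>i<n. fisher_density (p (w i)) (p' (w i)) (info (w i))" and A: "A \<in> sets borel"
  shows "emeasure (sum_law n w) A \<le> ennreal (sqrt (real n * info (w 0))) * emeasure lborel A"
  unfolding sum_law_def
  by (rule normalized_sum_law_le[OF n cond_laws_prob[OF w n] _ _ A]) (use fd n in \<open>auto simp: cond_laws_def\<close>)

text \<open>Without existence the choice in \<open>exp_cond_gauss_KL\<close> would be void. Almost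
  every \<open>sum_law\<close> gives a set at most a finite multiple of its length, so the joint law
  is absolutely continuous, and Radon-Nikodym delivers a jointly measurable density.\<close>

lemma ex_cond_density:
  assumes n: "0 < n"
  shows "\<exists>q. cond_density M (normalized_sum X n) (vec_prefix Y n) (Pi\<^sub>M {..<n} (\<lambda>_. N)) q"
proof -
  interpret Vn: prob_space "\<nu>n n" by (rule prob_\<nu>n)
  interpret VL: pair_sigma_finite "\<nu>n n" "lborel :: real measure" ..
  let ?L = "distr M (Pi\<^sub>M {..<n} (\<lambda>_. N) \<Otimes>\<^sub>M borel) (\<lambda>\<omega>. (vec_prefix Y n \<omega>, normalized_sum X n \<omega>))"
  let ?R = "\<nu>n n \<Otimes>\<^sub>M (lborel :: real measure)"
  interpret L: prob_space ?L by (rule prob_space_distr) measurable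
  have sR: "sets ?R = sets (Pi\<^sub>M {..<n} (\<lambda>_. N) \<Otimes>\<^sub>M borel)" by (rule sets_pair_measure_cong) auto
  have abs: "absolutely_continuous ?R ?L"
    unfolding absolutely_continuous_def
  proof
    fix E assume E: "E \<in> null_sets ?R"
    then have Em[measurable]: "E \<in> sets (Pi\<^sub>M {..<n} (\<lambda>_. N) \<Otimes>\<^sub>M borel)" using sR by auto
    have "AE v in ?R. v \<notin> E" using E by (rule AE_not_in)
    then have "AE w in \<nu>n n. AE x in lborel. (w, x) \<notin> E" by (rule VL.AE_pair)
    then have "AE w in \<nu>n n. kernel_integral n (indicator E) w = 0"
      using AE_regular[of n] AE_fisher_coord[of n]
    proof eventually_elim
      fix w assume nul: "AE x in lborel. (w, x) \<notin> E" and w: "regular n w"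
        and fd: "\<forall>i<n. fisher_density (p (w i)) (p' (w i)) (info (w i))"
      have ws: "w \<in> space (Pi\<^sub>M {..<n} (\<lambda>_. N))" using w unfolding regular_def by simp
      define A where "A = {x. (w, x) \<in> E}"
      have A[measurable]: "A \<in> sets borel" unfolding A_def using ws by measurable
      have "AE x in lborel. x \<notin> A" using nul by (simp add: A_def)
      then have "emeasure lborel A = 0" using AE_iff_null_sets[of A lborel] A by auto
      then have "emeasure (sum_law n w) A = 0" using sum_law_le[OF w n fd A] by simp
      moreover have "kernel_integral n (indicator E) w = (\<integral>\<^sup>+s. indicator E (w, s) \<partial>sum_law n w)"
        by (rule kernel_integral_eq[OF w n]) measurable
      moreover have "(\<integral>\<^sup>+s. indicator E (w, s) \<partial>sum_law n w) = (\<integral>\<^sup>+s. indicator A s \<partial>sum_law n w)"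
        by (intro nn_integral_cong) (auto simp: indicator_def A_def)
      ultimately show "kernel_integral n (indicator E) w = 0" by simp
    qed
    then have "(\<integral>\<^sup>+w. kernel_integral n (indicator E) w \<partial>\<nu>n n) = 0" by (subst nn_integral_0_iff_AE) auto
    then have "(\<integral>\<^sup>+\<omega>. indicator E (vec_prefix Y n \<omega>, normalized_sum X n \<omega>) \<partial>M) = 0"
      using joint_sum_law[OF n, of "indicator E"] by simp
    moreover have "(\<integral>\<^sup>+v. indicator E v \<partial>?L) = (\<integral>\<^sup>+\<omega>. indicator E (vec_prefix Y n \<omega>, normalized_sum X n \<omega>) \<partial>M)"
      by (rule nn_integral_distr) measurable
    ultimately have "emeasure ?L E = 0" by simp
    then show "E \<in> null_sets ?L" using Em by (auto simp: null_sets_def)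
  qed
  obtain f where f: "f \<in> borel_measurable ?R" "density ?R f = ?L"
    using VL.Radon_Nikodym[OF abs] sR by auto
  have fm[measurable]: "f \<in> borel_measurable (Pi\<^sub>M {..<n} (\<lambda>_. N) \<Otimes>\<^sub>M borel)" using f(1) sR by (auto cong: measurable_cong_sets)
  have "(\<integral>\<^sup>+v. f v \<partial>?R) = emeasure ?L (space ?R)" unfolding f(2)[symmetric]
    by (subst emeasure_density[OF f(1) sets.top]) (auto intro!: nn_integral_cong)
  also have "\<dots> \<noteq> \<infinity>" using L.emeasure_finite by simp
  finally have AEf: "AE v in ?R. f v \<noteq> \<infinity>" using f(1) by (intro nn_integral_noteq_infinite) auto
  define q where "q w x = enn2real (f (w, x))" for w x
  have qm: "(\<lambda>(w, x). q w x) \<in> borel_measurable (Pi\<^sub>M {..<n} (\<lambda>_. N) \<Otimes>\<^sub>M borel)" unfolding q_def by (simp add: case_prod_unfold)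
  have "density ?R (\<lambda>(w, x). ennreal (q w x)) = density ?R f"
  proof (rule density_cong)
    show "AE v in ?R. (case v of (w, x) \<Rightarrow> ennreal (q w x)) = f v"
      using AEf by eventually_elim (auto simp: q_def top.not_eq_extremum split: prod.split)
  qed (use qm f(1) sR in \<open>auto simp: case_prod_unfold cong: measurable_cong_sets\<close>)
  then have "?L = density (distr M (Pi\<^sub>M {..<n} (\<lambda>_. N)) (vec_prefix Y n) \<Otimes>\<^sub>M lborel) (\<lambda>(w, x). ennreal (q w x))"
    unfolding vec_prefix_law[OF n] f(2) by simp
  moreover have "\<forall>w x. 0 \<le> q w x" unfolding q_def by simp
  ultimately have "cond_density M (normalized_sum X n) (vec_prefix Y n) (Pi\<^sub>M {..<n} (\<lambda>_. N)) q"
    using cond_density_iff_distr[OF prob_space_axioms normalized_sum_meas vec_prefix_meas] qm by blast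
  then show ?thesis by blast
qed

section \<open>Integration over the conditioning variables\<close>

text \<open>The cost of one summand in the bound for frozen conditioning values; its
  \<nu>-expectation is finite under the moment assumptions of the theorem.\<close>

definition weight :: "'b \<Rightarrow> real" where "weight y = info y ^ 3 + moment6 y"

lemma weight_nonneg: "0 \<le> weight y"
  unfolding weight_def using info_nonneg moment6_nonneg by simp

lemma weight_meas[measurable]: "weight \<in> borel_measurable N"
  unfolding weight_def[abs_def] by measurable

definition KL_const :: "nat \<Rightarrow> real" where "KL_const n = 3000000 * real n powr (- 1 / 4)"

lemma KL_const_nonneg: "0 \<le> KL_const n" unfolding KL_const_def by simp

lemma AE_gauss_KL_le:
  assumes n: "4 \<le> n" and m6: "(\<integral>\<^sup>+\<omega>. ennreal ((X 0 \<omega>) ^ 6) \<partial>M) < \<infinity>"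
    and q: "cond_density M (normalized_sum X n) (vec_prefix Y n) (Pi\<^sub>M {..<n} (\<lambda>_. N)) q"
  shows "AE w in \<nu>n n. gauss_KL (q w) \<le> ennreal (KL_const n * ((\<Sum>j<n. weight (w j)) / real n + weight (w 0) + (3 + ln (real n))\<^sup>2))"
proof -
  have n0: "0 < n" using n by simp
  have "(\<integral>\<^sup>+\<omega>. ennreal ((X 0 \<omega>) ^ 6) \<partial>M) = (\<integral>\<^sup>+y. \<integral>\<^sup>+x. ennreal (p y x) * ennreal (x ^ 6) \<partial>lborel \<partial>\<nu>)"
    using joint_law0[of "\<lambda>v. ennreal (fst v ^ 6)"] by simp
  then have "AE y in \<nu>. (\<integral>\<^sup>+x. ennreal (p y x) * ennreal (x ^ 6) \<partial>lborel) \<noteq> \<infinity>"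
    using m6 by (intro nn_integral_noteq_infinite) auto
  then have "AE y in \<nu>. fisher_density (p y) (p' y) (info y) \<and> (\<integral>\<^sup>+x. ennreal (p y x) * ennreal (x ^ 6) \<partial>lborel) \<noteq> \<infinity>"
    using AE_fisher by eventually_elim auto
  from AE_coord[OF this] AE_regular[of n] AE_cond_density_eq_sum_law[OF n0 q]
  show ?thesis
  proof eventually_elim
    fix w assume w: "\<forall>i<n. fisher_density (p (w i)) (p' (w i)) (info (w i)) \<and> (\<integral>\<^sup>+x. ennreal (p (w i) x) * ennreal (x ^ 6) \<partial>lborel) \<noteq> \<infinity>"
      and reg: "regular n w" and law: "sum_law n w = density lborel (q w)"
    \<comment> \<open>The same continuation beyond \<open>n\<close> as in \<open>cond_laws\<close>,
      so that the hypotheses on the summands hold at every index.\<close>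
    define e where "e i = (if i < n then w i else w 0)" for i
    have fd: "fisher_density (p (e i)) (p' (e i)) (info (e i))"
      and i6: "(\<integral>\<^sup>+x. ennreal (p (e i) x) * ennreal (x ^ 6) \<partial>lborel) \<noteq> \<infinity>" for i
      using w n0 unfolding e_def by auto
    have pm[measurable]: "p (e i) \<in> borel_measurable borel" for i unfolding e_def by (rule regularD[OF reg n0])
    have nnd: "(\<integral>\<^sup>+x. ennreal (x ^ 6) \<partial>density lborel (p (e i))) = (\<integral>\<^sup>+x. ennreal (p (e i) x) * ennreal (x ^ 6) \<partial>lborel)" for i
      by (subst nn_integral_density) auto
    have int6: "integrable (density lborel (p (e i))) (\<lambda>x. x ^ 6)" for i
      by (rule integrableI_nonneg) (use i6[of i] in \<open>auto simp: nnd top.not_eq_extremum\<close>)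
    have mom: "(\<integral>x. x ^ 6 \<partial>density lborel (p (e i))) = moment6 (e i)" for i
      unfolding moment6_def nnd[symmetric] by (rule integral_eq_nn_integral) auto
    have "w \<in> space (Pi\<^sub>M {..<n} (\<lambda>_. N))" using reg unfolding regular_def by simp
    then have qm: "q w \<in> borel_measurable borel" and q0: "\<And>x. 0 \<le> q w x"
      using measurable_Pair2[of "\<lambda>(w, x). q w x"] q unfolding cond_density_def by force+
    have "gauss_KL (q w) \<le> ennreal (3000000 * real n powr (- 1 / 4) *
      ((\<Sum>j<n. info (e j) ^ 3 + (\<integral>x. x ^ 6 \<partial>density lborel (p (e j)))) / real n + info (e 0) ^ 3 + (3 + ln (real n))\<^sup>2))"
    proof (rule normalized_sum_gauss_KL_le[OF n fd int6 qm q0])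
      show "distr (Pi\<^sub>M {..<n} (\<lambda>j. density lborel (p (e j)))) borel (\<lambda>x. (\<Sum>j<n. x j) / sqrt (real n)) = density lborel (q w)"
        unfolding law[symmetric] sum_law_def cond_laws_def[abs_def] e_def ..
    qed
    also have "\<dots> \<le> ennreal (KL_const n * ((\<Sum>j<n. weight (w j)) / real n + weight (w 0) + (3 + ln (real n))\<^sup>2))"
    proof (rule ennreal_leI)
      have "(\<Sum>j<n. info (e j) ^ 3 + (\<integral>x. x ^ 6 \<partial>density lborel (p (e j)))) = (\<Sum>j<n. weight (w j))"
        unfolding mom by (intro sum.cong) (auto simp: weight_def e_def)
      moreover have "info (e 0) ^ 3 \<le> weight (w 0)" using n0 moment6_nonneg by (simp add: weight_def e_def)
      ultimately show "3000000 * real n powr (- 1 / 4) *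
        ((\<Sum>j<n. info (e j) ^ 3 + (\<integral>x. x ^ 6 \<partial>density lborel (p (e j)))) / real n + info (e 0) ^ 3 + (3 + ln (real n))\<^sup>2)
        \<le> KL_const n * ((\<Sum>j<n. weight (w j)) / real n + weight (w 0) + (3 + ln (real n))\<^sup>2)"
        unfolding KL_const_def by (intro mult_left_mono) auto
    qed
    finally show "gauss_KL (q w) \<le> ennreal (KL_const n * ((\<Sum>j<n. weight (w j)) / real n + weight (w 0) + (3 + ln (real n))\<^sup>2))" .
  qed
qed

lemma nn_integral_weight_coord:
  assumes "j < n"
  shows "(\<integral>\<^sup>+w. ennreal (weight (w j)) \<partial>\<nu>n n) = (\<integral>\<^sup>+y. ennreal (weight y) \<partial>\<nu>)"
proof -
  have d: "distr (\<nu>n n) \<nu> (\<lambda>w. w j) = \<nu>" unfolding \<nu>n_def by (rule distr_PiM_component) (use prob_\<nu> assms in auto)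
  have m: "(\<lambda>w. w j) \<in> measurable (\<nu>n n) \<nu>" unfolding \<nu>n_def by (rule measurable_component_singleton) (use assms in auto)
  have "(\<integral>\<^sup>+y. ennreal (weight y) \<partial>distr (\<nu>n n) \<nu> (\<lambda>w. w j)) = (\<integral>\<^sup>+w. ennreal (weight (w j)) \<partial>\<nu>n n)"
    by (rule nn_integral_distr[OF m]) measurable
  then show ?thesis unfolding d by simp
qed

text \<open>Each coordinate of the conditioning vector has law \<nu>, so the mean of the weights has
  expectation \<open>c\<close> and the extra weight of coordinate 0 another
  \<open>c\<close>.\<close>

lemma exp_cond_gauss_KL_le:
  assumes n: "4 \<le> n" and m6: "(\<integral>\<^sup>+\<omega>. ennreal ((X 0 \<omega>) ^ 6) \<partial>M) < \<infinity>"
    and wt: "(\<integral>\<^sup>+y. ennreal (weight y) \<partial>\<nu>) = ennreal c" "0 \<le> c"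
  shows "exp_cond_gauss_KL M (normalized_sum X n) (vec_prefix Y n) (Pi\<^sub>M {..<n} (\<lambda>_. N))
    \<le> ennreal (KL_const n * (2 * c + (3 + ln (real n))\<^sup>2))"
proof -
  have n0: "0 < n" using n by simp
  interpret Vn: prob_space "\<nu>n n" by (rule prob_\<nu>n)
  define q where "q = (SOME q. cond_density M (normalized_sum X n) (vec_prefix Y n) (Pi\<^sub>M {..<n} (\<lambda>_. N)) q)"
  have q: "cond_density M (normalized_sum X n) (vec_prefix Y n) (Pi\<^sub>M {..<n} (\<lambda>_. N)) q"
    unfolding q_def by (rule someI_ex[OF ex_cond_density[OF n0]])
  define K where "K = KL_const n"
  define L where "L = (3 + ln (real n))\<^sup>2"
  have K0: "0 \<le> K" "0 \<le> L" using KL_const_nonneg by (auto simp: K_def L_def)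
  have wm[measurable]: "(\<lambda>w. ennreal (weight (w j))) \<in> borel_measurable (\<nu>n n)" if "j < n" for j
    using measurable_compose[OF measurable_component_singleton[of j "{..<n}" "\<lambda>_. N"] weight_meas] that
    by (simp cong: measurable_cong_sets)
  have one: "emeasure (\<nu>n n) (space (Pi\<^sub>M {..<n} (\<lambda>_. N))) = 1" using Vn.emeasure_space_1 by simp
  have "exp_cond_gauss_KL M (normalized_sum X n) (vec_prefix Y n) (Pi\<^sub>M {..<n} (\<lambda>_. N)) = (\<integral>\<^sup>+w. gauss_KL (q w) \<partial>\<nu>n n)"
    unfolding exp_cond_gauss_KL_def q_def[symmetric] vec_prefix_law[OF n0] ..
  also have "\<dots> \<le> (\<integral>\<^sup>+w. ennreal (K * ((\<Sum>j<n. weight (w j)) / real n + weight (w 0) + L)) \<partial>\<nu>n n)"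
    unfolding K_def L_def by (rule nn_integral_mono_AE) (rule AE_gauss_KL_le[OF n m6 q])
  also have "\<dots> = (\<integral>\<^sup>+w. ennreal K * (ennreal (1 / real n) * (\<Sum>j<n. ennreal (weight (w j))) + ennreal (weight (w 0)) + ennreal L) \<partial>\<nu>n n)"
  proof (rule nn_integral_cong)
    fix w
    have "ennreal (1 / real n) * (\<Sum>j<n. ennreal (weight (w j))) = ennreal ((\<Sum>j<n. weight (w j)) / real n)"
      using weight_nonneg by (simp add: sum_nonneg ennreal_mult[symmetric])
    then show "ennreal (K * ((\<Sum>j<n. weight (w j)) / real n + weight (w 0) + L))
      = ennreal K * (ennreal (1 / real n) * (\<Sum>j<n. ennreal (weight (w j))) + ennreal (weight (w 0)) + ennreal L)"
      using weight_nonneg K0 by (simp add: ennreal_mult ennreal_plus sum_nonneg del: ennreal_plus add: ennreal_plus[symmetric])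
  qed
  also have "\<dots> = ennreal K * (ennreal (1 / real n) * (\<Sum>j<n. \<integral>\<^sup>+w. ennreal (weight (w j)) \<partial>\<nu>n n) + (\<integral>\<^sup>+w. ennreal (weight (w 0)) \<partial>\<nu>n n) + ennreal L)"
    using wm n0 by (simp add: nn_integral_cmult nn_integral_add nn_integral_sum one)
  also have "\<dots> = ennreal K * (ennreal (1 / real n) * (\<Sum>j<n. ennreal c) + ennreal c + ennreal L)"
    using nn_integral_weight_coord[of _ n] n0 wt by simp
  also have "ennreal (1 / real n) * (\<Sum>j<n. ennreal c) = ennreal c"
  proof -
    have "(\<Sum>j<n. ennreal c) = ennreal (real n * c)" using wt(2) by (simp add: ennreal_mult ennreal_of_nat_eq_real_of_nat)
    then show ?thesis using n0 wt(2) by (simp add: ennreal_mult[symmetric])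
  qed
  also have "ennreal K * (ennreal c + ennreal c + ennreal L) = ennreal (K * (2 * c + L))"
  proof -
    have "ennreal c + ennreal c + ennreal L = ennreal (2 * c + L)" using wt(2) K0 by (simp add: ennreal_plus[symmetric] del: ennreal_plus)
    then show ?thesis using wt(2) K0 by (simp only: ennreal_mult)
  qed
  finally show ?thesis unfolding K_def L_def .
qed

end

theorem theorem3p3:
  fixes M :: "'a measure" and N :: "'b measure"
    and X :: "nat \<Rightarrow> 'a \<Rightarrow> real" and Y :: "nat \<Rightarrow> 'a \<Rightarrow> 'b"
    and p :: "'b \<Rightarrow> real \<Rightarrow> real" and u k \<epsilon> :: real
  assumes "prob_space M"
    and "\<And>i. X i \<in> borel_measurable M"
    and "\<And>i. Y i \<in> measurable M N"
    and "prob_space.indep_vars M (\<lambda>_. borel \<Otimes>\<^sub>M N) (\<lambda>i \<omega>. (X i \<omega>, Y i \<omega>)) UNIV"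
    and "\<And>i. distr M (borel \<Otimes>\<^sub>M N) (\<lambda>\<omega>. (X i \<omega>, Y i \<omega>))
              = distr M (borel \<Otimes>\<^sub>M N) (\<lambda>\<omega>. (X 0 \<omega>, Y 0 \<omega>))"
    and "cond_density M (X 0) (Y 0) N p"
    and "AE y in distr M N (Y 0). abs_cont_real (p y)"
    and "u > 3" and "k > 6"
    and "(\<integral>\<^sup>+ \<omega>. ennreal (\<bar>X 0 \<omega>\<bar> powr k) \<partial>M) < \<infinity>"
    and "AE y in distr M N (Y 0). fisher_info (p y) < \<infinity>"
    and "(\<integral>\<^sup>+ y. ennreal (enn2real (fisher_info (p y)) powr u) \<partial>distr M N (Y 0)) < \<infinity>"
    and "6 / k + 3 / u < 1"
    and "0 < \<epsilon>"
    and "\<epsilon> < (1 - (6 / k + 3 / u)) / (4 + (6 / k + 3 / u))"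
  shows "\<exists>C. \<forall>\<^sub>F n in sequentially.
           exp_cond_gauss_KL M (normalized_sum X n) (vec_prefix Y n) (Pi\<^sub>M {..<n} (\<lambda>_. N))
           \<le> ennreal (C * (1 / real n) powr ((1 - (6 / k + 3 / u)) / (4 + (6 / k + 3 / u)) - \<epsilon>))"
proof -
  interpret prob_space M by fact
  interpret iid_conditional M N X Y p
    by (intro iid_conditional.intro iid_conditional_axioms.intro) (fact assms)+
  interpret iid_fisher M N X Y p
    by (intro iid_fisher.intro iid_fisher_axioms.intro iid_conditional_axioms)
      (use assms(7,11) in \<open>simp_all only: \<nu>_def\<close>)
  interpret V: prob_space \<nu> by (rule prob_\<nu>)
  \<comment> \<open>The exponents \<open>k\<close> and \<open>u\<close> need not be integers. The
    additive 1 pays for arguments below 1 and stays finite under a probability measure.\<close>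
  have pow: "a ^ m \<le> 1 + a powr r" if "0 \<le> a" "real m \<le> r" for a r :: real and m :: nat
  proof (cases "1 \<le> a")
    case True
    have "a ^ m = a powr real m" using True by (simp add: powr_realpow)
    also have "\<dots> \<le> a powr r" using True that by (intro powr_mono) auto
    finally show ?thesis by simp
  next
    case False
    then have "a ^ m \<le> 1" using that by (intro power_le_one) auto
    then show ?thesis using powr_ge_zero[of a r] by linarith
  qed
  have m6: "(\<integral>\<^sup>+\<omega>. ennreal ((X 0 \<omega>) ^ 6) \<partial>M) < \<infinity>"
  proof -
    have "(\<integral>\<^sup>+\<omega>. ennreal ((X 0 \<omega>) ^ 6) \<partial>M) \<le> (\<integral>\<^sup>+\<omega>. 1 + ennreal (\<bar>X 0 \<omega>\<bar> powr k) \<partial>M)"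
    proof (rule nn_integral_mono)
      fix \<omega>
      have "(X 0 \<omega>) ^ 6 \<le> 1 + \<bar>X 0 \<omega>\<bar> powr k" using pow[of "\<bar>X 0 \<omega>\<bar>" 6 k] assms(9) by (simp add: power_even_abs)
      then have "ennreal ((X 0 \<omega>) ^ 6) \<le> ennreal (1 + \<bar>X 0 \<omega>\<bar> powr k)" by (rule ennreal_leI)
      then show "ennreal ((X 0 \<omega>) ^ 6) \<le> 1 + ennreal (\<bar>X 0 \<omega>\<bar> powr k)" by simp
    qed
    also have "\<dots> = 1 + (\<integral>\<^sup>+\<omega>. ennreal (\<bar>X 0 \<omega>\<bar> powr k) \<partial>M)" by (subst nn_integral_add) (auto simp: emeasure_space_1)
    also have "\<dots> < \<infinity>" using assms(10) by simp
    finally show ?thesis .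
  qed
  have J3: "(\<integral>\<^sup>+y. ennreal (info y ^ 3) \<partial>\<nu>) < \<infinity>"
  proof -
    have eq: "(\<integral>\<^sup>+y. ennreal (info y powr u) \<partial>\<nu>) = (\<integral>\<^sup>+ y. ennreal (enn2real (fisher_info (p y)) powr u) \<partial>\<nu>)"
      by (rule nn_integral_cong_AE, use AE_fisher in eventually_elim) auto
    have "(\<integral>\<^sup>+y. ennreal (info y ^ 3) \<partial>\<nu>) \<le> (\<integral>\<^sup>+y. 1 + ennreal (info y powr u) \<partial>\<nu>)"
    proof (rule nn_integral_mono)
      fix y
      have "info y ^ 3 \<le> 1 + info y powr u" using pow[OF info_nonneg, of 3 u] assms(8) by simp
      then have "ennreal (info y ^ 3) \<le> ennreal (1 + info y powr u)" by (rule ennreal_leI)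
      then show "ennreal (info y ^ 3) \<le> 1 + ennreal (info y powr u)" by simp
    qed
    also have "\<dots> = 1 + (\<integral>\<^sup>+y. ennreal (info y powr u) \<partial>\<nu>)" using V.emeasure_space_1 by (subst nn_integral_add) auto
    also have "\<dots> < \<infinity>" unfolding eq using assms(12) by (simp add: \<nu>_def)
    finally show ?thesis .
  qed
  have "(\<integral>\<^sup>+y. ennreal (moment6 y) \<partial>\<nu>) \<le> (\<integral>\<^sup>+y. \<integral>\<^sup>+x. ennreal (p y x) * ennreal (x ^ 6) \<partial>lborel \<partial>\<nu>)"
    unfolding moment6_def by (intro nn_integral_mono) (simp add: ennreal_enn2real_if)
  also have "\<dots> = (\<integral>\<^sup>+\<omega>. ennreal ((X 0 \<omega>) ^ 6) \<partial>M)" using joint_law0[of "\<lambda>v. ennreal (fst v ^ 6)"] by simp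
  finally have M6: "(\<integral>\<^sup>+y. ennreal (moment6 y) \<partial>\<nu>) < \<infinity>" using m6 by (rule le_less_trans)
  have "(\<integral>\<^sup>+y. ennreal (weight y) \<partial>\<nu>) = (\<integral>\<^sup>+y. ennreal (info y ^ 3) \<partial>\<nu>) + (\<integral>\<^sup>+y. ennreal (moment6 y) \<partial>\<nu>)"
    unfolding weight_def using info_nonneg moment6_nonneg
    by (subst nn_integral_add[symmetric]) (auto simp: ennreal_plus)
  also have "\<dots> < \<infinity>" using J3 M6 by simp
  finally obtain c where c: "(\<integral>\<^sup>+y. ennreal (weight y) \<partial>\<nu>) = ennreal c" "0 \<le> c"
    by (metis ennreal_cases infinity_ennreal_def less_irrefl)
  define \<alpha> where "\<alpha> = 6 / k + 3 / u"
  have \<alpha>: "0 < \<alpha>" "\<alpha> < 1" using assms(8,9,13) by (auto simp: \<alpha>_def intro!: add_pos_pos divide_pos_pos)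
  define r where "r = (1 - \<alpha>) / (4 + \<alpha>) - \<epsilon>"
  \<comment> \<open>Positivity of \<alpha> puts the exponent strictly below 1/4; the remaining power
    of \<open>n\<close> absorbs the squared logarithm.\<close>
  have "(1 - \<alpha>) / (4 + \<alpha>) < 1 / 4" using \<alpha> by (simp add: divide_less_eq)
  then have r: "r < 1 / 4" using assms(14) by (simp add: r_def)
  have "(\<lambda>n::nat. 3000000 * real n powr (- 1 / 4) * (2 * c + (3 + ln (real n))\<^sup>2)) \<in> o(\<lambda>n. real n powr (- r))"
    using r by real_asymp
  then have "(\<lambda>n::nat. KL_const n * (2 * c + (3 + ln (real n))\<^sup>2)) \<in> o(\<lambda>n. real n powr (- r))"
    unfolding KL_const_def .
  \<comment> \<open>Strict domination in the exponent makes the ratio tend to zero, so the constant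
    \<open>C = 1\<close> is good enough for all large \<open>n\<close>.\<close>
  from landau_o.smallD[OF this, of 1]
  have ev: "\<forall>\<^sub>F n in sequentially. \<bar>KL_const n * (2 * c + (3 + ln (real n))\<^sup>2)\<bar> \<le> real n powr (- r)" by simp
  have "\<forall>\<^sub>F n in sequentially. exp_cond_gauss_KL M (normalized_sum X n) (vec_prefix Y n) (Pi\<^sub>M {..<n} (\<lambda>_. N))
           \<le> ennreal (1 * (1 / real n) powr r)"
    using ev eventually_ge_at_top[of 4]
  proof eventually_elim
    fix n :: nat assume 1: "\<bar>KL_const n * (2 * c + (3 + ln (real n))\<^sup>2)\<bar> \<le> real n powr (- r)" and n: "4 \<le> n"
    have "exp_cond_gauss_KL M (normalized_sum X n) (vec_prefix Y n) (Pi\<^sub>M {..<n} (\<lambda>_. N))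
      \<le> ennreal (KL_const n * (2 * c + (3 + ln (real n))\<^sup>2))" by (rule exp_cond_gauss_KL_le[OF n m6 c])
    also have "\<dots> \<le> ennreal (real n powr (- r))" using 1 by (intro ennreal_leI) linarith
    also have "real n powr (- r) = 1 * (1 / real n) powr r" using n by (simp add: powr_minus_divide powr_divide)
    finally show "exp_cond_gauss_KL M (normalized_sum X n) (vec_prefix Y n) (Pi\<^sub>M {..<n} (\<lambda>_. N)) \<le> ennreal (1 * (1 / real n) powr r)" .
  qed
  then show ?thesis unfolding r_def \<alpha>_def by (rule exI[of _ 1])
qed

end
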